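(* Let $N$ be a compact smooth Riemannian manifold, let $\widetilde A$ be a diffeomorphism of $\mathbb{T}^2$, and let $$f(x,y)=(\widetilde A(x),K(x,y))\quad\text{on}\quad \mathbb{T}^2\times N$$ be a skew product $C^{1+}$ diffeomorphism. Then there does not exist a physical measure of $f$ for which all the Lyapunov exponents along the $Df$-invariant subbundle $TN$ are positive.
   Context: $C^{1+}$ means $C^1$ with Hölder derivative. The subbundle $TN$ of $T(\mathbb{T}^2\times N)$ is the one tangent to the fibers $\{x\}\times N$. An $f$-invariant probability measure $\mu$ on $M=\mathbb{T}^2\times N$ is a physical measure if the set $$B(\mu)=\Big\{z\in M:\ \lim_{n\to+\infty}\tfrac1n\sum_{j=0}^{n-1}\varphi(f^j(z))=\int\varphi\,d\mu\ \ \forall\varphi\in C^0(M)\Big\}$$ has positive Lebesgue measure. "All Lyapunov exponents along $TN$ are positive" means that for $\mu$-almost every point all Lyapunov exponents of $Df$ restricted to $TN$ are positive. *)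

theory Defs
  imports "HOL-Probability.Probability"
begin

section \<open>Smooth manifolds, tangent vectors and differentials\<close>

text \<open>A chart is a pair of a domain and a coordinate map; the values of the coordinate map
  outside the domain are irrelevant. An atlas is a set of charts on a type. The model
  space is a type of class \<^class>\<open>euclidean_space\<close>, so manifolds have dimension at least one.\<close>

type_synonym ('a, 'e) chart = "'a set \<times> ('a \<Rightarrow> 'e)"

definition chart_inv :: "('a, 'e) chart \<Rightarrow> 'e \<Rightarrow> 'a" where
  "chart_inv c = inv_into (fst c) (snd c)"

text \<open>Class \<open>C\<^sup>k\<close> on an open set, by means of iterated directional derivatives.\<close>

fun Ck_on :: "nat \<Rightarrow> ('a::euclidean_space \<Rightarrow> 'b::real_normed_vector) \<Rightarrow> 'a set \<Rightarrow> bool" where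
  "Ck_on 0 f S \<longleftrightarrow> continuous_on S f"
| "Ck_on (Suc k) f S \<longleftrightarrow> (\<forall>x\<in>S. f differentiable (at x)) \<and>
     (\<forall>v. Ck_on k (\<lambda>x. frechet_derivative f (at x) v) S)"

definition smooth_on :: "'a set \<Rightarrow> ('a::euclidean_space \<Rightarrow> 'b::real_normed_vector) \<Rightarrow> bool" where
  "smooth_on S f \<longleftrightarrow> (\<forall>k. Ck_on k f S)"

text \<open>The Hausdorff property and second countability are left to the sort of the type
  \<^typ>\<open>'a\<close>.\<close>

definition smooth_atlas :: "('a::topological_space, 'e::euclidean_space) chart set \<Rightarrow> bool" where
  "smooth_atlas A \<longleftrightarrow>
     (\<Union>c\<in>A. fst c) = UNIV \<and>
     (\<forall>c\<in>A. open (fst c) \<and> open (snd c ` fst c) \<and>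
        homeomorphism (fst c) (snd c ` fst c) (snd c) (chart_inv c)) \<and>
     (\<forall>c\<in>A. \<forall>d\<in>A. smooth_on (snd c ` (fst c \<inter> fst d)) (snd d \<circ> chart_inv c))"

definition prod_atlas ::
  "('a, 'e) chart set \<Rightarrow> ('b, 'f) chart set \<Rightarrow> ('a \<times> 'b, 'e \<times> 'f) chart set" where
  "prod_atlas A B = (\<lambda>(c, d). (fst c \<times> fst d, map_prod (snd c) (snd d))) ` (A \<times> B)"

text \<open>A tangent vector at \<open>p\<close> is its family of coordinate vectors in the charts around \<open>p\<close>,
  which are related by the derivatives of the coordinate changes. The entries for charts
  that do not contain \<open>p\<close> are set to zero, so the zero vector is the zero family.\<close>

type_synonym ('a, 'e) tangent = "('a, 'e) chart \<Rightarrow> 'e"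

definition tangent_space ::
  "('a, 'e::euclidean_space) chart set \<Rightarrow> 'a \<Rightarrow> ('a, 'e) tangent set" where
  "tangent_space A p = {v.
     (\<forall>c\<in>A. \<forall>d\<in>A. p \<in> fst c \<inter> fst d \<longrightarrow>
        v d = frechet_derivative (snd d \<circ> chart_inv c) (at (snd c p)) (v c)) \<and>
     (\<forall>c. \<not> (c \<in> A \<and> p \<in> fst c) \<longrightarrow> v c = 0)}"

definition chart_at :: "('a, 'e) chart set \<Rightarrow> 'a \<Rightarrow> ('a, 'e) chart" where
  "chart_at A p = (SOME c. c \<in> A \<and> p \<in> fst c)"

definition differential ::
  "('a, 'e::euclidean_space) chart set \<Rightarrow> ('b, 'f::euclidean_space) chart set \<Rightarrow>
   ('a \<Rightarrow> 'b) \<Rightarrow> 'a \<Rightarrow> ('a, 'e) tangent \<Rightarrow> ('b, 'f) tangent" where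
  "differential A B F p v = (\<lambda>d. if d \<in> B \<and> F p \<in> fst d
     then let c = chart_at A p in
       frechet_derivative (snd d \<circ> F \<circ> chart_inv c) (at (snd c p)) (v c)
     else 0)"

text \<open>The tangent vector at \<open>p\<close> whose coordinate vector in the chart \<open>c\<close> is \<open>a\<close>.\<close>

definition coord_vector ::
  "('a, 'e::euclidean_space) chart set \<Rightarrow> ('a, 'e) chart \<Rightarrow> 'a \<Rightarrow> 'e \<Rightarrow> ('a, 'e) tangent" where
  "coord_vector A c p a = (\<lambda>d. if d \<in> A \<and> p \<in> fst d
     then frechet_derivative (snd d \<circ> chart_inv c) (at (snd c p)) a else 0)"


section \<open>Maps of class \<open>C\<^sup>1\<close> and \<open>C\<^sup>1\<^sup>+\<close>\<close>

definition C1_map ::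
  "('a::topological_space, 'e::euclidean_space) chart set \<Rightarrow>
   ('b::topological_space, 'f::euclidean_space) chart set \<Rightarrow> ('a \<Rightarrow> 'b) \<Rightarrow> bool" where
  "C1_map A B F \<longleftrightarrow> continuous_on UNIV F \<and>
     (\<forall>c\<in>A. \<forall>d\<in>B. Ck_on 1 (snd d \<circ> F \<circ> chart_inv c) (snd c ` (fst c \<inter> F -` fst d)))"

text \<open>Hoelder continuity of the derivative is required locally in charts, with a common
  exponent. On a compact manifold this is the same as global Hoelder continuity.\<close>

definition C1plus_map ::
  "('a::topological_space, 'e::euclidean_space) chart set \<Rightarrow>
   ('b::topological_space, 'f::euclidean_space) chart set \<Rightarrow> ('a \<Rightarrow> 'b) \<Rightarrow> bool" where
  "C1plus_map A B F \<longleftrightarrow> C1_map A B F \<and>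
     (\<exists>\<alpha>. 0 < \<alpha> \<and> \<alpha> \<le> 1 \<and>
       (\<forall>c\<in>A. \<forall>d\<in>B. \<forall>p\<in>fst c \<inter> F -` fst d.
         \<exists>W C. open W \<and> snd c p \<in> W \<and> W \<subseteq> snd c ` (fst c \<inter> F -` fst d) \<and>
           (\<forall>x\<in>W. \<forall>y\<in>W.
              onorm (\<lambda>v. frechet_derivative (snd d \<circ> F \<circ> chart_inv c) (at x) v -
                         frechet_derivative (snd d \<circ> F \<circ> chart_inv c) (at y) v)
              \<le> C * dist x y powr \<alpha>)))"

definition C1_diffeo ::
  "('a::topological_space, 'e::euclidean_space) chart set \<Rightarrow> ('a \<Rightarrow> 'a) \<Rightarrow> bool" where
  "C1_diffeo A F \<longleftrightarrow> bij F \<and> C1_map A A F \<and> C1_map A A (inv F)"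

definition C1plus_diffeo ::
  "('a::topological_space, 'e::euclidean_space) chart set \<Rightarrow> ('a \<Rightarrow> 'a) \<Rightarrow> bool" where
  "C1plus_diffeo A F \<longleftrightarrow> bij F \<and> C1plus_map A A F \<and> C1plus_map A A (inv F)"


section \<open>Riemannian metrics and volume\<close>

type_synonym ('a, 'e) metric = "'a \<Rightarrow> ('a, 'e) tangent \<Rightarrow> ('a, 'e) tangent \<Rightarrow> real"

definition riemannian_metric ::
  "('a, 'e::euclidean_space) chart set \<Rightarrow> ('a, 'e) metric \<Rightarrow> bool" where
  "riemannian_metric A g \<longleftrightarrow>
     (\<forall>p. \<forall>u\<in>tangent_space A p. \<forall>v\<in>tangent_space A p.
        g p u v = g p v u \<and>
        (\<forall>w\<in>tangent_space A p. g p (\<lambda>c. u c + v c) w = g p u w + g p v w) \<and>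
        (\<forall>r. g p (\<lambda>c. r *\<^sub>R u c) v = r * g p u v) \<and>
        (u \<noteq> (\<lambda>c. 0) \<longrightarrow> 0 < g p u u)) \<and>
     (\<forall>c\<in>A. \<forall>a b. smooth_on (snd c ` fst c)
        (\<lambda>x. g (chart_inv c x) (coord_vector A c (chart_inv c x) a)
                               (coord_vector A c (chart_inv c x) b)))"

definition prod_metric ::
  "('a, 'e::euclidean_space) chart set \<Rightarrow> ('a, 'e) metric \<Rightarrow>
   ('b, 'f::euclidean_space) chart set \<Rightarrow> ('b, 'f) metric \<Rightarrow> ('a \<times> 'b, 'e \<times> 'f) metric" where
  "prod_metric A g B h z u v =
     g (fst z) (differential (prod_atlas A B) A fst z u) (differential (prod_atlas A B) A fst z v) +
     h (snd z) (differential (prod_atlas A B) B snd z u) (differential (prod_atlas A B) B snd z v)"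

text \<open>The determinant of the Gram matrix \<open>(g\<^sub>i\<^sub>j)\<close> in the chart \<open>c\<close>, by the Leibniz formula
  over the standard basis of the model space.\<close>

definition gram_det ::
  "('a, 'e::euclidean_space) chart set \<Rightarrow> ('a, 'e) metric \<Rightarrow> ('a, 'e) chart \<Rightarrow> 'a \<Rightarrow> real" where
  "gram_det A g c p = (\<Sum>\<pi> | \<pi> permutes (Basis :: 'e set). of_int (sign \<pi>) *
     (\<Prod>b\<in>Basis. g p (coord_vector A c p b) (coord_vector A c p (\<pi> b))))"

definition chart_volume ::
  "('a, 'e::euclidean_space) chart set \<Rightarrow> ('a, 'e) metric \<Rightarrow> ('a, 'e) chart \<Rightarrow> 'a set \<Rightarrow> ennreal" where
  "chart_volume A g c S =
     (\<integral>\<^sup>+x. ennreal (sqrt (gram_det A g c (chart_inv c x))) * indicator (snd c ` S) x \<partial>lborel)"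

text \<open>Lebesgue measure on a Riemannian manifold is the Riemannian volume: the (outer) measure
  obtained from the chart volumes \<open>\<integral> \<surd>det g dx\<close> by covering with countably many Borel sets that
  lie in chart domains.\<close>

definition riemannian_volume ::
  "('a::topological_space, 'e::euclidean_space) chart set \<Rightarrow> ('a, 'e) metric \<Rightarrow> 'a set \<Rightarrow> ennreal" where
  "riemannian_volume A g S =
     (INF P \<in> {P :: nat \<Rightarrow> ('a, 'e) chart \<times> 'a set.
         (\<forall>i. fst (P i) \<in> A \<and> snd (P i) \<in> sets borel \<and> snd (P i) \<subseteq> fst (fst (P i))) \<and>
         S \<subseteq> (\<Union>i. snd (P i))}.
       \<Sum>i. chart_volume A g (fst (P i)) (snd (P i)))"


section \<open>The torus \<open>\<real>\<^sup>2/\<int>\<^sup>2\<close>\<close>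

definition torus_rel :: "real \<times> real \<Rightarrow> real \<times> real \<Rightarrow> bool" where
  "torus_rel p q \<longleftrightarrow> fst p - fst q \<in> \<int> \<and> snd p - snd q \<in> \<int>"

lemma equivp_torus_rel: "equivp torus_rel"
proof (rule equivpI)
  show "reflp torus_rel"
    by (simp add: reflp_def torus_rel_def)
  show "symp torus_rel"
    unfolding symp_def torus_rel_def by (metis Ints_minus minus_diff_eq)
  show "transp torus_rel"
    unfolding transp_def torus_rel_def by (metis Ints_add diff_add_cancel add_diff_eq)
qed

quotient_type torus2 = "real \<times> real" / torus_rel
  morphisms torus_rep torus_proj
  by (rule equivp_torus_rel)

instantiation torus2 :: topological_space
begin

definition open_torus2 :: "torus2 set \<Rightarrow> bool" where
  "open_torus2 U \<longleftrightarrow> open (torus_proj -` U)"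

instance
proof
  show "open (UNIV :: torus2 set)"
    by (simp add: open_torus2_def)
  show "open (S \<inter> T)" if "open S" "open T" for S T :: "torus2 set"
    using that by (simp add: open_torus2_def vimage_Int open_Int)
  show "open (\<Union>K)" if "\<forall>S\<in>K. open S" for K :: "torus2 set set"
    using that by (auto simp: open_torus2_def vimage_Union)
qed

end

text \<open>The charts are the local inverses of the projection \<open>\<real>\<^sup>2 \<rightarrow> \<real>\<^sup>2/\<int>\<^sup>2\<close>.\<close>

definition torus_atlas :: "(torus2, real \<times> real) chart set" where
  "torus_atlas = {(torus_proj ` W, inv_into W torus_proj) | W. open W \<and> inj_on torus_proj W}"

text \<open>The coordinate changes of the torus are locally translations, so the flat metric does
  not depend on the chart.\<close>

definition torus_metric :: "(torus2, real \<times> real) metric" where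
  "torus_metric x u v = u (chart_at torus_atlas x) \<bullet> v (chart_at torus_atlas x)"


section \<open>Physical measures and Lyapunov exponents along the fibres\<close>

abbreviation total_atlas ::
  "('n, 'e::euclidean_space) chart set \<Rightarrow> (torus2 \<times> 'n, (real \<times> real) \<times> 'e) chart set" where
  "total_atlas A \<equiv> prod_atlas torus_atlas A"

abbreviation total_metric ::
  "('n, 'e::euclidean_space) chart set \<Rightarrow> ('n, 'e) metric \<Rightarrow>
   (torus2 \<times> 'n, (real \<times> real) \<times> 'e) metric" where
  "total_metric A g \<equiv> prod_metric torus_atlas torus_metric A g"

definition basin :: "('a::topological_space \<Rightarrow> 'a) \<Rightarrow> 'a measure \<Rightarrow> 'a set" where
  "basin f \<mu> = {z. \<forall>\<phi> :: 'a \<Rightarrow> real. continuous_on UNIV \<phi> \<longrightarrow>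
     (\<lambda>n. (\<Sum>j<n. \<phi> ((f ^^ j) z)) / real n) \<longlonglongrightarrow> (\<integral>z. \<phi> z \<partial>\<mu>)}"

definition physical_measure ::
  "('a::topological_space, 'e::euclidean_space) chart set \<Rightarrow> ('a, 'e) metric \<Rightarrow>
   ('a \<Rightarrow> 'a) \<Rightarrow> 'a measure \<Rightarrow> bool" where
  "physical_measure A g f \<mu> \<longleftrightarrow>
     prob_space \<mu> \<and> sets \<mu> = sets borel \<and> distr \<mu> borel f = \<mu> \<and>
     0 < riemannian_volume A g (basin f \<mu>)"

text \<open>The Lyapunov exponent in a direction is an upper limit, so that it is defined for every
  point and every nonzero vector. By the Oseledets theorem it is a limit for almost every point
  with respect to an invariant probability measure.\<close>

definition lyapunov_exponent ::
  "('a, 'e::euclidean_space) chart set \<Rightarrow> ('a, 'e) metric \<Rightarrow>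
   ('a \<Rightarrow> 'a) \<Rightarrow> 'a \<Rightarrow> ('a, 'e) tangent \<Rightarrow> ereal" where
  "lyapunov_exponent A g f z v = limsup (\<lambda>n.
     let w = differential A A (f ^^ n) z v
     in ereal (ln (sqrt (g ((f ^^ n) z) w w)) / real n))"

text \<open>The fibre of \<open>TN\<close> at \<open>(x, y)\<close>, as the image of \<open>T\<^sub>y N\<close> under the differential of the
  inclusion \<open>y \<mapsto> (x, y)\<close>.\<close>

definition fibre_tangent_space ::
  "('n, 'e::euclidean_space) chart set \<Rightarrow> torus2 \<times> 'n \<Rightarrow>
   (torus2 \<times> 'n, (real \<times> real) \<times> 'e) tangent set" where
  "fibre_tangent_space A z =
     differential A (total_atlas A) (Pair (fst z)) (snd z) ` tangent_space A (snd z)"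

definition fibre_exponents_positive ::
  "('n::topological_space, 'e::euclidean_space) chart set \<Rightarrow> ('n, 'e) metric \<Rightarrow>
   (torus2 \<times> 'n \<Rightarrow> torus2 \<times> 'n) \<Rightarrow> (torus2 \<times> 'n) measure \<Rightarrow> bool" where
  "fibre_exponents_positive A g f \<mu> \<longleftrightarrow>
     (AE z in \<mu>. \<forall>v\<in>fibre_tangent_space A z. v \<noteq> (\<lambda>c. 0) \<longrightarrow>
        0 < lyapunov_exponent (total_atlas A) (total_metric A g) f z v)"

end

(* Let mu be an invariant probability measure with positive fibre exponents, and let
   phi_n(z) be the logarithm of the least factor by which Df^n expands a vector of TN at z.

   (1) Some phi_m has positive integral. Instead of the Oseledets theorem one uses invariant sets
   on which every vector eventually grows at some fixed rate l > 0. Finite-dimensionality and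
   compactness show that they exhaust the space as l tends to 0, and on most of such a set the
   waiting time is bounded by some N. Cutting an orbit into blocks of growing vectors and a few
   bad steps bounds phi_n from below by l n minus a small error.

   (2) phi_m is continuous, so its time averages converge to the positive integral at every point
   of the basin, and superadditivity makes phi_n(z) tend to infinity there along n = m k + m.

   (3) On a fibre {x} x N, the inverse of f^n contracts the f^n-image of the set where phi_n is
   large by a large factor. A Lipschitz image with small constant of a bounded set has small
   volume, and the images stay in the compact manifold N, so the basin meets every fibre in a
   null set. By Fubini the basin has volume zero. *)

theory Submission imports Defs begin

section \<open>Volume of contracted images\<close>

text \<open>Coordinates are taken in charts selected pointwise, so the derivatives of the iterates,
  read there, jump with the base point. The cocycle locale therefore asks for continuity only after
  a local change of frame; the growth of a vector, unlike its coordinates, does not depend on the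
  chart. The measure need not be ergodic, and positive exponents may come arbitrarily close to zero.
  One rate cannot serve almost every point: the gain on a set with a definite rate has to beat the
  loss on a remainder where nothing is known, and two rates are played against each other.
  Membership in the basin controls averages over all iterates of \<open>f\<close>, while
  superadditivity joins steps of length \<open>m\<close>. Splitting the times by their residue mod
  \<open>m\<close> reconciles the two. In the fibres, the images under the iterates are compact but
  need not be convex in charts, so a small derivative of the inverse gives no Lipschitz bound along
  segments. A covering argument at shrinking scales takes the place of the mean value
  theorem.\<close>

text \<open>Vitali selects disjoint balls of a small radius \<delta> whose fivefold enlargements
  cover \<open>T\<close>. Comparing volumes, there are at most
  \<open>((R + 1) / \<delta>) ^ DIM('e)\<close> of them. Each enlarged ball is sent into one of
  radius \<open>5 * \<delta> * \<epsilon>\<close>, and \<delta> cancels.\<close>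

lemma emeasure_locally_lipschitz_image_le:
  fixes h :: "'e::euclidean_space \<Rightarrow> 'e"
  assumes "compact T" "T \<subseteq> cball 0 R" "0 \<le> R" "0 < s" "0 \<le> \<epsilon>"
    and lip: "\<And>a b. a \<in> T \<Longrightarrow> b \<in> T \<Longrightarrow> dist a b < s \<Longrightarrow> dist (h a) (h b) \<le> \<epsilon> * dist a b"
  shows "emeasure lborel (h ` T) \<le> ennreal (unit_ball_vol DIM('e) * (5 * \<epsilon> * (R + 1)) ^ DIM('e))"
proof -
  \<comment> \<open>\<open>s / 6\<close> leaves \<open>5 * \<delta> < s\<close>, so the Lipschitz
    bound applies within each enlarged ball; the cap 1 keeps the small balls inside
    \<open>cball 0 (R + 1)\<close>.\<close>
  define \<delta> where "\<delta> = min 1 (s / 6)"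
  have \<delta>: "0 < \<delta>" "\<delta> \<le> 1" "5 * \<delta> < s"
    using \<open>0 < s\<close> by (auto simp: \<delta>_def min_def)
  let ?d = "DIM('e)" and ?\<omega> = "unit_ball_vol (real DIM('e))"
  have \<omega>: "0 < ?\<omega>" by simp
  obtain C where C: "C \<subseteq> T" "pairwise (\<lambda>i j. disjnt (ball i \<delta>) (ball j \<delta>)) C"
      "T \<subseteq> (\<Union>i\<in>C. ball i (5 * \<delta>))"
    by (rule Vitali_covering_lemma_balls[where S = T and K = T and a = "\<lambda>x. x" and r = "\<lambda>_. \<delta>" and B = \<delta>])
      (use \<delta> in auto)
  have count: "real (card F) * \<delta> ^ ?d \<le> (R + 1) ^ ?d" if F: "finite F" "F \<subseteq> C" for F
  proof -
    have disj: "disjoint_family_on (\<lambda>i. ball i \<delta>) F"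
      using C(2) F(2) unfolding disjoint_family_on_def pairwise_def disjnt_def by blast
    have sub: "(\<Union>i\<in>F. ball i \<delta>) \<subseteq> cball 0 (R + 1)"
    proof
      fix x assume "x \<in> (\<Union>i\<in>F. ball i \<delta>)"
      then obtain i where "i \<in> F" "dist i x < \<delta>" by auto
      moreover have "norm i \<le> R" using \<open>i \<in> F\<close> F C assms(2) by fastforce
      ultimately show "x \<in> cball 0 (R + 1)"
        using \<delta> by (simp add: dist_norm) (smt (verit) norm_minus_commute norm_triangle_sub)
    qed
    have "(\<Sum>i\<in>F. emeasure lborel (ball i \<delta>)) = emeasure lborel (\<Union>i\<in>F. ball i \<delta>)"
      by (rule sum_emeasure) (use disj F in auto)
    also have "\<dots> \<le> emeasure lborel (cball (0::'e) (R + 1))"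
      by (rule emeasure_mono[OF sub]) auto
    finally have "ennreal (real (card F) * (?\<omega> * \<delta> ^ ?d)) \<le> ennreal (?\<omega> * (R + 1) ^ ?d)"
      using \<delta> assms(3) by (simp add: emeasure_ball emeasure_cball ennreal_mult' ennreal_of_nat_eq_real_of_nat)
    then have "real (card F) * (?\<omega> * \<delta> ^ ?d) \<le> ?\<omega> * (R + 1) ^ ?d"
      using assms(3) by (subst (asm) ennreal_le_iff) (auto intro!: mult_nonneg_nonneg)
    then have "?\<omega> * (real (card F) * \<delta> ^ ?d) \<le> ?\<omega> * (R + 1) ^ ?d"
      by (simp add: algebra_simps)
    then show ?thesis using \<omega> by (simp only: mult_le_cancel_left_pos)
  qed
  have finC: "finite C"
  proof (rule finite_if_finite_subsets_card_bdd[THEN conjunct1])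
    show "\<And>G. G \<subseteq> C \<Longrightarrow> finite G \<Longrightarrow> card G \<le> nat \<lceil>(R + 1) ^ ?d / \<delta> ^ ?d\<rceil>"
      using count \<delta> by (smt (verit) divide_le_eq le_nat_iff of_nat_le_iff pos_le_divide_eq real_nat_ceiling_ge zero_less_power)
  qed
  have "emeasure lborel (h ` T) \<le> emeasure lborel (\<Union>i\<in>C. cball (h i) (5 * \<delta> * \<epsilon>))"
  proof (rule emeasure_mono)
    show "h ` T \<subseteq> (\<Union>i\<in>C. cball (h i) (5 * \<delta> * \<epsilon>))"
    proof
      fix y assume "y \<in> h ` T"
      then obtain b where b: "b \<in> T" "y = h b" by auto
      then obtain i where i: "i \<in> C" "dist i b < 5 * \<delta>" using C(3) by auto
      then have "dist (h i) (h b) \<le> \<epsilon> * dist i b"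
        using b C(1) \<delta> by (intro lip) auto
      also have "\<dots> \<le> \<epsilon> * (5 * \<delta>)" using i assms(5) by (intro mult_left_mono) auto
      finally show "y \<in> (\<Union>i\<in>C. cball (h i) (5 * \<delta> * \<epsilon>))" using i b by (auto simp: algebra_simps)
    qed
    show "(\<Union>i\<in>C. cball (h i) (5 * \<delta> * \<epsilon>)) \<in> sets lborel" using finC by (intro sets.finite_UN) auto
  qed
  also have "\<dots> \<le> (\<Sum>i\<in>C. emeasure lborel (cball (h i) (5 * \<delta> * \<epsilon>)))"
    by (rule emeasure_subadditive_finite) (use finC in auto)
  also have "\<dots> = ennreal (real (card C) * (?\<omega> * (5 * \<delta> * \<epsilon>) ^ ?d))"
    using \<delta> assms(5) by (simp add: emeasure_cball ennreal_mult' ennreal_of_nat_eq_real_of_nat)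
  also have "\<dots> \<le> ennreal (?\<omega> * (5 * \<epsilon> * (R + 1)) ^ ?d)"
  proof (rule ennreal_leI)
    have "real (card C) * (?\<omega> * (5 * \<delta> * \<epsilon>) ^ ?d) = (real (card C) * \<delta> ^ ?d) * (?\<omega> * (5 * \<epsilon>) ^ ?d)"
      by (simp add: power_mult_distrib)
    also have "\<dots> \<le> (R + 1) ^ ?d * (?\<omega> * (5 * \<epsilon>) ^ ?d)"
      by (rule mult_right_mono[OF count[OF finC order_refl]]) (use assms(5) in auto)
    also have "\<dots> = ?\<omega> * (5 * \<epsilon> * (R + 1)) ^ ?d" by (simp add: power_mult_distrib)
    finally show "real (card C) * (?\<omega> * (5 * \<delta> * \<epsilon>) ^ ?d) \<le> ?\<omega> * (5 * \<epsilon> * (R + 1)) ^ ?d" .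
  qed
  finally show ?thesis .
qed

text \<open>The derivative bound gives the Lipschitz estimate at each point below a scale that
  depends on the point. Sorting the points by that scale exhausts \<open>T\<close> by compact sets
  to which the previous lemma applies with the same bound; continuity from below passes it to
  \<open>T\<close>.\<close>

lemma emeasure_contracting_image_le:
  fixes h :: "'e::euclidean_space \<Rightarrow> 'e"
  assumes "compact T" "T \<subseteq> cball 0 R" "0 \<le> R"
    and deriv: "\<And>b. b \<in> T \<Longrightarrow> (h has_derivative h' b) (at b within T)"
    and small: "\<And>b. b \<in> T \<Longrightarrow> onorm (h' b) < \<epsilon>"
  shows "emeasure lborel (h ` T) \<le> ennreal (unit_ball_vol DIM('e) * (5 * \<epsilon> * (R + 1)) ^ DIM('e))"
proof (cases "T = {}")
  case False
  then have \<epsilon>: "0 < \<epsilon>"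
    using small onorm_pos_le[OF has_derivative_bounded_linear[OF deriv]] by fastforce
  have cont: "continuous_on T h"
    by (rule has_derivative_continuous_on[OF deriv])
  define P where "P k = {a\<in>T. \<forall>b\<in>T. dist a b < 1 / Suc k \<longrightarrow> dist (h a) (h b) \<le> \<epsilon> * dist a b}" for k :: nat
  have "closed (P k)" for k
    unfolding closed_sequential_limits
  proof (intro allI impI, elim conjE)
    fix u a assume u: "\<forall>n. u n \<in> P k" "u \<longlonglongrightarrow> a"
    have aT: "a \<in> T" using u compact_imp_closed[OF assms(1)]
      unfolding closed_sequential_limits P_def by blast
    show "a \<in> P k" unfolding P_def
    proof (intro CollectI conjI ballI impI aT)
      fix b assume b: "b \<in> T" "dist a b < 1 / Suc k"
      have "(\<lambda>n. dist (u n) b) \<longlonglongrightarrow> dist a b" using u by (intro tendsto_intros)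
      then have ev: "eventually (\<lambda>n. dist (u n) b < 1 / Suc k) sequentially"
        using b by (auto elim: order_tendstoD(2))
      have "(\<lambda>n. h (u n)) \<longlonglongrightarrow> h a"
        using cont u aT by (auto simp: continuous_on_sequentially P_def comp_def)
      then have "(\<lambda>n. dist (h (u n)) (h b)) \<longlonglongrightarrow> dist (h a) (h b)" by (intro tendsto_intros)
      moreover have "(\<lambda>n. \<epsilon> * dist (u n) b) \<longlonglongrightarrow> \<epsilon> * dist a b" using u by (intro tendsto_intros)
      moreover have "eventually (\<lambda>n. dist (h (u n)) (h b) \<le> \<epsilon> * dist (u n) b) sequentially"
        using ev by eventually_elim (use u b in \<open>auto simp: P_def\<close>)
      ultimately show "dist (h a) (h b) \<le> \<epsilon> * dist a b"
        using tendsto_le[OF sequentially_bot] by blast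
    qed
  qed
  then have comp: "compact (P k)" for k
    using assms(1) by (metis (no_types, lifting) P_def closed_Int_compact inf.absorb_iff1 mem_Collect_eq subsetI)
  have subT: "P k \<subseteq> T" for k by (auto simp: P_def)
  have T_eq: "T = (\<Union>k. P k)"
  proof
    show "T \<subseteq> (\<Union>k. P k)"
    proof
      fix a assume a: "a \<in> T"
      \<comment> \<open>The strict bound on \<open>onorm (h' a)\<close> leaves the margin
        \<open>\<epsilon> - onorm (h' a)\<close> for the remainder term of the derivative.\<close>
      obtain d where d: "0 < d" "\<And>b. b \<in> T \<Longrightarrow> norm (b - a) < d \<Longrightarrow>
          norm (h b - h a - h' a (b - a)) \<le> (\<epsilon> - onorm (h' a)) * norm (b - a)"
        using deriv[OF a] small[OF a] unfolding has_derivative_within_alt by (metis diff_gt_0_iff_gt)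
      obtain k where k: "1 / Suc k < d" using d(1) nat_approx_posE by blast
      have "a \<in> P k" unfolding P_def
      proof (intro CollectI conjI ballI impI a)
        fix b assume b: "b \<in> T" "dist a b < 1 / Suc k"
        have "norm (h b - h a) \<le> norm (h b - h a - h' a (b - a)) + norm (h' a (b - a))"
          by (metis diff_add_cancel norm_triangle_ineq)
        also have "\<dots> \<le> (\<epsilon> - onorm (h' a)) * norm (b - a) + onorm (h' a) * norm (b - a)"
        proof (rule add_mono)
          show "norm (h b - h a - h' a (b - a)) \<le> (\<epsilon> - onorm (h' a)) * norm (b - a)"
            using d(2)[OF b(1)] b(2) k by (simp add: dist_norm norm_minus_commute)
        qed (rule onorm[OF has_derivative_bounded_linear[OF deriv[OF a]]])
        finally show "dist (h a) (h b) \<le> \<epsilon> * dist a b"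
          by (simp add: dist_norm norm_minus_commute algebra_simps)
      qed
      then show "a \<in> (\<Union>k. P k)" by blast
    qed
  qed (use subT in auto)
  have inc: "incseq (\<lambda>k. h ` P k)"
  proof (rule incseq_SucI)
    fix k
    have "1 / real (Suc (Suc k)) \<le> 1 / real (Suc k)" by (simp add: field_simps)
    then show "h ` P k \<subseteq> h ` P (Suc k)" unfolding P_def by (intro image_mono) force
  qed
  have meas: "range (\<lambda>k. h ` P k) \<subseteq> sets lborel"
    using comp compact_continuous_image[OF continuous_on_subset[OF cont subT]]
    by (auto intro!: borel_compact)
  have "emeasure lborel (h ` T) = emeasure lborel (\<Union>k. h ` P k)"
    by (subst T_eq) (simp add: image_UN)
  also have "\<dots> = (SUP k. emeasure lborel (h ` P k))"
    by (rule SUP_emeasure_incseq[OF meas inc, symmetric])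
  also have "\<dots> \<le> ennreal (unit_ball_vol DIM('e) * (5 * \<epsilon> * (R + 1)) ^ DIM('e))"
  proof (rule SUP_least)
    fix k
    show "emeasure lborel (h ` P k) \<le> ennreal (unit_ball_vol DIM('e) * (5 * \<epsilon> * (R + 1)) ^ DIM('e))"
      by (rule emeasure_locally_lipschitz_image_le[where s = "1 / Suc k"])
        (use comp subT assms(2,3) \<epsilon> in \<open>auto simp: P_def\<close>)
  qed
  finally show ?thesis .
qed auto

section \<open>Linear cocycles over a compact space\<close>

text \<open>Tube lemma: finitely many boxes cover the compact slice over \<open>z\<close>, and the
  intersection of their base sides is the required neighbourhood. It makes a condition on all unit
  vectors an open condition on the base point.\<close>

lemma open_tube:
  fixes W :: "('z::topological_space \<times> 'e::topological_space) set"
  assumes U: "open U" and S: "compact S" and W: "openin (top_of_set (U \<times> S)) W"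
  shows "open {z\<in>U. \<forall>a\<in>S. (z, a) \<in> W}"
proof (subst open_subopen, intro ballI)
  fix z assume "z \<in> {z\<in>U. \<forall>a\<in>S. (z, a) \<in> W}"
  then have z: "z \<in> U" "\<And>a. a \<in> S \<Longrightarrow> (z, a) \<in> W" by auto
  obtain V where V: "open V" "W = (U \<times> S) \<inter> V"
    using W by (auto simp: openin_open)
  have "\<exists>A B. a \<in> S \<longrightarrow> open A \<and> open B \<and> z \<in> A \<and> a \<in> B \<and> A \<times> B \<subseteq> V" for a
  proof (cases "a \<in> S")
    case True
    then have "(z, a) \<in> V" using z V(2) by auto
    then obtain A B where "open A" "open B" "(z, a) \<in> A \<times> B" "A \<times> B \<subseteq> V"
      by (rule open_prod_elim[OF V(1)])
    then show ?thesis by blast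
  qed auto
  then obtain A B where AB: "\<And>a. a \<in> S \<Longrightarrow> open (A a) \<and> open (B a) \<and> z \<in> A a \<and> a \<in> B a \<and> A a \<times> B a \<subseteq> V"
    by metis
  obtain F where F: "F \<subseteq> S" "finite F" "S \<subseteq> (\<Union>a\<in>F. B a)"
    by (rule compactE_image[OF S, of S B]) (use AB in auto)
  have "open (U \<inter> (\<Inter>a\<in>F. A a))" using F AB U by (intro open_Int open_INT) auto
  moreover have "z \<in> U \<inter> (\<Inter>a\<in>F. A a)" using F AB z by auto
  moreover have "U \<inter> (\<Inter>a\<in>F. A a) \<subseteq> {z\<in>U. \<forall>a\<in>S. (z, a) \<in> W}"
  proof safe
    fix w a assume w: "w \<in> U" "w \<in> (\<Inter>a\<in>F. A a)" "a \<in> S"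
    then obtain b where "b \<in> F" "a \<in> B b" using F by auto
    then have "(w, a) \<in> V" using w AB[of b] F by auto
    then show "(w, a) \<in> W" using V w by auto
  qed
  ultimately show "\<exists>T. open T \<and> z \<in> T \<and> T \<subseteq> {z\<in>U. \<forall>a\<in>S. (z, a) \<in> W}" by blast
qed

text \<open>An abstract derivative cocycle: \<open>M n z\<close> is the derivative of the
  \<open>n\<close>-th iterate in frames chosen point by point, and \<open>\<rho> z\<close> is a
  squared norm. As the frames may jump, \<open>local_cont\<close> asks for continuity only along a
  local family \<open>T\<close> of frame changes. \<open>\<rho>_add\<close> is the weak triangle
  inequality that holds for squared norms; it makes sets of slowly growing vectors into
  subspaces.\<close>

locale linear_cocycle =
  fixes f :: "'z::topological_space \<Rightarrow> 'z"
    and M :: "nat \<Rightarrow> 'z \<Rightarrow> 'e::euclidean_space \<Rightarrow> 'e"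
    and \<rho> :: "'z \<Rightarrow> 'e \<Rightarrow> real"
  assumes cont_f: "continuous_on UNIV f"
    and compact_base: "compact (UNIV :: 'z set)"
    and M_linear: "linear (M n z)"
    and M_inj: "inj (M n z)"
    and M_0: "M 0 z a = a"
    and M_add: "M (n + k) z a = M k ((f ^^ n) z) (M n z a)"
    and \<rho>_pos: "a \<noteq> 0 \<Longrightarrow> 0 < \<rho> z a"
    and \<rho>_scale: "\<rho> z (t *\<^sub>R a) = t\<^sup>2 * \<rho> z a"
    and \<rho>_add: "\<rho> z (a + b) \<le> 2 * \<rho> z a + 2 * \<rho> z b"
    and local_cont: "\<exists>U (T :: 'z \<Rightarrow> 'e \<Rightarrow> 'e). open U \<and> z \<in> U \<and> (\<forall>w\<in>U. linear (T w) \<and> bij (T w)) \<and>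
      (\<forall>n. continuous_on (U \<times> UNIV) (\<lambda>(w, a). \<rho> ((f ^^ n) w) (M n w (T w a))))"
begin

text \<open>Since \<open>\<rho>\<close> is quadratic, \<open>growth\<close> is twice the logarithm of the factor by which the norm
  grows.\<close>

definition growth :: "nat \<Rightarrow> 'z \<Rightarrow> 'e \<Rightarrow> real" where
  "growth n z a = ln (\<rho> ((f ^^ n) z) (M n z a)) - ln (\<rho> z a)"

text \<open>Twice the logarithm of the conorm, hence \<open>2 * phi_n\<close> in the notation of the
  overview.\<close>

definition min_growth :: "nat \<Rightarrow> 'z \<Rightarrow> real" where
  "min_growth n z = (INF a\<in>-{0}. growth n z a)"

lemma M_eq_0_iff: "M n z a = 0 \<longleftrightarrow> a = 0"
  using inj_eq[OF M_inj, of n z a 0] linear_0[OF M_linear, of n z] by simp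

lemma growth_0 [simp]: "growth 0 z a = 0"
  by (simp add: growth_def M_0)

lemma growth_add: "growth (n + k) z a = growth n z a + growth k ((f ^^ n) z) (M n z a)"
proof -
  have "(f ^^ (n + k)) z = (f ^^ k) ((f ^^ n) z)"
    using funpow_add[of k n f] by (simp add: add.commute)
  then show ?thesis by (simp add: growth_def M_add)
qed

lemma growth_scale:
  assumes "t \<noteq> 0" "a \<noteq> 0"
  shows "growth n z (t *\<^sub>R a) = growth n z a"
  using assms \<rho>_pos[of a z] \<rho>_pos[of "M n z a" "(f ^^ n) z"]
  by (simp add: growth_def linear_scale[OF M_linear] \<rho>_scale ln_mult M_eq_0_iff)

lemma growth_normalize: "a \<noteq> 0 \<Longrightarrow> growth n z (a /\<^sub>R norm a) = growth n z a"
  by (rule growth_scale) auto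

lemma local_chart:
  obtains U and T :: "'z \<Rightarrow> 'e \<Rightarrow> 'e" where "open U" "z \<in> U" "\<And>w. w \<in> U \<Longrightarrow> linear (T w)" "\<And>w. w \<in> U \<Longrightarrow> bij (T w)"
    "\<And>n. continuous_on (U \<times> sphere 0 1) (\<lambda>(w, a). growth n w (T w a))"
proof -
  obtain U and T :: "'z \<Rightarrow> 'e \<Rightarrow> 'e" where *: "open U \<and> z \<in> U \<and>
      (\<forall>w\<in>U. linear (T w) \<and> bij (T w)) \<and>
      (\<forall>n. continuous_on (U \<times> UNIV) (\<lambda>(w, a). \<rho> ((f ^^ n) w) (M n w (T w a))))"
    using local_cont[of z] by (elim exE)
  then have UT: "open U" "z \<in> U" "\<And>w. w \<in> U \<Longrightarrow> linear (T w) \<and> bij (T w)" by auto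
  have cont: "continuous_on (U \<times> UNIV) (\<lambda>(w, a). \<rho> ((f ^^ n) w) (M n w (T w a)))" for n
    using * by simp
  have nz: "T w a \<noteq> 0" if "w \<in> U" "norm a = 1" for w a
    using UT(3)[OF that(1)] that(2) inj_eq[of "T w" a 0] linear_0[of "T w"]
    by (auto simp: bij_def)
  have c: "continuous_on (U \<times> sphere 0 1) (\<lambda>p. \<rho> ((f ^^ n) (fst p)) (M n (fst p) (T (fst p) (snd p))))" for n
    using continuous_on_subset[OF cont, of "U \<times> sphere 0 1"] by (auto simp: case_prod_beta)
  have "continuous_on (U \<times> sphere 0 1) (\<lambda>(w, a). growth n w (T w a))" for n
    unfolding growth_def case_prod_beta
  proof (intro continuous_intros c ballI)
    show "continuous_on (U \<times> sphere 0 1) (\<lambda>p. \<rho> (fst p) (T (fst p) (snd p)))"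
      using c[of 0] by (simp add: M_0)
    show "\<rho> (fst p) (T (fst p) (snd p)) \<noteq> 0" if "p \<in> U \<times> sphere 0 1" for p
      using that \<rho>_pos[OF nz[of "fst p" "snd p"], of "fst p"] by auto
    show "\<rho> ((f ^^ n) (fst p)) (M n (fst p) (T (fst p) (snd p))) \<noteq> 0"
      if "p \<in> U \<times> sphere 0 1" for p
      using that nz[of "fst p" "snd p"] \<rho>_pos[of "M n (fst p) (T (fst p) (snd p))" "(f ^^ n) (fst p)"]
      by (auto simp: M_eq_0_iff)
  qed
  then show thesis by (intro that[of U T]) (use UT in auto)
qed

section \<open>Semicontinuity and superadditivity of the least growth\<close>

text \<open>The image of the unit sphere under a linear bijection meets every ray, so a scale
  invariant property may be tested there. This allows the compact sphere of the local frame to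
  replace the noncompact set of nonzero vectors.\<close>

lemma all_nonzero_iff_sphere:
  fixes T :: "'e \<Rightarrow> 'e"
  assumes "linear T" "bij T"
    and "\<And>t a. t \<noteq> 0 \<Longrightarrow> a \<noteq> 0 \<Longrightarrow> P (t *\<^sub>R a) \<longleftrightarrow> P a"
  shows "(\<forall>a. a \<noteq> 0 \<longrightarrow> P a) \<longleftrightarrow> (\<forall>b\<in>sphere 0 1. P (T b))"
proof safe
  have T0: "T b = 0 \<longleftrightarrow> b = 0" for b
    using inj_eq[of T b 0] linear_0[OF assms(1)] assms(2) by (simp add: bij_def)
  show "P (T b)" if "\<forall>a. a \<noteq> 0 \<longrightarrow> P a" "b \<in> sphere 0 1" for b
    using that T0[of b] by auto
  show "P a" if *: "\<forall>b\<in>sphere 0 1. P (T b)" and "a \<noteq> 0" for a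
  proof -
    obtain b where b: "a = T b" using assms(2) by (metis bij_pointE)
    then have "b \<noteq> 0" using \<open>a \<noteq> 0\<close> T0 by auto
    have "P (T (b /\<^sub>R norm b))" using * \<open>b \<noteq> 0\<close> by auto
    then show "P a" using assms(3)[of "inverse (norm b)" a] \<open>b \<noteq> 0\<close> \<open>a \<noteq> 0\<close>
      by (simp add: b linear_scale[OF assms(1)])
  qed
qed

text \<open>The tube lemma in a local frame. The time is chosen after the vector, so the condition
  on a pair of point and vector is a union of open ones. The case \<open>I = {n}\<close> serves
  \<open>min_growth\<close>, the case \<open>I = {1..N}\<close> serves \<open>fast\<close>.\<close>

lemma open_growth_greater: "open {z. \<forall>a. a \<noteq> 0 \<longrightarrow> (\<exists>n\<in>I. c n < growth n z a)}"
proof (subst open_subopen, intro ballI)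
  fix z assume z: "z \<in> {z. \<forall>a. a \<noteq> 0 \<longrightarrow> (\<exists>n\<in>I. c n < growth n z a)}"
  obtain U and T :: "'z \<Rightarrow> 'e \<Rightarrow> 'e" where UT: "open U" "z \<in> U" "\<And>w. w \<in> U \<Longrightarrow> linear (T w)" "\<And>w. w \<in> U \<Longrightarrow> bij (T w)"
    "\<And>n. continuous_on (U \<times> sphere 0 1) (\<lambda>(w, a). growth n w (T w a))"
    using local_chart[of z] by blast
  define W where "W = (\<Union>n\<in>I. U \<times> sphere 0 1 \<inter> (\<lambda>(w, a). growth n w (T w a)) -` {c n<..})"
  have "openin (top_of_set (U \<times> sphere 0 1)) W"
    unfolding W_def by (intro openin_Union ballI)
      (auto intro!: continuous_openin_preimage_gen UT)
  from open_tube[OF UT(1) compact_sphere this]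
  have "open {w\<in>U. \<forall>b\<in>sphere 0 1. (w, b) \<in> W}" .
  moreover have "{w\<in>U. \<forall>b\<in>sphere 0 1. (w, b) \<in> W} =
      U \<inter> {z. \<forall>a. a \<noteq> 0 \<longrightarrow> (\<exists>n\<in>I. c n < growth n z a)}"
  proof (rule set_eqI)
    fix w
    show "w \<in> {w\<in>U. \<forall>b\<in>sphere 0 1. (w, b) \<in> W} \<longleftrightarrow>
      w \<in> U \<inter> {z. \<forall>a. a \<noteq> 0 \<longrightarrow> (\<exists>n\<in>I. c n < growth n z a)}"
    proof (cases "w \<in> U")
      case True
      have "(\<forall>a. a \<noteq> 0 \<longrightarrow> (\<exists>n\<in>I. c n < growth n w a)) \<longleftrightarrow>
         (\<forall>b\<in>sphere 0 1. (\<exists>n\<in>I. c n < growth n w (T w b)))"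
        by (rule all_nonzero_iff_sphere) (use UT True growth_scale in auto)
      then show ?thesis using True by (simp add: W_def)
    qed auto
  qed
  ultimately show "\<exists>S. open S \<and> z \<in> S \<and> S \<subseteq> {z. \<forall>a. a \<noteq> 0 \<longrightarrow> (\<exists>n\<in>I. c n < growth n z a)}"
    using z UT by blast
qed

text \<open>A witness at \<open>z\<close> is written as \<open>T z b\<close> and carried along as
  \<open>T w b\<close> with the same frame coordinates \<open>b\<close>; it remains a witness
  nearby.\<close>

lemma open_growth_less: "open {z. \<exists>a. a \<noteq> 0 \<and> growth n z a < c}"
proof (subst open_subopen, intro ballI)
  fix z assume "z \<in> {z. \<exists>a. a \<noteq> 0 \<and> growth n z a < c}"
  then have z: "\<not> (\<forall>a. a \<noteq> 0 \<longrightarrow> \<not> growth n z a < c)" by auto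
  obtain U and T :: "'z \<Rightarrow> 'e \<Rightarrow> 'e" where UT: "open U" "z \<in> U" "\<And>w. w \<in> U \<Longrightarrow> linear (T w)" "\<And>w. w \<in> U \<Longrightarrow> bij (T w)"
    "\<And>n. continuous_on (U \<times> sphere 0 1) (\<lambda>(w, a). growth n w (T w a))"
    using local_chart[of z] by blast
  have iff: "(\<forall>a. a \<noteq> 0 \<longrightarrow> \<not> growth n w a < c) \<longleftrightarrow> (\<forall>b\<in>sphere 0 1. \<not> growth n w (T w b) < c)"
    if "w \<in> U" for w
    by (rule all_nonzero_iff_sphere) (use UT that growth_scale in auto)
  then obtain b where b: "b \<in> sphere 0 1" "growth n z (T z b) < c" using z UT(2) by auto
  have "continuous_on U ((\<lambda>(w, a). growth n w (T w a)) \<circ> (\<lambda>w. (w, b)))"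
    by (rule continuous_on_compose)
      (use b in \<open>auto intro!: continuous_intros continuous_on_subset[OF UT(5)]\<close>)
  then have "open (U \<inter> ((\<lambda>(w, a). growth n w (T w a)) \<circ> (\<lambda>w. (w, b))) -` {..<c})"
    using UT(1) by (intro continuous_open_preimage) auto
  moreover have "U \<inter> ((\<lambda>(w, a). growth n w (T w a)) \<circ> (\<lambda>w. (w, b))) -` {..<c}
      \<subseteq> {z. \<exists>a. a \<noteq> 0 \<and> growth n z a < c}"
  proof
    fix w assume "w \<in> U \<inter> ((\<lambda>(w, a). growth n w (T w a)) \<circ> (\<lambda>w. (w, b))) -` {..<c}"
    then show "w \<in> {z. \<exists>a. a \<noteq> 0 \<and> growth n z a < c}" using iff[of w] b(1) by fastforce
  qed
  ultimately show "\<exists>S. open S \<and> z \<in> S \<and> S \<subseteq> {z. \<exists>a. a \<noteq> 0 \<and> growth n z a < c}"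
    using b UT(2) by (intro exI conjI) auto
qed

lemma min_growth_attained:
  obtains a where "a \<noteq> 0" "min_growth n z = growth n z a" "\<And>b. b \<noteq> 0 \<Longrightarrow> growth n z a \<le> growth n z b"
proof -
  obtain U and T :: "'z \<Rightarrow> 'e \<Rightarrow> 'e" where UT: "open U" "z \<in> U" "\<And>w. w \<in> U \<Longrightarrow> linear (T w)" "\<And>w. w \<in> U \<Longrightarrow> bij (T w)"
    "\<And>n. continuous_on (U \<times> sphere 0 1) (\<lambda>(w, a). growth n w (T w a))"
    using local_chart[of z] by blast
  have cont: "continuous_on (sphere 0 1) ((\<lambda>(w, a). growth n w (T w a)) \<circ> (\<lambda>a. (z, a)))"
    by (rule continuous_on_compose)
      (use UT(2) in \<open>auto intro!: continuous_intros continuous_on_subset[OF UT(5)]\<close>)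
  have "sphere (0::'e) 1 \<noteq> {}" by simp
  from continuous_attains_inf[OF compact_sphere this cont]
  obtain b where b: "b \<in> sphere 0 1" "\<And>a. a \<in> sphere 0 1 \<Longrightarrow> growth n z (T z b) \<le> growth n z (T z a)"
    by auto
  have iff: "(\<forall>a. a \<noteq> 0 \<longrightarrow> growth n z (T z b) \<le> growth n z a) \<longleftrightarrow>
      (\<forall>a\<in>sphere 0 1. growth n z (T z b) \<le> growth n z (T z a))"
    by (rule all_nonzero_iff_sphere) (use UT growth_scale in auto)
  have le: "growth n z (T z b) \<le> growth n z a" if "a \<noteq> 0" for a
    using iff b that by blast
  have "T z b \<noteq> 0"
    using inj_eq[of "T z" b 0] linear_0[OF UT(3)[OF UT(2)]] UT(4)[OF UT(2)] b(1) by (auto simp: bij_def)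
  moreover have "min_growth n z = growth n z (T z b)"
    unfolding min_growth_def using le \<open>T z b \<noteq> 0\<close> by (intro cInf_eq_minimum) auto
  ultimately show thesis using le that by blast
qed

lemma min_growth_le: "a \<noteq> 0 \<Longrightarrow> min_growth n z \<le> growth n z a"
  by (rule min_growth_attained[of n z]) auto

text \<open>Attainment of the infimum preserves the strict inequality; the openness of upper rays in
  \<open>continuous_min_growth\<close> depends on it.\<close>

lemma min_growth_greater_iff: "c < min_growth n z \<longleftrightarrow> (\<forall>a. a \<noteq> 0 \<longrightarrow> c < growth n z a)"
  using min_growth_le[of _ n z] by (rule_tac min_growth_attained[of n z]) (auto intro: less_le_trans)

lemma min_growth_ge_iff: "c \<le> min_growth n z \<longleftrightarrow> (\<forall>a. a \<noteq> 0 \<longrightarrow> c \<le> growth n z a)"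
  using min_growth_le[of _ n z] by (rule_tac min_growth_attained[of n z]) (auto intro: order_trans)

lemma min_growth_0 [simp]: "min_growth 0 z = 0"
  by (rule min_growth_attained[of 0 z]) simp

text \<open>The two stretches are minimized separately. By injectivity the image of a nonzero vector
  is an admissible competitor on the second stretch.\<close>

lemma min_growth_superadd: "min_growth n z + min_growth k ((f ^^ n) z) \<le> min_growth (n + k) z"
  unfolding min_growth_ge_iff growth_add
  by (intro allI impI add_mono min_growth_le) (auto simp: M_eq_0_iff)

lemma continuous_min_growth: "continuous_on UNIV (min_growth n)"
proof (rule continuous_on_generate_topology[OF open_generated_order])
  fix B :: "real set" assume "B \<in> range lessThan \<union> range greaterThan"
  then consider c where "B = {..<c}" | c where "B = {c<..}" by auto
  then have "open (min_growth n -` B)"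
  proof cases
    case 1
    have "min_growth n -` B = {z. \<exists>a. a \<noteq> 0 \<and> growth n z a < c}"
      using min_growth_ge_iff[of c n] by (auto simp: 1 not_less[symmetric])
    then show ?thesis using open_growth_less by simp
  next
    case 2
    have "min_growth n -` B = {z. \<forall>a. a \<noteq> 0 \<longrightarrow> (\<exists>k\<in>{n}. c < growth k z a)}"
      using min_growth_greater_iff[of c n] by (auto simp: 2)
    then show ?thesis using open_growth_greater[of "{n}" "\<lambda>_. c"] by simp
  qed
  then show "\<exists>C. open C \<and> C \<inter> UNIV = min_growth n -` B \<inter> UNIV" by auto
qed

lemma min_growth_1_bound: obtains C where "0 \<le> C" "\<And>z. - C \<le> min_growth 1 z"
proof -
  have "bounded (range (min_growth 1))"
    using compact_base continuous_min_growth by (intro compact_imp_bounded compact_continuous_image)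
  then obtain C where "\<And>z. \<bar>min_growth 1 z\<bar> \<le> C"
    by (auto simp: bounded_iff)
  then show thesis using that[of C] by (meson abs_ge_zero abs_le_D2 minus_le_iff order_trans)
qed

lemma min_growth_bound:
  assumes "\<And>z. - C \<le> min_growth 1 z"
  shows "- C * real n \<le> min_growth n z"
proof (induction n arbitrary: z)
  case (Suc n)
  have "- C * real (Suc n) \<le> min_growth 1 z + min_growth n ((f ^^ 1) z)"
    using Suc[of "f z"] assms[of z] by (simp add: algebra_simps)
  also have "\<dots> \<le> min_growth (Suc n) z" using min_growth_superadd[of 1 z n] by simp
  finally show ?case .
qed simp

section \<open>Points where all vectors grow within a bounded time\<close>

text \<open>The time may depend on the vector and only its bound \<open>N\<close> is common. Upper
  limits taken vector by vector can deliver this much, whereas they give no single time at which all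
  vectors have grown.\<close>

definition fast :: "real \<Rightarrow> nat \<Rightarrow> 'z set" where
  "fast l N = {z. \<forall>a. a \<noteq> 0 \<longrightarrow> (\<exists>n\<in>{1..N}. l * real n < growth n z a)}"

lemma open_fast: "open (fast l N)"
  unfolding fast_def by (rule open_growth_greater)

text \<open>The orbit of the vector is cut greedily. At a fast point it jumps over a block of length
  at most \<open>N\<close> that gains the rate \<open>l\<close>; at any other point it makes one
  step, which loses at most \<open>C\<close> and forgoes \<open>l\<close>. Hence the charge
  \<open>C + l\<close> for each bad time.\<close>

lemma growth_block_bound:
  assumes C: "0 \<le> C" "\<And>z. - C \<le> min_growth 1 z" and l: "0 \<le> l" and a: "a \<noteq> 0"
  shows "l * real n - (C + l) * (real (card {j. j < n \<and> (f ^^ j) z \<notin> fast l N}) + real N) \<le> growth n z a"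
  using a
proof (induction n arbitrary: z a rule: less_induct)
  case (less n)
  define bad where "bad n z = {j. j < n \<and> (f ^^ j) z \<notin> fast l N}" for n z
  have fin: "finite (bad n z)" for n z by (simp add: bad_def)
  have shift: "(\<lambda>j. j + k) ` bad (n - k) ((f ^^ k) z) \<subseteq> bad n z" for k
    by (auto simp: bad_def funpow_add)
  have card_shift: "card ((\<lambda>j. j + k) ` bad (n - k) ((f ^^ k) z)) = card (bad (n - k) ((f ^^ k) z))" for k
    by (rule card_image) simp
  show ?case
  proof (cases "z \<in> fast l N")
    case True
    then obtain k where k: "1 \<le> k" "k \<le> N" "l * real k < growth k z a"
      using less.prems by (fastforce simp: fast_def)
    show ?thesis
    proof (cases "k \<le> n")
      case True
      have ne: "M k z a \<noteq> 0" using less.prems M_eq_0_iff by auto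
      have "l * real (n - k) - (C + l) * (real (card (bad (n - k) ((f ^^ k) z))) + real N) \<le>
          growth (n - k) ((f ^^ k) z) (M k z a)"
        unfolding bad_def by (rule less.IH) (use k True ne in auto)
      moreover have "card (bad (n - k) ((f ^^ k) z)) \<le> card (bad n z)"
        using card_mono[OF fin shift] card_shift by metis
      then have "(C + l) * (real (card (bad (n - k) ((f ^^ k) z))) + real N) \<le> (C + l) * (real (card (bad n z)) + real N)"
        using C l by (intro mult_left_mono) auto
      moreover have "growth n z a = growth k z a + growth (n - k) ((f ^^ k) z) (M k z a)"
        using growth_add[of k "n - k" z a] True by simp
      moreover have "l * real n = l * real k + l * real (n - k)" using True by (simp add: of_nat_diff algebra_simps)
      ultimately show ?thesis using k(3) unfolding bad_def by linarith
    next
      case False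
      \<comment> \<open>The block overruns \<open>n\<close>, so fewer than \<open>N\<close> steps
        remain. The allowance \<open>(C + l) * real N\<close> pays for this last, incomplete
        block.\<close>
      then have "(C + l) * real n \<le> (C + l) * (real (card (bad n z)) + real N)"
        using C l k by (intro mult_left_mono) auto
      moreover have "- C * real n \<le> growth n z a"
        using min_growth_bound[OF C(2), of n z] min_growth_le[OF less.prems, of n z] by linarith
      ultimately show ?thesis unfolding bad_def by (simp add: algebra_simps)
    qed
  next
    case z: False
    show ?thesis
    proof (cases "n = 0")
      case True
      then show ?thesis using C l by simp
    next
      case False
      have ne: "M 1 z a \<noteq> 0" using less.prems M_eq_0_iff by auto
      have "l * real (n - 1) - (C + l) * (real (card (bad (n - 1) ((f ^^ 1) z))) + real N) \<le>
          growth (n - 1) ((f ^^ 1) z) (M 1 z a)"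
        unfolding bad_def by (rule less.IH) (use False ne in auto)
      moreover have "card (bad (n - 1) ((f ^^ 1) z)) + 1 \<le> card (bad n z)"
      proof -
        \<comment> \<open>Time 0 is itself bad and lies outside the shifted set; this extra 1 pays
          for the step just made.\<close>
        have "insert 0 ((\<lambda>j. j + 1) ` bad (n - 1) ((f ^^ 1) z)) \<subseteq> bad n z"
          using z False shift[of 1] by (auto simp: bad_def)
        from card_mono[OF fin this] show ?thesis
          using card_shift[of 1] fin by (subst (asm) card_insert_disjoint) auto
      qed
      then have "(C + l) * (real (card (bad (n - 1) ((f ^^ 1) z))) + real N + 1) \<le> (C + l) * (real (card (bad n z)) + real N)"
        using C l by (intro mult_left_mono) auto
      moreover have "growth n z a = growth 1 z a + growth (n - 1) ((f ^^ 1) z) (M 1 z a)"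
        using growth_add[of 1 "n - 1" z a] False by simp
      moreover have "- C \<le> growth 1 z a"
        using C(2)[of z] min_growth_le[OF less.prems, of 1 z] by linarith
      moreover have "l * real n = l + l * real (n - 1)" using False by (simp add: of_nat_diff algebra_simps)
      ultimately show ?thesis unfolding bad_def by (simp add: algebra_simps)
    qed
  qed
qed

lemma continuous_growth: "continuous_on (- {0}) (growth n z)"
proof -
  obtain U and T :: "'z \<Rightarrow> 'e \<Rightarrow> 'e" where *: "open U \<and> z \<in> U \<and>
      (\<forall>w\<in>U. linear (T w) \<and> bij (T w)) \<and>
      (\<forall>n. continuous_on (U \<times> UNIV) (\<lambda>(w, a). \<rho> ((f ^^ n) w) (M n w (T w a))))"
    using local_cont[of z] by (elim exE)
  have T: "linear (T z)" "bij (T z)" using * by auto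
  have inv: "T z (inv (T z) a) = a" for a
    using T(2) by (simp add: bij_def surj_f_inv_f)
  have lin: "linear (inv (T z))"
    using T by (simp add: bij_def inj_linear_imp_inv_linear)
  have c: "continuous_on A (\<lambda>a. \<rho> ((f ^^ n) z) (M n z a))" for n A
  proof -
    have "continuous_on A ((\<lambda>(w, a). \<rho> ((f ^^ n) w) (M n w (T w a))) \<circ> (\<lambda>a. (z, inv (T z) a)))"
    proof (rule continuous_on_compose)
      show "continuous_on A (\<lambda>a. (z, inv (T z) a))"
        using linear_continuous_on_compose[OF continuous_on_id lin] by (intro continuous_intros) auto
      show "continuous_on ((\<lambda>a. (z, inv (T z) a)) ` A) (\<lambda>(w, a). \<rho> ((f ^^ n) w) (M n w (T w a)))"
        using * by (auto intro: continuous_on_subset)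
    qed
    then show ?thesis by (simp add: inv comp_def)
  qed
  show ?thesis unfolding growth_def
  proof (intro continuous_intros c ballI)
    show "continuous_on (- {0}) (\<rho> z)" using c[of _ 0] by (simp add: M_0)
    show "\<rho> z a \<noteq> 0" "\<rho> ((f ^^ n) z) (M n z a) \<noteq> 0" if "a \<in> - {0}" for a
      using that \<rho>_pos[of a z] \<rho>_pos[of "M n z a" "(f ^^ n) z"] by (auto simp: M_eq_0_iff)
  qed
qed

text \<open>For a fixed base point the vectors that grow by time \<open>n\<close> form an open cone.
  Finitely many such cones cover the unit sphere, which bounds the waiting time.\<close>

lemma fastI:
  assumes "\<And>a. a \<noteq> 0 \<Longrightarrow> \<exists>n\<ge>1. l * real n < growth n z a"
  shows "\<exists>N. z \<in> fast l N"
proof -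
  define V where "V n = (- {0}) \<inter> growth n z -` {l * real n<..}" for n
  have "open (V n)" for n
    unfolding V_def by (rule continuous_open_preimage[OF continuous_growth]) auto
  moreover have "sphere 0 1 \<subseteq> (\<Union>n\<in>{1..}. V n)"
  proof
    fix a :: 'e assume "a \<in> sphere 0 1"
    then have "a \<noteq> 0" by auto
    with assms[OF this] show "a \<in> (\<Union>n\<in>{1..}. V n)" by (auto simp: V_def)
  qed
  ultimately obtain F where F: "F \<subseteq> {1..}" "finite F" "sphere 0 1 \<subseteq> (\<Union>n\<in>F. V n)"
    by (rule compactE_image[OF compact_sphere])
  \<comment> \<open>\<open>insert 0\<close> spares the proof that \<open>F\<close> is
    nonempty.\<close>
  have "z \<in> fast l (Max (insert 0 F))"
    unfolding fast_def
  proof (intro CollectI allI impI)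
    fix a :: 'e assume a: "a \<noteq> 0"
    then have "a /\<^sub>R norm a \<in> sphere 0 1" by simp
    then obtain n where n: "n \<in> F" "a /\<^sub>R norm a \<in> V n" using F by blast
    then have "l * real n < growth n z a" using growth_normalize[OF a] by (simp add: V_def)
    moreover have "n \<in> {1..Max (insert 0 F)}" using n F by (auto intro: Max_ge)
    ultimately show "\<exists>n\<in>{1..Max (insert 0 F)}. l * real n < growth n z a" by blast
  qed
  then show ?thesis ..
qed

lemma fast_antimono_rate: "l \<le> l' \<Longrightarrow> fast l' N \<subseteq> fast l N"
proof
  fix z assume "l \<le> l'" and z: "z \<in> fast l' N"
  then have le: "l * real n \<le> l' * real n" for n by (simp add: mult_right_mono)
  show "z \<in> fast l N" unfolding fast_def
  proof (intro CollectI allI impI)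
    fix a :: 'e assume "a \<noteq> 0"
    then obtain n where "n \<in> {1..N}" "l' * real n < growth n z a" using z unfolding fast_def by blast
    then show "\<exists>n\<in>{1..N}. l * real n < growth n z a" using le_less_trans[OF le] by blast
  qed
qed

lemma fast_mono_time: "N \<le> N' \<Longrightarrow> fast l N \<subseteq> fast l N'"
  unfolding fast_def by fastforce

section \<open>Forward invariant sets with a definite growth rate\<close>

text \<open>Quantifying over the whole forward orbit builds in forward invariance, while the bound
  \<open>N\<close> may change along the orbit. Bad times of an orbit in this set are then visits to
  \<open>regular l - fast l N\<close>, whose measure tends to 0 as \<open>N\<close> grows.\<close>

definition regular :: "real \<Rightarrow> 'z set" where
  "regular l = {z. \<forall>j. \<exists>N. (f ^^ j) z \<in> fast l N}"

lemma continuous_funpow: "continuous_on UNIV (f ^^ n)"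
proof (induction n)
  case (Suc n)
  show ?case using continuous_on_compose[OF Suc continuous_on_subset[OF cont_f]] by (simp add: comp_def)
qed (simp add: id_def)

lemma funpow_measurable [measurable]: "f ^^ n \<in> borel_measurable borel"
  using continuous_funpow by (rule borel_measurable_continuous_onI)

lemma min_growth_measurable [measurable]: "min_growth n \<in> borel_measurable borel"
  using continuous_min_growth by (rule borel_measurable_continuous_onI)

lemma fast_measurable [measurable]: "fast l N \<in> sets borel"
  using open_fast by simp

lemma regular_measurable [measurable]: "regular l \<in> sets borel"
proof -
  have "regular l = (\<Inter>j. \<Union>N. (f ^^ j) -` fast l N \<inter> space borel)" by (auto simp: regular_def)
  also have "\<dots> \<in> sets borel" by measurable
  finally show ?thesis .
qed

lemma regular_funpow: "z \<in> regular l \<Longrightarrow> (f ^^ j) z \<in> regular l"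
  unfolding regular_def by (auto simp: funpow_add[THEN fun_cong, unfolded comp_def, symmetric])

lemma regular_antimono: "l \<le> l' \<Longrightarrow> regular l' \<subseteq> regular l"
  using fast_antimono_rate unfolding regular_def by blast

text \<open>Positive upper exponents give each vector its own rate. Vectors with at most a given
  exponential growth form a subspace, these subspaces shrink with the rate, and finite dimension
  yields one rate for which the subspace is trivial. Failure of the exponential bound for every
  constant then gives growth from every later point of the orbit.\<close>

lemma regular_of_exponents_pos:
  assumes "\<And>a. a \<noteq> 0 \<Longrightarrow> 0 < limsup (\<lambda>n. ereal (ln (sqrt (\<rho> ((f ^^ n) z) (M n z a))) / real n))"
  shows "\<exists>k. z \<in> regular (1 / real (Suc k))"
proof -
  define r where "r n a = \<rho> ((f ^^ n) z) (M n z a)" for n a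
  have r_pos: "0 < r n a" if "a \<noteq> 0" for n a
    using that by (simp add: r_def \<rho>_pos M_eq_0_iff)
  have r_0: "r n 0 = 0" for n
    using \<rho>_scale[of "(f ^^ n) z" 0 0] by (simp add: r_def linear_0[OF M_linear])
  have r_nonneg: "0 \<le> r n a" for n a using r_pos[of a n] r_0[of n] by (cases "a = 0") auto
  \<comment> \<open>The constant \<open>B\<close> may depend on the vector, so sums and multiples of
    slow vectors stay slow.\<close>
  define W where "W k = {a. \<exists>B. \<forall>n. r n a \<le> B * exp (real n / real (Suc k))}" for k
  have sub: "subspace (W k)" for k
    unfolding subspace_def
  proof (intro conjI ballI allI)
    show "0 \<in> W k" unfolding W_def by (auto simp: r_0 intro!: exI[of _ 0])
  next
    fix a b assume "a \<in> W k" "b \<in> W k"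
    then obtain B B' where B: "\<And>n. r n a \<le> B * exp (real n / real (Suc k))"
        "\<And>n. r n b \<le> B' * exp (real n / real (Suc k))" by (auto simp: W_def)
    have "r n (a + b) \<le> (2 * B + 2 * B') * exp (real n / real (Suc k))" for n
    proof -
      have "r n (a + b) \<le> 2 * r n a + 2 * r n b"
        unfolding r_def linear_add[OF M_linear] by (rule \<rho>_add)
      also have "\<dots> \<le> 2 * (B * exp (real n / real (Suc k))) + 2 * (B' * exp (real n / real (Suc k)))"
        using B[of n] by linarith
      finally show ?thesis by (simp add: algebra_simps)
    qed
    then show "a + b \<in> W k" unfolding W_def by blast
  next
    fix a t assume "a \<in> W k"
    then obtain B where B: "\<And>n. r n a \<le> B * exp (real n / real (Suc k))" by (auto simp: W_def)
    have "r n (t *\<^sub>R a) \<le> (t\<^sup>2 * B) * exp (real n / real (Suc k))" for n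
      using mult_left_mono[OF B[of n], of "t\<^sup>2"]
      by (simp add: r_def linear_scale[OF M_linear] \<rho>_scale algebra_simps)
    then show "t *\<^sub>R a \<in> W k" unfolding W_def by blast
  qed
  have dec: "W k' \<subseteq> W k" if "k \<le> k'" for k k'
  proof
    fix a assume "a \<in> W k'"
    then obtain B where B: "\<And>n. r n a \<le> B * exp (real n / real (Suc k'))" by (auto simp: W_def)
    then have "0 \<le> B" using r_nonneg[of 0 a] B[of 0] by simp
    have "r n a \<le> B * exp (real n / real (Suc k))" for n
    proof -
      have "exp (real n / real (Suc k')) \<le> exp (real n / real (Suc k))"
        using that by (simp add: frac_le)
      then show ?thesis using B[of n] mult_left_mono[OF _ \<open>0 \<le> B\<close>] order_trans by blast
    qed
    then show "a \<in> W k" unfolding W_def by blast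
  qed
  \<comment> \<open>A vector in all \<open>W k\<close> has upper exponent at most
    \<open>1 / (2 * real (Suc k))\<close> for every \<open>k\<close>; the 2 comes from the square
    root.\<close>
  have inter: "a = 0" if in_W: "\<And>k. a \<in> W k" for a
  proof (rule ccontr)
    assume a: "a \<noteq> 0"
    define u where "u n = ln (sqrt (r n a)) / real n" for n
    have "limsup (\<lambda>n. ereal (u n)) \<le> ereal (1 / (2 * real (Suc k)))" for k
    proof -
      obtain B where B: "\<And>n. r n a \<le> B * exp (real n / real (Suc k))"
        using in_W[of k] by (auto simp: W_def)
      have "0 < B" using r_pos[OF a, of 0] B[of 0] by simp
      have le: "u n \<le> (ln B / 2) / real n + 1 / (2 * real (Suc k))" if "0 < n" for n
      proof -
        have "ln (r n a) \<le> ln (B * exp (real n / real (Suc k)))"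
          using B[of n] r_pos[OF a] \<open>0 < B\<close> by (subst ln_le_cancel_iff) auto
        also have "\<dots> = ln B + real n / real (Suc k)" using \<open>0 < B\<close> by (simp add: ln_mult)
        finally have "ln (sqrt (r n a)) \<le> ln B / 2 + real n / real (Suc k) / 2"
          using ln_sqrt[OF less_imp_le[OF r_pos[OF a, of n]]]
          by (simp only: add_divide_distrib[symmetric] divide_right_mono)
        then have "u n \<le> (ln B / 2 + real n / real (Suc k) / 2) / real n"
          unfolding u_def by (rule divide_right_mono) simp
        also have "\<dots> = (ln B / 2) / real n + 1 / (2 * real (Suc k))"
          using that by (simp add: field_simps)
        finally show ?thesis .
      qed
      have "(\<lambda>n. (ln B / 2) / real n + 1 / (2 * real (Suc k))) \<longlonglongrightarrow> 0 + 1 / (2 * real (Suc k))"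
        by (intro tendsto_intros lim_const_over_n)
      then have lim: "(\<lambda>n. ereal ((ln B / 2) / real n + 1 / (2 * real (Suc k)))) \<longlonglongrightarrow> ereal (1 / (2 * real (Suc k)))"
        by simp
      have "limsup (\<lambda>n. ereal (u n)) \<le> limsup (\<lambda>n. ereal ((ln B / 2) / real n + 1 / (2 * real (Suc k))))"
        by (intro Limsup_mono eventually_sequentiallyI[of 1]) (simp only: ereal_less_eq, rule le, simp)
      also have "\<dots> = ereal (1 / (2 * real (Suc k)))"
        by (rule lim_imp_Limsup[OF sequentially_bot lim])
      finally show ?thesis .
    qed
    then have le: "\<exists>N. \<forall>k\<ge>N. limsup (\<lambda>n. ereal (u n)) \<le> ereal (1 / (2 * real (Suc k)))" by blast
    have "(\<lambda>k. ereal (1 / (2 * real (Suc k)))) \<longlonglongrightarrow> ereal 0"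
    proof -
      have "(\<lambda>k. 1 / 2 * inverse (real (Suc k))) \<longlonglongrightarrow> 1 / 2 * 0"
        by (intro tendsto_intros LIMSEQ_inverse_real_of_nat)
      moreover have "1 / 2 * inverse (real (Suc k)) = 1 / (2 * real (Suc k))" for k
        by (simp add: field_simps)
      ultimately have "(\<lambda>k. 1 / (2 * real (Suc k))) \<longlonglongrightarrow> 1 / 2 * 0" by (simp only:)
      then show ?thesis unfolding lim_ereal by (simp only: mult_zero_right)
    qed
    then have "limsup (\<lambda>n. ereal (u n)) \<le> ereal 0"
      using le by (rule LIMSEQ_le_const)
    then show False using assms[OF a] by (simp add: u_def r_def zero_ereal_def)
  qed
  \<comment> \<open>A decreasing chain of subspaces stabilizes: at minimal dimension
    \<open>W k0\<close> is contained in every \<open>W k\<close> and is therefore trivial.\<close>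
  obtain k0 where k0: "\<And>k. dim (W k0) \<le> dim (W k)"
    using ex_has_least_nat[of "\<lambda>_. True" 0 "\<lambda>k. dim (W k)"] by auto
  have "W k0 \<subseteq> W k" for k
  proof (cases "k \<le> k0")
    case False
    then have "W k = W k0"
      using subspace_dim_equal[OF sub sub, of k k0] dec[of k0 k] k0[of k] by auto
    then show ?thesis by simp
  qed (rule dec)
  then have triv: "a = 0" if "a \<in> W k0" for a using inter that by blast
  define l where "l = 1 / real (Suc k0)"
  have "\<exists>N. (f ^^ j) z \<in> fast l N" for j
  proof (rule fastI)
    fix a :: 'e assume a: "a \<noteq> 0"
    have "surj (M j z)" by (rule linear_injective_imp_surjective[OF M_linear M_inj]) (rule refl)
    then obtain b where b: "a = M j z b" by (meson surjD)
    then have "b \<noteq> 0" using a M_eq_0_iff by auto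
    \<comment> \<open>\<open>B\<close> dominates the squared norms of the vector at all times up to
      \<open>j\<close>. Since \<open>b\<close> is not in \<open>W k0\<close>, its squared norm
      exceeds \<open>B\<close> times the exponential at some time, necessarily later than
      \<open>j\<close>; the excess is growth accumulated after time \<open>j\<close>.\<close>
    define B where "B = (\<Sum>i\<le>j. r i b)"
    have B: "r i b \<le> B" if "i \<le> j" for i
      unfolding B_def by (rule member_le_sum) (use that r_nonneg in auto)
    have "0 < B" using B[of 0] r_pos[OF \<open>b \<noteq> 0\<close>, of 0] by simp
    obtain n' where n': "B * exp (real n' / real (Suc k0)) < r n' b"
    proof -
      have "\<not> (\<forall>n. r n b \<le> B * exp (real n / real (Suc k0)))"
        using triv[of b] \<open>b \<noteq> 0\<close> unfolding W_def by blast
      then show thesis using that by (meson not_le)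
    qed
    have "B \<le> B * exp (real n' / real (Suc k0))" using \<open>0 < B\<close> by simp
    then have "j < n'" using B[of n'] n' by (meson leD le_less_trans not_le)
    define n where "n = n' - j"
    have nj: "n' = j + n" "1 \<le> n" using \<open>j < n'\<close> by (auto simp: n_def)
    have fj: "(f ^^ n') z = (f ^^ n) ((f ^^ j) z)"
      using funpow_add[of n j f] by (simp add: nj add.commute)
    have rn: "r n' b = \<rho> ((f ^^ n) ((f ^^ j) z)) (M n ((f ^^ j) z) a)"
      unfolding r_def fj unfolding nj M_add b ..
    have "l * real n \<le> real n' / real (Suc k0)" by (simp add: l_def nj divide_right_mono)
    then have "B * exp (l * real n) \<le> B * exp (real n' / real (Suc k0))" using \<open>0 < B\<close> by simp
    moreover have "\<rho> ((f ^^ j) z) a \<le> B" using B[of j] by (simp add: r_def b)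
    then have "\<rho> ((f ^^ j) z) a * exp (l * real n) \<le> B * exp (l * real n)" by simp
    ultimately have "\<rho> ((f ^^ j) z) a * exp (l * real n) < r n' b" using n' by linarith
    then have "ln (\<rho> ((f ^^ j) z) a * exp (l * real n)) < ln (r n' b)"
      using \<rho>_pos[OF a, of "(f ^^ j) z"] r_pos[OF \<open>b \<noteq> 0\<close>, of n'] by (subst ln_less_cancel_iff) auto
    then have "ln (\<rho> ((f ^^ j) z) a) + l * real n < ln (r n' b)"
      using \<rho>_pos[OF a, of "(f ^^ j) z"] by (simp add: ln_mult)
    then have "l * real n < growth n ((f ^^ j) z) a" by (simp add: growth_def rn)
    then show "\<exists>n\<ge>1. l * real n < growth n ((f ^^ j) z) a" using nj by blast
  qed
  then have "z \<in> regular l" by (simp add: regular_def)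
  then show ?thesis unfolding l_def by blast
qed

section \<open>Integrals of the least growth against an invariant measure\<close>

lemma distr_funpow:
  assumes \<mu>: "sets \<mu> = sets borel" "distr \<mu> borel f = \<mu>"
  shows "distr \<mu> borel (f ^^ n) = \<mu>"
proof (induction n)
  case 0
  show ?case using \<mu>(1) by (simp add: distr_id2 id_def)
next
  case (Suc n)
  have f: "f \<in> borel \<rightarrow>\<^sub>M borel" using cont_f by (rule borel_measurable_continuous_onI)
  have fn: "f ^^ n \<in> \<mu> \<rightarrow>\<^sub>M borel" using measurable_cong_sets[OF \<mu>(1) refl] funpow_measurable by blast
  have "distr \<mu> borel (f ^^ Suc n) = distr (distr \<mu> borel (f ^^ n)) borel f"
    unfolding funpow.simps by (rule distr_distr[OF f fn, symmetric])
  then show ?case by (simp only: Suc \<mu>(2))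
qed

context
  fixes \<mu> :: "'z measure"
  assumes prob: "prob_space \<mu>" and sets_\<mu> [measurable_cong]: "sets \<mu> = sets borel"
    and invariant: "distr \<mu> borel f = \<mu>"
begin

interpretation prob_space \<mu> by (rule prob)

lemma space_\<mu>: "space \<mu> = UNIV"
  using sets_eq_imp_space_eq[OF sets_\<mu>] by simp

lemma integrable_min_growth: "integrable \<mu> (min_growth n)"
proof -
  have "bounded (range (min_growth n))"
    using compact_base continuous_min_growth by (intro compact_imp_bounded compact_continuous_image)
  then obtain C where "\<And>z. norm (min_growth n z) \<le> C"
    by (auto simp: bounded_iff)
  then show ?thesis by (intro integrable_const_bound[where B = C]) auto
qed

lemma integral_indicator_funpow:
  assumes [measurable]: "S \<in> sets borel"
  shows "(\<integral>z. (indicator S ((f ^^ j) z) :: real) \<partial>\<mu>) = measure \<mu> S"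
proof -
  have "(\<integral>z. (indicator S ((f ^^ j) z) :: real) \<partial>\<mu>) = (\<integral>z. indicator S z \<partial>(distr \<mu> borel (f ^^ j)))"
    by (rule integral_distr[symmetric]) auto
  also have "\<dots> = (\<integral>z. indicator S z \<partial>\<mu>)"
    by (simp add: distr_funpow[OF sets_\<mu> invariant])
  also have "\<dots> = measure \<mu> S" by (simp add: space_\<mu>)
  finally show ?thesis .
qed

text \<open>This integrates \<open>growth_block_bound\<close> over \<open>X\<close>. Orbits may
  leave \<open>X\<close> but stay in \<open>regular l\<close>, and by invariance the expected number
  of bad times is \<open>n\<close> times the measure of \<open>bad N\<close>. Choosing
  \<open>N\<close> makes this cost small, and a large \<open>n\<close> absorbs the cost of the last
  block.\<close>

lemma integral_min_growth_regular_ge: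
  assumes X [measurable]: "X \<in> sets borel" "X \<subseteq> regular l" and l: "0 \<le> l" and "0 < \<eta>"
  shows "\<exists>n0. \<forall>n\<ge>n0. real n * (l * measure \<mu> X - \<eta>) \<le> (\<integral>z. indicator X z * min_growth n z \<partial>\<mu>)"
proof -
  obtain C where C: "0 \<le> C" "\<And>z. - C \<le> min_growth 1 z" by (rule min_growth_1_bound) auto
  define bad where "bad N = regular l - fast l N" for N
  have bad_meas [measurable]: "bad N \<in> sets borel" for N by (simp add: bad_def)
  have "(\<lambda>N. measure \<mu> (bad N)) \<longlonglongrightarrow> measure \<mu> (\<Inter>N. bad N)"
  proof (rule finite_Lim_measure_decseq)
    show "range bad \<subseteq> sets \<mu>" by (auto simp: sets_\<mu>)
    show "decseq bad" using fast_mono_time by (fastforce simp: decseq_def bad_def)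
  qed
  moreover have "(\<Inter>N. bad N) = {}"
  proof -
    have "\<exists>N. z \<in> fast l N" if "z \<in> regular l" for z
    proof -
      have "\<exists>N. (f ^^ 0) z \<in> fast l N" using that unfolding regular_def by blast
      then show ?thesis by simp
    qed
    then show ?thesis by (auto simp: bad_def)
  qed
  ultimately have "(\<lambda>N. (C + l) * measure \<mu> (bad N)) \<longlonglongrightarrow> (C + l) * 0"
    by (intro tendsto_intros) auto
  then have "eventually (\<lambda>N. (C + l) * measure \<mu> (bad N) < \<eta> / 2) sequentially"
    by (rule order_tendstoD) (use \<open>0 < \<eta>\<close> in auto)
  then obtain N where N: "(C + l) * measure \<mu> (bad N) < \<eta> / 2"
    by (auto simp: eventually_sequentially)
  obtain n0 :: nat where n0: "(C + l) * real N / (\<eta> / 2) \<le> real n0"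
    using real_arch_simple by blast
  have "real n * (l * measure \<mu> X - \<eta>) \<le> (\<integral>z. indicator X z * min_growth n z \<partial>\<mu>)" if "n0 \<le> n" for n
  proof -
    \<comment> \<open>The subtracted part is not cut off outside \<open>X\<close>: its integral is
      then computed exactly by invariance, and off \<open>X\<close> it only makes \<open>g\<close>
      nonpositive.\<close>
    define g where "g z = l * real n * indicator X z
        - (C + l) * ((\<Sum>j<n. indicator (bad N) ((f ^^ j) z)) + real N)" for z
    have int1: "integrable \<mu> (\<lambda>z. indicator (bad N) ((f ^^ j) z) :: real)" for j
      by (rule integrable_const_bound[where B = 1]) auto
    have int2: "integrable \<mu> (\<lambda>z. indicator X z :: real)"
      by (rule integrable_const_bound[where B = 1]) auto
    have "real n * (l * measure \<mu> X - \<eta>)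
        \<le> l * real n * measure \<mu> X - (C + l) * (real n * measure \<mu> (bad N) + real N)"
    proof -
      have "(C + l) * real N \<le> real n * (\<eta> / 2)"
      proof -
        have "(C + l) * real N \<le> real n0 * (\<eta> / 2)"
          using n0 \<open>0 < \<eta>\<close> by (simp add: pos_divide_le_eq)
        also have "\<dots> \<le> real n * (\<eta> / 2)" using that \<open>0 < \<eta>\<close> by (intro mult_right_mono) auto
        finally show ?thesis .
      qed
      moreover have "real n * ((C + l) * measure \<mu> (bad N)) \<le> real n * (\<eta> / 2)"
        using N by (intro mult_left_mono) auto
      ultimately show ?thesis by (simp add: algebra_simps)
    qed
    also have "\<dots> = (\<integral>z. g z \<partial>\<mu>)"
      unfolding g_def using int1 int2
      by (simp add: integral_indicator_funpow space_\<mu> prob_space[unfolded space_\<mu>])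
    also have "\<dots> \<le> (\<integral>z. indicator X z * min_growth n z \<partial>\<mu>)"
    proof (rule integral_mono)
      show "integrable \<mu> g" unfolding g_def using int1 int2 by simp
      show "integrable \<mu> (\<lambda>z. indicator X z * min_growth n z)"
        using integrable_real_mult_indicator[OF _ integrable_min_growth] by (simp add: sets_\<mu> mult.commute)
      show "g z \<le> indicator X z * min_growth n z" for z
      proof (cases "z \<in> X")
        case True
        then have "{j. j < n \<and> (f ^^ j) z \<notin> fast l N} = {j \<in> {..<n}. (f ^^ j) z \<in> bad N}"
          using X(2) regular_funpow by (auto simp: bad_def)
        moreover have "real (card {j \<in> {..<n}. (f ^^ j) z \<in> bad N}) = (\<Sum>j<n. indicator (bad N) ((f ^^ j) z))"
          by (simp add: indicator_def sum.If_cases Int_def)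
        ultimately have "g z \<le> growth n z a" if "a \<noteq> 0" for a
          using growth_block_bound[OF C l that, of n z N] True by (simp add: g_def)
        then show ?thesis using True by (simp add: min_growth_ge_iff)
      next
        case False
        then show ?thesis using C l by (simp add: g_def sum_nonneg)
      qed
    qed
    finally show ?thesis .
  qed
  then show ?thesis by blast
qed

text \<open>Enlarging the good set lowers its rate, so the loss outside it cannot be compared
  directly with the gain inside. The gain \<open>p\<close> is fixed on a first set
  \<open>R k0\<close>. A second set \<open>R k1\<close> is then taken so large that its complement
  loses less than \<open>p / 4\<close> per step; between the two the rate is still nonnegative up to
  an error.\<close>

lemma integral_min_growth_pos:
  assumes AE: "AE z in \<mu>. \<forall>a. a \<noteq> 0 \<longrightarrow>
      0 < limsup (\<lambda>n. ereal (ln (sqrt (\<rho> ((f ^^ n) z) (M n z a))) / real n))"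
  shows "\<exists>m>0. 0 < (\<integral>z. min_growth m z \<partial>\<mu>)"
proof -
  obtain C where C: "0 \<le> C" "\<And>z. - C \<le> min_growth 1 z" by (rule min_growth_1_bound) auto
  define R where "R k = regular (1 / real (Suc k))" for k
  have [measurable]: "R k \<in> sets borel" for k by (simp add: R_def)
  have incR: "incseq R"
    unfolding R_def by (intro incseq_SucI regular_antimono) (simp add: field_simps)
  have "AE z in \<mu>. z \<in> (\<Union>k. R k)"
    using AE by eventually_elim (use regular_of_exponents_pos in \<open>auto simp: R_def\<close>)
  then have "measure \<mu> (\<Union>k. R k) = 1"
    by (subst prob_eq_1) (auto simp: sets_\<mu>)
  moreover have "range R \<subseteq> sets \<mu>" by (auto simp: sets_\<mu>)
  ultimately have lim: "(\<lambda>k. measure \<mu> (R k)) \<longlonglongrightarrow> 1"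
    using finite_Lim_measure_incseq[of R] incR by simp
  have "eventually (\<lambda>k. 0 < measure \<mu> (R k)) sequentially"
    by (rule order_tendstoD[OF lim]) simp
  then obtain k0 where k0: "0 < measure \<mu> (R k0)" by (auto simp: eventually_sequentially)
  \<comment> \<open>Rate times measure: the gain per unit time on \<open>R k0\<close>. Three errors
    of at most \<open>p / 4\<close> (one on each part of the space) leave
    \<open>p / 4\<close>.\<close>
  define p where "p = measure \<mu> (R k0) / real (Suc k0)"
  have "0 < p" using k0 by (simp add: p_def)
  have "(\<lambda>k. C * (1 - measure \<mu> (R k))) \<longlonglongrightarrow> C * (1 - 1)"
    using lim by (intro tendsto_intros)
  then have "eventually (\<lambda>k. C * (1 - measure \<mu> (R k)) < p / 4) sequentially"
    by (rule order_tendstoD) (use \<open>0 < p\<close> in simp)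
  then have "eventually (\<lambda>k. k0 \<le> k \<and> C * (1 - measure \<mu> (R k)) < p / 4) sequentially"
    using eventually_ge_at_top by eventually_elim auto
  then obtain k1 where k1: "k0 \<le> k1" "C * (1 - measure \<mu> (R k1)) < p / 4"
    by (auto simp: eventually_sequentially)
  define Y where "Y = R k1 - R k0"
  have [measurable]: "Y \<in> sets borel" by (simp add: Y_def)
  obtain n0 where n0: "\<And>n. n0 \<le> n \<Longrightarrow> real n * (1 / real (Suc k0) * measure \<mu> (R k0) - p / 4)
      \<le> (\<integral>z. indicator (R k0) z * min_growth n z \<partial>\<mu>)"
    using integral_min_growth_regular_ge[of "R k0" "1 / real (Suc k0)" "p / 4"] \<open>0 < p\<close>
    by (auto simp: R_def)
  obtain n1 where n1: "\<And>n. n1 \<le> n \<Longrightarrow> real n * (1 / real (Suc k1) * measure \<mu> Y - p / 4)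
      \<le> (\<integral>z. indicator Y z * min_growth n z \<partial>\<mu>)"
    using integral_min_growth_regular_ge[of Y "1 / real (Suc k1)" "p / 4"] \<open>0 < p\<close>
    by (auto simp: Y_def R_def)
  define n where "n = max 1 (max n0 n1)"
  have n: "n0 \<le> n" "n1 \<le> n" "0 < n" by (auto simp: n_def)
  have int: "integrable \<mu> (\<lambda>z. indicator S z * min_growth n z)" if "S \<in> sets borel" for S
    using integrable_real_mult_indicator[OF _ integrable_min_growth] that by (simp add: sets_\<mu> mult.commute)
  define Z where "Z = - R k1"
  have [measurable]: "Z \<in> sets borel" by (simp add: Z_def)
  have split: "min_growth n z = indicator (R k0) z * min_growth n z + indicator Y z * min_growth n z
      + indicator Z z * min_growth n z" for z
    using incseqD[OF incR k1(1)] by (auto simp: Y_def Z_def indicator_def)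
  have "(\<integral>z. min_growth n z \<partial>\<mu>) = (\<integral>z. indicator (R k0) z * min_growth n z \<partial>\<mu>)
      + (\<integral>z. indicator Y z * min_growth n z \<partial>\<mu>) + (\<integral>z. indicator Z z * min_growth n z \<partial>\<mu>)"
    by (subst split) (simp add: int)
  moreover have "real n * (p - p / 4) \<le> (\<integral>z. indicator (R k0) z * min_growth n z \<partial>\<mu>)"
    using n0[OF n(1)] by (simp add: p_def)
  moreover have "real n * (- (p / 4)) \<le> (\<integral>z. indicator Y z * min_growth n z \<partial>\<mu>)"
    using n1[OF n(2)] by (rule order_trans[rotated]) (intro mult_left_mono, auto)
  moreover have "real n * (- (p / 4)) \<le> (\<integral>z. indicator Z z * min_growth n z \<partial>\<mu>)"
  proof -
    have "measure \<mu> Z = 1 - measure \<mu> (R k1)"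
      using prob_compl[of "R k1"] by (simp add: Z_def space_\<mu> sets_\<mu> Compl_eq_Diff_UNIV)
    then have "real n * (- (p / 4)) \<le> real n * (- (C * measure \<mu> Z))"
      using k1(2) by (intro mult_left_mono) auto
    also have "\<dots> = (\<integral>z. indicator Z z * (- C * real n) \<partial>\<mu>)"
      by (simp add: space_\<mu>)
    also have "\<dots> \<le> (\<integral>z. indicator Z z * min_growth n z \<partial>\<mu>)"
    proof (rule integral_mono)
      show "integrable \<mu> (\<lambda>z. indicator Z z * (- C * real n))"
        by (intro integrable_mult_left integrable_const_bound[where B = 1]) auto
      show "indicator Z z * (- C * real n) \<le> indicator Z z * min_growth n z" for z
        by (rule mult_left_mono[OF min_growth_bound[OF C(2)]]) simp
    qed (simp add: int)
    finally show ?thesis .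
  qed
  ultimately have "real n * (p / 4) \<le> (\<integral>z. min_growth n z \<partial>\<mu>)" by (simp add: algebra_simps)
  moreover have "0 < real n * (p / 4)" using n \<open>0 < p\<close> by simp
  ultimately show ?thesis using n by (intro exI[of _ n]) linarith
qed

end

section \<open>From time averages to growth along the orbit\<close>

text \<open>Times below \<open>m * k\<close> are sorted by residue mod \<open>m\<close>. For each
  residue \<open>r\<close> they form \<open>k\<close> consecutive stretches of length
  \<open>m\<close> starting at \<open>r\<close>, to which superadditivity applies.\<close>

lemma sum_min_growth_le:
  "(\<Sum>j<m * k. min_growth m ((f ^^ j) z)) \<le> (\<Sum>r<m. min_growth (m * k) ((f ^^ r) z))"
proof (induction k)
  case (Suc k)
  have split: "sum h {..<a + b} = sum h {..<a} + (\<Sum>r<b. h (a + r))" for h :: "nat \<Rightarrow> real" and a b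
    by (induction b) (auto simp: add.assoc)
  have "(\<Sum>j<m * Suc k. min_growth m ((f ^^ j) z))
      = (\<Sum>j<m * k. min_growth m ((f ^^ j) z)) + (\<Sum>r<m. min_growth m ((f ^^ (m * k + r)) z))"
    using split[of _ "m * k" m] by (simp add: add.commute)
  also have "\<dots> \<le> (\<Sum>r<m. min_growth (m * k) ((f ^^ r) z) + min_growth m ((f ^^ (m * k)) ((f ^^ r) z)))"
    using Suc by (simp add: sum.distrib funpow_add)
  also have "\<dots> \<le> (\<Sum>r<m. min_growth (m * Suc k) ((f ^^ r) z))"
    using min_growth_superadd[of "m * k" _ m] by (intro sum_mono) (simp add: add.commute)
  finally show ?case .
qed simp

text \<open>The stretch of length \<open>m * k\<close> starting at \<open>r < m\<close> ends before
  \<open>m * k + m\<close>. Extending it at both ends to a common stretch costs at most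
  \<open>C * real m\<close> in total, whatever \<open>r\<close> is, and
  \<open>S (m * k) / real m\<close> grows like \<open>c\<close> times \<open>k\<close>.\<close>

lemma min_growth_tendsto_infinity:
  assumes "0 < m" "0 < c"
    and lim: "(\<lambda>n. (\<Sum>j<n. min_growth m ((f ^^ j) z)) / real n) \<longlonglongrightarrow> c"
  shows "filterlim (\<lambda>k. min_growth (m * k + m) z) at_top sequentially"
proof -
  obtain C where C: "0 \<le> C" "\<And>z. - C \<le> min_growth 1 z" by (rule min_growth_1_bound) auto
  define S where "S n = (\<Sum>j<n. min_growth m ((f ^^ j) z))" for n
  have ge: "S (m * k) / real m - C * real m \<le> min_growth (m * k + m) z" for k
  proof -
    have "min_growth (m * k) ((f ^^ r) z) - C * real m \<le> min_growth (m * k + m) z" if "r < m" for r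
    proof -
      have "- C * real r + min_growth (m * k) ((f ^^ r) z) \<le> min_growth (r + m * k) z"
        using min_growth_superadd[of r z "m * k"] min_growth_bound[OF C(2), of r z] by linarith
      moreover have "min_growth (r + m * k) z - C * real (m - r) \<le> min_growth (r + m * k + (m - r)) z"
        using min_growth_superadd[of "r + m * k" z "m - r"]
          min_growth_bound[OF C(2), of "m - r" "(f ^^ (r + m * k)) z"] by linarith
      moreover have "r + m * k + (m - r) = m * k + m" "C * real m = C * real r + C * real (m - r)"
        using that by (auto simp: of_nat_diff algebra_simps)
      ultimately show ?thesis by simp
    qed
    then have "(\<Sum>r<m. min_growth (m * k) ((f ^^ r) z) - C * real m) \<le> (\<Sum>r<m. min_growth (m * k + m) z)"
      by (intro sum_mono) auto
    then have "S (m * k) \<le> real m * (min_growth (m * k + m) z + C * real m)"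
      using sum_min_growth_le[where m = m and k = k and z = z] by (simp add: S_def sum_subtractf algebra_simps)
    then show ?thesis using \<open>0 < m\<close> by (simp add: field_simps)
  qed
  have mk: "filterlim (\<lambda>k. m * k) sequentially sequentially"
    by (rule filterlim_subseq) (use \<open>0 < m\<close> in \<open>simp add: strict_mono_def\<close>)
  have "(\<lambda>k. S (m * k) / real (m * k)) \<longlonglongrightarrow> c"
    using filterlim_compose[OF lim mk] by (simp add: S_def)
  moreover have "filterlim (\<lambda>k. real (m * k)) at_top sequentially"
    using filterlim_compose[OF filterlim_real_sequentially mk] .
  ultimately have "filterlim (\<lambda>k. S (m * k) / real (m * k) * real (m * k)) at_top sequentially"
    using \<open>0 < c\<close> by (intro filterlim_tendsto_pos_mult_at_top)
  then have "filterlim (\<lambda>k. inverse (real m) * (S (m * k) / real (m * k) * real (m * k))) at_top sequentially"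
    using \<open>0 < m\<close> by (intro filterlim_tendsto_pos_mult_at_top[OF tendsto_const]) auto
  then have "filterlim (\<lambda>k. - (C * real m) + inverse (real m) * (S (m * k) / real (m * k) * real (m * k))) at_top sequentially"
    by (intro filterlim_tendsto_add_at_top[OF tendsto_const])
  moreover have "eventually (\<lambda>k. - (C * real m) + inverse (real m) * (S (m * k) / real (m * k) * real (m * k))
      \<le> min_growth (m * k + m) z) sequentially"
    using eventually_gt_at_top[of 0]
  proof eventually_elim
    case (elim k)
    then have "- (C * real m) + inverse (real m) * (S (m * k) / real (m * k) * real (m * k))
        = S (m * k) / real m - C * real m" using \<open>0 < m\<close> by (simp add: field_simps)
    then show ?case using ge[of k] by simp
  qed
  ultimately show ?thesis by (rule filterlim_at_top_mono)
qed

end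

section \<open>Charts and maps of class \<open>C\<^sup>1\<close>\<close>

text \<open>The topological clauses of \<open>smooth_atlas\<close> as a separate notion, because
  they are what is established for the torus and for product atlases. Differentiability of
  coordinate changes enters as \<open>C1_map\<close> of the identity.\<close>

definition topological_atlas :: "('a::topological_space, 'e::euclidean_space) chart set \<Rightarrow> bool" where
  "topological_atlas A \<longleftrightarrow> (\<Union>c\<in>A. fst c) = UNIV \<and>
     (\<forall>c\<in>A. open (fst c) \<and> open (snd c ` fst c) \<and>
        homeomorphism (fst c) (snd c ` fst c) (snd c) (chart_inv c))"

text \<open>With \<open>F = id\<close> this is the derivative of a coordinate change, so changes of
  frame and iterates obey the same chain rule.\<close>

definition chart_deriv ::
  "('a, 'e::euclidean_space) chart \<Rightarrow> ('b, 'f::euclidean_space) chart \<Rightarrow> ('a \<Rightarrow> 'b) \<Rightarrow> 'a \<Rightarrow> 'e \<Rightarrow> 'f" where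
  "chart_deriv c d F p = frechet_derivative (snd d \<circ> F \<circ> chart_inv c) (at (snd c p))"

lemma has_derivative_chart_deriv:
  assumes "(snd d \<circ> F \<circ> chart_inv c has_derivative L) (at (snd c p))"
  shows "chart_deriv c d F p = L"
  using frechet_derivative_at[OF assms] by (simp add: chart_deriv_def)

lemma topological_atlas_chart_at:
  assumes "topological_atlas A"
  shows "chart_at A p \<in> A" "p \<in> fst (chart_at A p)"
proof -
  have "p \<in> (\<Union>c\<in>A. fst c)" using assms by (simp only: topological_atlas_def UNIV_I)
  then have "\<exists>c. c \<in> A \<and> p \<in> fst c" by blast
  from someI_ex[OF this] show "chart_at A p \<in> A" "p \<in> fst (chart_at A p)"
    by (auto simp: chart_at_def)
qed

context
  fixes A :: "('a::topological_space, 'e::euclidean_space) chart set" and c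
  assumes A: "topological_atlas A" and c: "c \<in> A"
begin

lemma chart_homeomorphism: "homeomorphism (fst c) (snd c ` fst c) (snd c) (chart_inv c)"
  using A c by (auto simp: topological_atlas_def)

lemma chart_open: "open (fst c)" "open (snd c ` fst c)"
  using A c by (auto simp: topological_atlas_def)

lemma chart_inv_chart: "p \<in> fst c \<Longrightarrow> chart_inv c (snd c p) = p"
  using chart_homeomorphism by (rule homeomorphism_apply1)

lemma chart_inv_in: "x \<in> snd c ` fst c \<Longrightarrow> chart_inv c x \<in> fst c"
  using chart_inv_chart by auto

lemma chart_chart_inv: "x \<in> snd c ` fst c \<Longrightarrow> snd c (chart_inv c x) = x"
  using chart_homeomorphism by (rule homeomorphism_apply2)

lemma continuous_chart: "continuous_on (fst c) (snd c)"
  using chart_homeomorphism by (rule homeomorphism_cont1)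

lemma continuous_chart_inv: "continuous_on (snd c ` fst c) (chart_inv c)"
  using chart_homeomorphism by (rule homeomorphism_cont2)

lemma chart_image_eq: "snd c ` (fst c \<inter> S) = snd c ` fst c \<inter> chart_inv c -` S"
  using chart_inv_chart by (auto simp: chart_chart_inv intro!: image_eqI[of _ "snd c"] chart_inv_in)

lemma open_chart_image: "open S \<Longrightarrow> open (snd c ` (fst c \<inter> S))"
  unfolding chart_image_eq
  by (intro continuous_open_preimage continuous_chart_inv chart_open)

end

lemma has_derivative_chart_id:
  assumes "topological_atlas A" "c \<in> A" "p \<in> fst c"
  shows "(snd c \<circ> id \<circ> chart_inv c has_derivative (\<lambda>v. v)) (at (snd c p))"
  by (rule has_derivative_transform_within_open[OF has_derivative_ident chart_open(2)[OF assms(1,2)]])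
    (use assms in \<open>auto simp: chart_inv_chart\<close>)

lemma has_derivative_chart_comp:
  fixes F :: "'a::topological_space \<Rightarrow> 'b::topological_space"
  assumes A: "topological_atlas A" "c \<in> A" and B: "topological_atlas B" "e \<in> B"
    and F: "continuous_on UNIV F" and p: "p \<in> fst c" "F p \<in> fst e"
    and dF: "(snd e \<circ> F \<circ> chart_inv c has_derivative L) (at (snd c p))"
    and dG: "(snd d \<circ> G \<circ> chart_inv e has_derivative L') (at (snd e (F p)))"
  shows "(snd d \<circ> (G \<circ> F) \<circ> chart_inv c has_derivative L' \<circ> L) (at (snd c p))"
proof (rule has_derivative_transform_within_open)
  have "(snd e \<circ> F \<circ> chart_inv c) (snd c p) = snd e (F p)"
    using chart_inv_chart[OF A p(1)] by simp
  with dG have "(snd d \<circ> G \<circ> chart_inv e has_derivative L') (at ((snd e \<circ> F \<circ> chart_inv c) (snd c p)))"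
    by simp
  from diff_chain_at[OF dF this]
  show "((snd d \<circ> G \<circ> chart_inv e) \<circ> (snd e \<circ> F \<circ> chart_inv c) has_derivative L' \<circ> L) (at (snd c p))" .
  show "open (snd c ` (fst c \<inter> F -` fst e))"
    by (intro open_chart_image[OF A] open_vimage chart_open[OF B] F)
  show "snd c p \<in> snd c ` (fst c \<inter> F -` fst e)" using p by auto
  show "((snd d \<circ> G \<circ> chart_inv e) \<circ> (snd e \<circ> F \<circ> chart_inv c)) x = (snd d \<circ> (G \<circ> F) \<circ> chart_inv c) x"
    if "x \<in> snd c ` (fst c \<inter> F -` fst e)" for x
    using that by (auto simp: chart_inv_chart[OF A] chart_inv_chart[OF B])
qed

lemma C1_map_has_derivative:
  assumes A: "topological_atlas A" and F: "C1_map A B F" and "c \<in> A" "d \<in> B" "p \<in> fst c" "F p \<in> fst d"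
  shows "(snd d \<circ> F \<circ> chart_inv c has_derivative chart_deriv c d F p) (at (snd c p))"
  using assms unfolding C1_map_def chart_deriv_def
  by (fastforce simp: frechet_derivative_works[symmetric])

lemma C1_map_continuous_deriv:
  assumes A: "topological_atlas A" and F: "C1_map A B F" and "c \<in> A" "d \<in> B"
  shows "continuous_on (fst c \<inter> F -` fst d) (\<lambda>p. chart_deriv c d F p v)"
proof -
  have "continuous_on (snd c ` (fst c \<inter> F -` fst d)) (\<lambda>x. frechet_derivative (snd d \<circ> F \<circ> chart_inv c) (at x) v)"
    using F assms(3,4) by (auto simp: C1_map_def)
  then have "continuous_on (fst c \<inter> F -` fst d) ((\<lambda>x. frechet_derivative (snd d \<circ> F \<circ> chart_inv c) (at x) v) \<circ> snd c)"
    by (intro continuous_on_compose continuous_on_subset[OF continuous_chart[OF A assms(3)]]) auto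
  then show ?thesis by (simp add: chart_deriv_def comp_def)
qed

lemma C1_mapI:
  assumes A: "topological_atlas A" and F: "continuous_on UNIV F"
    and deriv: "\<And>c d p. c \<in> A \<Longrightarrow> d \<in> B \<Longrightarrow> p \<in> fst c \<Longrightarrow> F p \<in> fst d \<Longrightarrow>
      \<exists>L. (snd d \<circ> F \<circ> chart_inv c has_derivative L) (at (snd c p))"
    and cont: "\<And>c d v. c \<in> A \<Longrightarrow> d \<in> B \<Longrightarrow> continuous_on (fst c \<inter> F -` fst d) (\<lambda>p. chart_deriv c d F p v)"
  shows "C1_map A B F"
  unfolding C1_map_def
proof (intro conjI ballI F)
  fix c d assume cd: "c \<in> A" "d \<in> B"
  let ?S = "snd c ` (fst c \<inter> F -` fst d)"
  have "continuous_on ?S (\<lambda>x. frechet_derivative (snd d \<circ> F \<circ> chart_inv c) (at x) v)" for v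
  proof -
    have "continuous_on ?S ((\<lambda>p. chart_deriv c d F p v) \<circ> chart_inv c)"
    proof (rule continuous_on_compose)
      show "continuous_on ?S (chart_inv c)"
        by (rule continuous_on_subset[OF continuous_chart_inv[OF A cd(1)]]) auto
      show "continuous_on (chart_inv c ` ?S) (\<lambda>p. chart_deriv c d F p v)"
        by (rule continuous_on_subset[OF cont[OF cd]]) (auto simp: chart_inv_chart[OF A cd(1)])
    qed
    then show ?thesis
      by (rule continuous_on_eq) (auto simp: chart_deriv_def chart_inv_chart[OF A cd(1)])
  qed
  then show "Ck_on 1 (snd d \<circ> F \<circ> chart_inv c) ?S"
    using deriv[OF cd] by (auto simp: differentiable_def)
qed

text \<open>\<open>C1_map\<close> gives continuity of the derivative at each fixed vector; expanding
  the argument in the basis extends it to moving vectors.\<close>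

lemma continuous_on_linear_family:
  fixes L :: "'a::topological_space \<Rightarrow> 'e::euclidean_space \<Rightarrow> 'f::real_normed_vector"
  assumes "\<And>p. p \<in> S \<Longrightarrow> linear (L p)" "\<And>v. continuous_on S (\<lambda>p. L p v)" "continuous_on S w"
  shows "continuous_on S (\<lambda>p. L p (w p))"
proof -
  have "continuous_on S (\<lambda>p. \<Sum>b\<in>Basis. (w p \<bullet> b) *\<^sub>R L p b)"
    by (intro continuous_intros assms)
  then show ?thesis
  proof (rule continuous_on_eq)
    fix p assume "p \<in> S"
    then have lin: "linear (L p)" by (rule assms)
    have "L p (w p) = L p (\<Sum>b\<in>Basis. (w p \<bullet> b) *\<^sub>R b)" by (simp add: euclidean_representation)
    also have "\<dots> = (\<Sum>b\<in>Basis. (w p \<bullet> b) *\<^sub>R L p b)"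
      by (simp add: linear_sum[OF lin] linear_scale[OF lin])
    finally show "(\<Sum>b\<in>Basis. (w p \<bullet> b) *\<^sub>R L p b) = L p (w p)" by simp
  qed
qed

lemma C1_map_comp:
  fixes F :: "'a::topological_space \<Rightarrow> 'b::topological_space"
  assumes A: "topological_atlas A" and B: "topological_atlas B" and C: "topological_atlas C"
    and F: "C1_map A B F" and G: "C1_map B C G"
  shows "C1_map A C (G \<circ> F)"
proof (rule C1_mapI[OF A])
  have cF: "continuous_on UNIV F" and cG: "continuous_on UNIV G" using F G by (auto simp: C1_map_def)
  then show "continuous_on UNIV (G \<circ> F)" by (intro continuous_on_compose continuous_on_subset[OF cG]) auto
  have chain: "(snd d \<circ> (G \<circ> F) \<circ> chart_inv c has_derivative chart_deriv e d G (F p) \<circ> chart_deriv c e F p) (at (snd c p))"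
    if "c \<in> A" "e \<in> B" "d \<in> C" "p \<in> fst c" "F p \<in> fst e" "G (F p) \<in> fst d" for c e d p
    by (rule has_derivative_chart_comp[OF A that(1) B that(2) cF that(4,5)
        C1_map_has_derivative[OF A F that(1,2,4,5)] C1_map_has_derivative[OF B G that(2,3,5,6)]])
  show "\<exists>L. (snd d \<circ> (G \<circ> F) \<circ> chart_inv c has_derivative L) (at (snd c p))"
    if "c \<in> A" "d \<in> C" "p \<in> fst c" "(G \<circ> F) p \<in> fst d" for c d p
    using chain[of c "chart_at B (F p)" d p] topological_atlas_chart_at[OF B, of "F p"] that by auto
  fix c d v assume cd: "c \<in> A" "d \<in> C"
  let ?S = "\<lambda>e. fst c \<inter> (F -` fst e \<inter> (G \<circ> F) -` fst d)"
  \<comment> \<open>No single intermediate chart need serve the whole domain; it is covered by the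
    open sets on which a fixed \<open>e\<close> does.\<close>
  have "continuous_on (\<Union>e\<in>B. ?S e) (\<lambda>p. chart_deriv c d (G \<circ> F) p v)"
  proof (rule continuous_on_open_UN)
    fix e assume e: "e \<in> B"
    show "open (?S e)"
      using chart_open[OF A cd(1)] chart_open[OF B e] chart_open[OF C cd(2)] cF cG
      by (intro open_Int open_vimage continuous_on_compose continuous_on_subset[OF cG]) auto
    have "continuous_on (?S e) (\<lambda>p. chart_deriv e d G (F p) (chart_deriv c e F p v))"
    proof (rule continuous_on_linear_family[where L = "\<lambda>p. chart_deriv e d G (F p)"])
      show "linear (chart_deriv e d G (F p))" if "p \<in> ?S e" for p
        using C1_map_has_derivative[OF B G e cd(2), of "F p"] that by (auto dest: has_derivative_linear)
      have "continuous_on (?S e) ((\<lambda>q. chart_deriv e d G q v) \<circ> F)" for v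
        by (intro continuous_on_compose continuous_on_subset[OF cF]
            continuous_on_subset[OF C1_map_continuous_deriv[OF B G e cd(2)]]) auto
      then show "continuous_on (?S e) (\<lambda>p. chart_deriv e d G (F p) v)" for v by (simp add: comp_def)
      show "continuous_on (?S e) (\<lambda>p. chart_deriv c e F p v)"
        by (rule continuous_on_subset[OF C1_map_continuous_deriv[OF A F cd(1) e]]) auto
    qed
    then show "continuous_on (?S e) (\<lambda>p. chart_deriv c d (G \<circ> F) p v)"
      by (rule continuous_on_eq) (use cd e in \<open>auto simp: has_derivative_chart_deriv[OF chain[of c e d]]\<close>)
  qed
  moreover have "(\<Union>e\<in>B. ?S e) = fst c \<inter> (G \<circ> F) -` fst d"
    using topological_atlas_chart_at[OF B] by fastforce
  ultimately show "continuous_on (fst c \<inter> (G \<circ> F) -` fst d) (\<lambda>p. chart_deriv c d (G \<circ> F) p v)" by simp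
qed

lemma smooth_atlas_imp_topological_atlas: "smooth_atlas A \<Longrightarrow> topological_atlas A"
  by (simp add: smooth_atlas_def topological_atlas_def)

lemma smooth_atlas_C1_map_id: "smooth_atlas A \<Longrightarrow> C1_map A A id"
  unfolding smooth_atlas_def C1_map_def smooth_on_def
  by (auto simp: continuous_on_id simp del: Ck_on.simps)

section \<open>Topology and charts of the torus\<close>

lemma continuous_torus_proj: "continuous_on UNIV torus_proj"
  unfolding continuous_on_open_vimage[OF open_UNIV] by (auto simp: open_torus2_def)

lemma torus_proj_eq_iff: "torus_proj p = torus_proj q \<longleftrightarrow> torus_rel p q"
  using torus2.abs_eq_iff by simp

lemma torus_proj_surj: "\<exists>p. x = torus_proj p"
  by (metis Quotient3_abs_rep Quotient3_torus2)

text \<open>The saturation of \<open>W\<close> is the union of its integer translates.\<close>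

lemma open_torus_proj_image:
  assumes "open W"
  shows "open (torus_proj ` W)"
proof -
  have eq: "torus_proj -` (torus_proj ` W) = (\<Union>m n. (\<lambda>p. p + (of_int m, of_int n)) ` W)"
  proof (intro equalityI subsetI)
    fix p assume "p \<in> torus_proj -` (torus_proj ` W)"
    then obtain q where q: "q \<in> W" "torus_rel p q" by (auto simp: torus_proj_eq_iff)
    obtain m n :: int where "fst p - fst q = of_int m" "snd p - snd q = of_int n"
      using q(2) by (auto simp: torus_rel_def elim!: Ints_cases)
    then have "p = q + (of_int m, of_int n)" by (simp add: prod_eq_iff algebra_simps)
    then show "p \<in> (\<Union>m n. (\<lambda>p. p + (of_int m, of_int n)) ` W)" using q(1) by blast
  next
    fix q assume "q \<in> (\<Union>m n. (\<lambda>p. p + (of_int m, of_int n)) ` W)"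
    then obtain p and m n :: int where "p \<in> W" "q = p + (of_int m, of_int n)" by blast
    then have "torus_proj q = torus_proj p" by (simp add: torus_proj_eq_iff torus_rel_def)
    then show "q \<in> torus_proj -` torus_proj ` W" using \<open>p \<in> W\<close> by simp
  qed
  have "open ((\<lambda>p. p + v) ` W)" for v :: "real \<times> real"
    using open_translation[OF assms, of v] by (simp add: add.commute)
  then show ?thesis unfolding open_torus2_def eq by auto
qed

lemma compact_torus: "compact (UNIV :: torus2 set)"
proof -
  have "(UNIV :: torus2 set) = torus_proj ` cbox (0, 0) (1, 1)"
  proof (intro equalityI subsetI)
    fix x :: torus2
    obtain a b where x: "x = torus_proj (a, b)" using torus_proj_surj[of x] by auto
    have "torus_rel (a, b) (frac a, frac b)" by (simp add: torus_rel_def frac_def)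
    then have "x = torus_proj (frac a, frac b)" by (simp add: x torus_proj_eq_iff)
    moreover have "(frac a, frac b) \<in> cbox (0, 0) (1, 1)"
      using frac_ge_0 less_imp_le[OF frac_lt_1] by (auto simp: cbox_Pair_eq)
    ultimately show "x \<in> torus_proj ` cbox (0, 0) (1, 1)" by blast
  qed auto
  moreover have "compact (torus_proj ` cbox (0, 0) (1, 1))"
    by (intro compact_continuous_image continuous_on_subset[OF continuous_torus_proj]) auto
  ultimately show ?thesis by simp
qed

lemma topological_atlas_torus: "topological_atlas torus_atlas"
  unfolding topological_atlas_def
proof (intro conjI ballI)
  show "(\<Union>c\<in>torus_atlas. fst c) = UNIV"
  proof (intro equalityI subsetI UNIV_I)
    fix x :: torus2
    obtain p where x: "x = torus_proj p" using torus_proj_surj by blast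
    \<comment> \<open>Points of this ball are less than 1 apart, so integer differences of their
      coordinates vanish.\<close>
    have "inj_on torus_proj (ball p (1/2))"
    proof (rule inj_onI)
      fix q r assume q: "q \<in> ball p (1/2)" and r: "r \<in> ball p (1/2)" and "torus_proj q = torus_proj r"
      then have I: "fst q - fst r \<in> \<int>" "snd q - snd r \<in> \<int>"
        by (auto simp: torus_proj_eq_iff torus_rel_def)
      have "dist q r < 1" using q r dist_triangle_half_r[of p q 1 r] by auto
      then have "norm (q - r) < 1" by (simp add: dist_norm)
      then have "\<bar>fst q - fst r\<bar> < 1" "\<bar>snd q - snd r\<bar> < 1"
        using norm_fst_le[of "fst (q - r)" "snd (q - r)"] norm_snd_le[of "snd (q - r)" "fst (q - r)"]
        unfolding prod.collapse by auto
      then have "fst q - fst r = 0" "snd q - snd r = 0"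
        using Ints_nonzero_abs_less1[OF I(1)] Ints_nonzero_abs_less1[OF I(2)] by auto
      then show "q = r" by (simp add: prod_eq_iff)
    qed
    then have "(torus_proj ` ball p (1/2), inv_into (ball p (1/2)) torus_proj) \<in> torus_atlas"
      unfolding torus_atlas_def by blast
    then show "x \<in> (\<Union>c\<in>torus_atlas. fst c)" using x by force
  qed
  fix c assume "c \<in> torus_atlas"
  then obtain W where W: "open W" "inj_on torus_proj W" and c: "c = (torus_proj ` W, inv_into W torus_proj)"
    by (auto simp: torus_atlas_def)
  have im: "inv_into W torus_proj ` torus_proj ` W = W" using W(2) by simp
  \<comment> \<open>\<open>chart_inv\<close> is an \<open>inv_into\<close> of an
    \<open>inv_into\<close>; on \<open>W\<close> it gives back the projection.\<close>
  have inv: "chart_inv c x = torus_proj x" if "x \<in> W" for x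
    unfolding chart_inv_def using that W(2) by (intro inv_into_f_eq) (auto simp: c inj_on_inv_into)
  show "open (fst c)" using open_torus_proj_image[OF W(1)] by (simp add: c)
  show "open (snd c ` fst c)" using W im by (simp add: c)
  have "continuous_on (torus_proj ` W) (inv_into W torus_proj)"
  proof (rule continuous_on_open_gen[THEN iffD2, rule_format])
    show "inv_into W torus_proj \<in> torus_proj ` W \<rightarrow> W" using im by auto
    fix V assume "openin (top_of_set W) V"
    then have V: "open V" "V \<subseteq> W" using W(1) by (auto simp: openin_open_eq)
    have "torus_proj ` W \<inter> inv_into W torus_proj -` V = torus_proj ` V"
      using W(2) V(2) by auto
    then show "openin (top_of_set (torus_proj ` W)) (torus_proj ` W \<inter> inv_into W torus_proj -` V)"
      using open_torus_proj_image[OF V(1)] V(2)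
      by (auto simp: openin_open intro!: exI[of _ "torus_proj ` V"])
  qed
  then have "homeomorphism W (torus_proj ` W) torus_proj (inv_into W torus_proj)"
    unfolding homeomorphism_def
    by (intro conjI ballI im refl inv_into_f_f[OF W(2)] f_inv_into_f
        continuous_on_subset[OF continuous_torus_proj subset_UNIV])
  then have "homeomorphism (torus_proj ` W) W (inv_into W torus_proj) torus_proj"
    by (rule homeomorphism_symD)
  then show "homeomorphism (fst c) (snd c ` fst c) (snd c) (chart_inv c)"
    by (rule homeomorphism_cong) (use im inv in \<open>auto simp: c\<close>)
qed

section \<open>Products of charts\<close>

definition prod_chart :: "('a, 'e) chart \<Rightarrow> ('b, 'f) chart \<Rightarrow> ('a \<times> 'b, 'e \<times> 'f) chart" where
  "prod_chart c d = (fst c \<times> fst d, map_prod (snd c) (snd d))"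

lemma prod_atlas_eq: "prod_atlas A B = {prod_chart c d | c d. c \<in> A \<and> d \<in> B}"
  unfolding prod_atlas_def prod_chart_def[symmetric] by (auto simp del: split_paired_Ex)

lemma prod_chart_simps [simp]:
  "fst (prod_chart c d) = fst c \<times> fst d" "snd (prod_chart c d) z = (snd c (fst z), snd d (snd z))"
  by (auto simp: prod_chart_def map_prod_def split: prod.splits)

lemma prod_chart_image: "snd (prod_chart c d) ` (fst c \<times> fst d) = (snd c ` fst c) \<times> (snd d ` fst d)"
  by (auto simp: prod_chart_def intro: map_prod_imageI)

lemma prod_chart_inv:
  assumes "topological_atlas A" "topological_atlas B" "c \<in> A" "d \<in> B" "x \<in> snd c ` fst c" "y \<in> snd d ` fst d"
  shows "chart_inv (prod_chart c d) (x, y) = (chart_inv c x, chart_inv d y)"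
  unfolding chart_inv_def[of "prod_chart c d"]
proof (rule inv_into_f_eq)
  have "inj_on (snd c) (fst c)"
    by (rule inj_on_inverseI) (rule chart_inv_chart[OF assms(1,3)])
  moreover have "inj_on (snd d) (fst d)"
    by (rule inj_on_inverseI) (rule chart_inv_chart[OF assms(2,4)])
  ultimately show "inj_on (snd (prod_chart c d)) (fst (prod_chart c d))"
    by (auto simp: inj_on_def)
  show "(chart_inv c x, chart_inv d y) \<in> fst (prod_chart c d)"
    using assms by (auto simp: chart_inv_chart)
  show "snd (prod_chart c d) (chart_inv c x, chart_inv d y) = (x, y)"
    using assms by (auto simp: chart_inv_chart)
qed

lemma topological_atlas_prod:
  assumes A: "topological_atlas A" and B: "topological_atlas B"
  shows "topological_atlas (prod_atlas A B)"
  unfolding topological_atlas_def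
proof (intro conjI ballI)
  show "(\<Union>c\<in>prod_atlas A B. fst c) = UNIV"
  proof (intro equalityI subsetI UNIV_I)
    fix z :: "'a \<times> 'c"
    have "prod_chart (chart_at A (fst z)) (chart_at B (snd z)) \<in> prod_atlas A B"
      "z \<in> fst (prod_chart (chart_at A (fst z)) (chart_at B (snd z)))"
      using topological_atlas_chart_at[OF A, of "fst z"] topological_atlas_chart_at[OF B, of "snd z"]
      unfolding prod_atlas_eq by (blast, simp add: mem_Times_iff)
    then show "z \<in> (\<Union>c\<in>prod_atlas A B. fst c)" by blast
  qed
  fix e assume "e \<in> prod_atlas A B"
  then obtain c d where e: "e = prod_chart c d" and cd: "c \<in> A" "d \<in> B" by (auto simp: prod_atlas_eq)
  show "open (fst e)" using chart_open[OF A cd(1)] chart_open[OF B cd(2)] by (simp add: e open_Times)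
  show "open (snd e ` fst e)"
    using chart_open[OF A cd(1)] chart_open[OF B cd(2)]
    by (simp only: e prod_chart_simps prod_chart_image open_Times)
  have inv: "chart_inv e z = (chart_inv c (fst z), chart_inv d (snd z))"
    if "z \<in> (snd c ` fst c) \<times> (snd d ` fst d)" for z
    using prod_chart_inv[OF A B cd, of "fst z" "snd z"] that by (auto simp: e mem_Times_iff)
  have im: "snd e ` fst e = (snd c ` fst c) \<times> (snd d ` fst d)"
    by (simp only: e prod_chart_simps prod_chart_image)
  show "homeomorphism (fst e) (snd e ` fst e) (snd e) (chart_inv e)"
    unfolding homeomorphism_def
  proof (intro conjI ballI)
    show "continuous_on (fst e) (snd e)"
      unfolding e prod_chart_simps
      by (rule continuous_on_eq[where f = "\<lambda>z. (snd c (fst z), snd d (snd z))"])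
       (auto intro!: continuous_intros continuous_on_compose2[OF continuous_chart[OF A cd(1)]]
          continuous_on_compose2[OF continuous_chart[OF B cd(2)]])
    show "continuous_on (snd e ` fst e) (chart_inv e)"
      unfolding im
      by (rule continuous_on_eq[where f = "\<lambda>z. (chart_inv c (fst z), chart_inv d (snd z))"])
       (use inv in \<open>auto intro!: continuous_intros continuous_on_compose2[OF continuous_chart_inv[OF A cd(1)]]
          continuous_on_compose2[OF continuous_chart_inv[OF B cd(2)]]\<close>)
    have inv': "chart_inv e (snd e z) = z" if "z \<in> fst e" for z
      using that inv[of "snd e z"] cd
      by (auto simp: e chart_inv_chart[OF A] chart_inv_chart[OF B] mem_Times_iff)
    then show "chart_inv e (snd e z) = z" if "z \<in> fst e" for z using that .
    show "chart_inv e ` snd e ` fst e = fst e" using inv' by (simp add: image_image cong: image_cong_simp)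
    show "snd e (chart_inv e z) = z" if "z \<in> snd e ` fst e" for z using that inv' by auto
  qed auto
qed

section \<open>Fibre derivatives and the metric in charts\<close>

definition fibre_map :: "('b \<times> 'n \<Rightarrow> 'b \<times> 'n) \<Rightarrow> 'b \<Rightarrow> 'n \<Rightarrow> 'n" where
  "fibre_map F x y = snd (F (x, y))"

context
  fixes T :: "('b::topological_space, 'k::euclidean_space) chart set"
    and A :: "('n::topological_space, 'e::euclidean_space) chart set"
  assumes T: "topological_atlas T" and A: "topological_atlas A"
begin

context
  fixes F :: "'b \<times> 'n \<Rightarrow> 'b \<times> 'n" and S :: "'b \<Rightarrow> 'b"
  assumes F: "C1_map (prod_atlas T A) (prod_atlas T A) F" and skew: "\<And>z. fst (F z) = S (fst z)"
begin

lemma continuous_skew: "continuous_on UNIV F"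
  using F by (auto simp: C1_map_def)

lemma continuous_fibre_map: "continuous_on UNIV (fibre_map F x)"
  unfolding fibre_map_def
  by (intro continuous_intros continuous_on_compose2[OF continuous_skew]) auto

text \<open>The total map is composed with the slice on which the base coordinate is constant. By
  skewness the base coordinate of the image is constant too, hence the vanishing first component,
  which is the invariance of TN.\<close>

lemma fibre_map_partial_derivative:
  assumes c: "c1 \<in> T" "c \<in> A" and d: "d1 \<in> T" "d \<in> A"
    and z: "z \<in> fst (prod_chart c1 c)" "F z \<in> fst (prod_chart d1 d)"
  defines "L \<equiv> chart_deriv (prod_chart c1 c) (prod_chart d1 d) F z"
  shows "(snd d \<circ> fibre_map F (fst z) \<circ> chart_inv c has_derivative (\<lambda>v. snd (L (0, v)))) (at (snd c (snd z)))"
    and "fst (L (0, v)) = 0"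
proof -
  define s where "s = snd c1 (fst z)"
  let ?\<Phi> = "snd (prod_chart d1 d) \<circ> F \<circ> chart_inv (prod_chart c1 c)"
  have pc: "prod_chart c1 c \<in> prod_atlas T A" "prod_chart d1 d \<in> prod_atlas T A"
    using c d by (auto simp: prod_atlas_eq simp del: split_paired_Ex)
  have "(?\<Phi> has_derivative L) (at (s, snd c (snd z)))"
    using C1_map_has_derivative[OF topological_atlas_prod[OF T A] F pc z]
    by (simp add: L_def s_def)
  moreover have "((\<lambda>a. (s, a)) has_derivative (\<lambda>v. (0, v))) (at (snd c (snd z)))"
    by (auto intro!: derivative_eq_intros)
  ultimately have "(?\<Phi> \<circ> (\<lambda>a. (s, a)) has_derivative L \<circ> (\<lambda>v. (0, v))) (at (snd c (snd z)))"
    by (intro diff_chain_at)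
  then have D: "((\<lambda>a. (snd d1 (S (fst z)), snd d (fibre_map F (fst z) (chart_inv c a))))
      has_derivative L \<circ> (\<lambda>v. (0, v))) (at (snd c (snd z)))"
  proof (rule has_derivative_transform_within_open)
    show "open (snd c ` fst c)" by (rule chart_open[OF A c(2)])
    show "snd c (snd z) \<in> snd c ` fst c" using z by (auto simp: mem_Times_iff)
    fix a assume a: "a \<in> snd c ` fst c"
    have "s \<in> snd c1 ` fst c1" using z by (auto simp: s_def mem_Times_iff)
    then have "chart_inv (prod_chart c1 c) (s, a) = (fst z, chart_inv c a)"
      using a z by (simp add: prod_chart_inv[OF T A c] s_def chart_inv_chart[OF T c(1)] mem_Times_iff)
    then show "(?\<Phi> \<circ> (\<lambda>a. (s, a))) a = (snd d1 (S (fst z)), snd d (fibre_map F (fst z) (chart_inv c a)))"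
      by (simp add: fibre_map_def skew)
  qed
  from has_derivative_snd[OF D]
  show "(snd d \<circ> fibre_map F (fst z) \<circ> chart_inv c has_derivative (\<lambda>v. snd (L (0, v)))) (at (snd c (snd z)))"
    by (simp add: comp_def)
  have "((\<lambda>a. snd d1 (S (fst z))) has_derivative (\<lambda>v. fst (L (0, v)))) (at (snd c (snd z)))"
    using has_derivative_fst[OF D] by (simp add: comp_def)
  from has_derivative_unique[OF this has_derivative_const] show "fst (L (0, v)) = 0"
    by (simp add: fun_eq_iff)
qed

lemma fibre_map_has_derivative:
  assumes "c \<in> A" "d \<in> A" "snd z \<in> fst c" "snd (F z) \<in> fst d"
  shows "(snd d \<circ> fibre_map F (fst z) \<circ> chart_inv c has_derivative
      chart_deriv c d (fibre_map F (fst z)) (snd z)) (at (snd c (snd z)))"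
proof -
  note D = fibre_map_partial_derivative(1)[of "chart_at T (fst z)" c "chart_at T (fst (F z))" d z]
  have "z \<in> fst (prod_chart (chart_at T (fst z)) c)" "F z \<in> fst (prod_chart (chart_at T (fst (F z))) d)"
    using assms topological_atlas_chart_at[OF T] by (auto simp: mem_Times_iff)
  with D show ?thesis
    using assms topological_atlas_chart_at[OF T] has_derivative_chart_deriv by metis
qed

lemma chart_deriv_vertical:
  assumes c: "c1 \<in> T" "c \<in> A" and d: "d1 \<in> T" "d \<in> A"
    and z: "z \<in> fst (prod_chart c1 c)" "F z \<in> fst (prod_chart d1 d)"
  shows "chart_deriv (prod_chart c1 c) (prod_chart d1 d) F z (0, v) =
    (0, chart_deriv c d (fibre_map F (fst z)) (snd z) v)"
  unfolding has_derivative_chart_deriv[OF fibre_map_partial_derivative(1)[OF assms]]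
  using fibre_map_partial_derivative(2)[OF assms] by (simp add: prod_eq_iff)

text \<open>Continuity jointly in base and fibre is inherited from the total derivative applied to
  vertical vectors. The base charts at \<open>z\<close> and at \<open>F z\<close> vary, so the
  domain is covered by open sets indexed by pairs of them.\<close>

lemma continuous_fibre_deriv:
  assumes "c \<in> A" "d \<in> A"
  shows "continuous_on {z. snd z \<in> fst c \<and> snd (F z) \<in> fst d}
    (\<lambda>z. chart_deriv c d (fibre_map F (fst z)) (snd z) v)"
proof -
  define I where "I = T \<times> T"
  let ?S = "\<lambda>i. fst (prod_chart (fst i) c) \<inter> F -` fst (prod_chart (snd i) d)"
  have pc: "prod_chart c1 e \<in> prod_atlas T A" if "c1 \<in> T" "e \<in> A" for c1 e
    using that by (auto simp: prod_atlas_eq simp del: split_paired_Ex)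
  have "continuous_on (\<Union>i\<in>I. ?S i) (\<lambda>z. chart_deriv c d (fibre_map F (fst z)) (snd z) v)"
  proof (rule continuous_on_open_UN)
    fix i assume "i \<in> I"
    then have i: "fst i \<in> T" "snd i \<in> T" by (auto simp: I_def)
    show "open (?S i)"
      by (intro open_Int open_vimage continuous_skew)
        (simp_all add: open_Times chart_open(1)[OF T i(1)] chart_open(1)[OF T i(2)]
          chart_open(1)[OF A assms(1)] chart_open(1)[OF A assms(2)])
    have "continuous_on (?S i) (\<lambda>z. snd (chart_deriv (prod_chart (fst i) c) (prod_chart (snd i) d) F z (0, v)))"
      by (intro continuous_on_snd C1_map_continuous_deriv[OF topological_atlas_prod[OF T A] F] pc i assms)
    then show "continuous_on (?S i) (\<lambda>z. chart_deriv c d (fibre_map F (fst z)) (snd z) v)"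
      by (rule continuous_on_eq) (use chart_deriv_vertical[OF i(1) assms(1) i(2) assms(2)] in auto)
  qed
  moreover have "(\<Union>i\<in>I. ?S i) = {z. snd z \<in> fst c \<and> snd (F z) \<in> fst d}"
  proof (intro equalityI subsetI)
    fix z assume "z \<in> {z. snd z \<in> fst c \<and> snd (F z) \<in> fst d}"
    then have "z \<in> ?S (chart_at T (fst z), chart_at T (fst (F z)))"
      using topological_atlas_chart_at[OF T] by (auto simp: mem_Times_iff)
    then show "z \<in> (\<Union>i\<in>I. ?S i)"
      using topological_atlas_chart_at[OF T] unfolding I_def by blast
  qed (auto simp: mem_Times_iff)
  ultimately show ?thesis by simp
qed

end

lemma fibre_map_comp:
  assumes "\<And>z. fst (F z) = S (fst z)"
  shows "fibre_map (G \<circ> F) x = fibre_map G (S x) \<circ> fibre_map F x"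
  using assms by (auto simp: fibre_map_def fun_eq_iff) (metis fst_conv prod.collapse)

lemma chart_deriv_fibre_map_comp:
  assumes F: "C1_map (prod_atlas T A) (prod_atlas T A) F" "\<And>z. fst (F z) = S (fst z)"
    and G: "C1_map (prod_atlas T A) (prod_atlas T A) G" "\<And>z. fst (G z) = S' (fst z)"
    and "c \<in> A" "e \<in> A" "d \<in> A" "snd z \<in> fst c" "snd (F z) \<in> fst e" "snd (G (F z)) \<in> fst d"
  shows "chart_deriv c d (fibre_map (G \<circ> F) (fst z)) (snd z) v =
    chart_deriv e d (fibre_map G (fst (F z))) (snd (F z)) (chart_deriv c e (fibre_map F (fst z)) (snd z) v)"
proof -
  have Fz: "fibre_map F (fst z) (snd z) = snd (F z)" by (simp add: fibre_map_def)
  have "(snd d \<circ> (fibre_map G (fst (F z)) \<circ> fibre_map F (fst z)) \<circ> chart_inv c has_derivative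
     chart_deriv e d (fibre_map G (fst (F z))) (snd (F z)) \<circ> chart_deriv c e (fibre_map F (fst z)) (snd z)) (at (snd c (snd z)))"
    by (rule has_derivative_chart_comp[OF A assms(5) A assms(6) continuous_fibre_map[OF F] assms(8)])
     (use fibre_map_has_derivative[OF F assms(5,6,8,9)] fibre_map_has_derivative[OF G assms(6,7,9,10)] assms(9)
       in \<open>simp_all add: Fz\<close>)
  then show ?thesis
    unfolding fibre_map_comp[where F = F and S = S, OF F(2)] F(2)[symmetric]
    by (simp add: has_derivative_chart_deriv)
qed

end

section \<open>Coordinate changes and the Riemannian metric in a chart\<close>

lemma chart_deriv_id_self:
  assumes "topological_atlas A" "c \<in> A" "p \<in> fst c"
  shows "chart_deriv c c id p v = v"
  using has_derivative_chart_deriv[OF has_derivative_chart_id[OF assms]] by simp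

lemma smooth_chart_deriv_id:
  assumes A: "smooth_atlas A" and "c \<in> A" "d \<in> A" "p \<in> fst c" "p \<in> fst d"
  shows "(snd d \<circ> id \<circ> chart_inv c has_derivative chart_deriv c d id p) (at (snd c p))"
  using C1_map_has_derivative[OF smooth_atlas_imp_topological_atlas[OF A] smooth_atlas_C1_map_id[OF A]] assms
  by simp

lemma smooth_chart_deriv_id_comp:
  fixes A :: "('a::topological_space, 'e::euclidean_space) chart set"
  assumes A: "smooth_atlas A" and "c \<in> A" "e \<in> A" "d \<in> A" "p \<in> fst c" "p \<in> fst e" "p \<in> fst d"
  shows "chart_deriv e d id p (chart_deriv c e id p v) = chart_deriv c d id p v"
proof -
  note A' = smooth_atlas_imp_topological_atlas[OF A]
  have "(snd d \<circ> (id \<circ> id) \<circ> chart_inv c has_derivative chart_deriv e d id p \<circ> chart_deriv c e id p) (at (snd c p))"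
  proof (rule has_derivative_chart_comp[OF A' assms(2) A' assms(3) _ assms(5)])
    show "continuous_on UNIV (id :: 'a \<Rightarrow> 'a)" by (simp add: id_def)
    show "id p \<in> fst e" using assms by simp
    show "(snd e \<circ> id \<circ> chart_inv c has_derivative chart_deriv c e id p) (at (snd c p))"
      by (rule smooth_chart_deriv_id[OF A assms(2,3,5,6)])
    show "(snd d \<circ> id \<circ> chart_inv e has_derivative chart_deriv e d id p) (at (snd e (id p)))"
      using smooth_chart_deriv_id[OF A assms(3,4,6,7)] by simp
  qed
  then show ?thesis by (simp add: has_derivative_chart_deriv)
qed

lemma coord_vector_eq:
  "coord_vector A c p a = (\<lambda>d. if d \<in> A \<and> p \<in> fst d then chart_deriv c d id p a else 0)"
  by (simp add: coord_vector_def chart_deriv_def comp_def id_def fun_eq_iff)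

lemma coord_vector_in_tangent_space:
  assumes A: "smooth_atlas A" and c: "c \<in> A" "p \<in> fst c"
  shows "coord_vector A c p a \<in> tangent_space A p"
proof -
  have *: "coord_vector A c p a d = chart_deriv e d id p (coord_vector A c p a e)"
    if "e \<in> A" "d \<in> A" "p \<in> fst e \<inter> fst d" for e d
    using smooth_chart_deriv_id_comp[OF A c(1) that(1,2) c(2)] that by (simp add: coord_vector_eq)
  have "\<forall>e\<in>A. \<forall>d\<in>A. p \<in> fst e \<inter> fst d \<longrightarrow> coord_vector A c p a d =
      frechet_derivative (snd d \<circ> chart_inv e) (at (snd e p)) (coord_vector A c p a e)"
    by (intro ballI impI) (rule *[unfolded chart_deriv_def comp_id])
  moreover have "\<forall>d. \<not> (d \<in> A \<and> p \<in> fst d) \<longrightarrow> coord_vector A c p a d = 0"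
    by (simp add: coord_vector_eq)
  ultimately show ?thesis unfolding tangent_space_def mem_Collect_eq by (rule conjI)
qed

lemma coord_vector_change:
  assumes A: "smooth_atlas A" and "c \<in> A" "e \<in> A" "p \<in> fst c" "p \<in> fst e"
  shows "coord_vector A e p (chart_deriv c e id p a) = coord_vector A c p a"
proof
  fix d
  show "coord_vector A e p (chart_deriv c e id p a) d = coord_vector A c p a d"
    using smooth_chart_deriv_id_comp[OF A assms(2,3) _ assms(4,5), of d] by (simp add: coord_vector_eq)
qed

lemma coord_vector_add:
  assumes A: "smooth_atlas A" and "c \<in> A" "p \<in> fst c"
  shows "coord_vector A c p (a + b) = (\<lambda>d. coord_vector A c p a d + coord_vector A c p b d)"
proof
  fix d
  show "coord_vector A c p (a + b) d = coord_vector A c p a d + coord_vector A c p b d"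
    using linear_add[OF has_derivative_linear[OF smooth_chart_deriv_id[OF A assms(2) _ assms(3)]], of d]
    by (simp add: coord_vector_eq)
qed

lemma coord_vector_scale:
  assumes A: "smooth_atlas A" and "c \<in> A" "p \<in> fst c"
  shows "coord_vector A c p (t *\<^sub>R a) = (\<lambda>d. t *\<^sub>R coord_vector A c p a d)"
proof
  fix d
  show "coord_vector A c p (t *\<^sub>R a) d = t *\<^sub>R coord_vector A c p a d"
    using linear_scale[OF has_derivative_linear[OF smooth_chart_deriv_id[OF A assms(2) _ assms(3)]], of d]
    by (simp add: coord_vector_eq)
qed

definition metric_form :: "('n, 'e::euclidean_space) chart set \<Rightarrow> ('n, 'e) metric \<Rightarrow> ('n, 'e) chart \<Rightarrow> 'n \<Rightarrow> 'e \<Rightarrow> 'e \<Rightarrow> real" where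
  "metric_form A g c p a b = g p (coord_vector A c p a) (coord_vector A c p b)"

context
  fixes A :: "('n::topological_space, 'e::euclidean_space) chart set" and g :: "('n, 'e) metric"
  assumes A: "smooth_atlas A" and g: "riemannian_metric A g"
begin

context
  fixes c p assumes c: "c \<in> A" "p \<in> fst c"
begin

private lemma tangent: "coord_vector A c p a \<in> tangent_space A p"
  by (rule coord_vector_in_tangent_space[OF A c])

lemma metric_form_sym: "metric_form A g c p a b = metric_form A g c p b a"
  using g tangent unfolding riemannian_metric_def metric_form_def by blast

lemma metric_form_add_left:
  "metric_form A g c p (a + a') b = metric_form A g c p a b + metric_form A g c p a' b"
  using g tangent unfolding riemannian_metric_def metric_form_def coord_vector_add[OF A c] by blast

lemma metric_form_scale_left: "metric_form A g c p (t *\<^sub>R a) b = t * metric_form A g c p a b"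
  using g tangent unfolding riemannian_metric_def metric_form_def coord_vector_scale[OF A c] by blast

lemma metric_form_add_right:
  "metric_form A g c p a (b + b') = metric_form A g c p a b + metric_form A g c p a b'"
  by (metis metric_form_add_left metric_form_sym)

lemma metric_form_scale_right: "metric_form A g c p a (t *\<^sub>R b) = t * metric_form A g c p a b"
  by (metis metric_form_scale_left metric_form_sym)

lemma metric_form_pos: "a \<noteq> 0 \<Longrightarrow> 0 < metric_form A g c p a a"
proof -
  assume "a \<noteq> 0"
  have "coord_vector A c p a c = a"
    using c chart_deriv_id_self[OF smooth_atlas_imp_topological_atlas[OF A]] by (simp add: coord_vector_eq)
  then have "coord_vector A c p a \<noteq> (\<lambda>c. 0)" using \<open>a \<noteq> 0\<close> by metis
  then show ?thesis
    using g tangent unfolding riemannian_metric_def metric_form_def by blast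
qed

lemma metric_form_0_left [simp]: "metric_form A g c p 0 b = 0"
  using metric_form_scale_left[of 0 0 b] by simp

lemma metric_form_sum_left:
  "metric_form A g c p (\<Sum>i\<in>I. h i) b = (\<Sum>i\<in>I. metric_form A g c p (h i) b)"
  by (induction I rule: infinite_finite_induct) (auto simp: metric_form_add_left)

lemma metric_form_nonneg: "0 \<le> metric_form A g c p a a"
  using metric_form_pos[of a] by (cases "a = 0") auto

text \<open>Nonnegativity of the form at \<open>a - b\<close>. This supplies
  \<open>\<rho>_add\<close> for the fibre cocycle.\<close>

lemma metric_form_add_le:
  "metric_form A g c p (a + b) (a + b) \<le> 2 * metric_form A g c p a a + 2 * metric_form A g c p b b"
proof -
  have "0 \<le> metric_form A g c p (a + (- 1) *\<^sub>R b) (a + (- 1) *\<^sub>R b)" by (rule metric_form_nonneg)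
  then show ?thesis
    unfolding metric_form_add_left metric_form_add_right metric_form_scale_left metric_form_scale_right
    using metric_form_sym[of a b] by simp
qed

lemma metric_form_basis:
  "metric_form A g c p a a = (\<Sum>i\<in>Basis. \<Sum>j\<in>Basis. (a \<bullet> i) * (a \<bullet> j) * metric_form A g c p i j)"
proof -
  have 1: "metric_form A g c p a b = (\<Sum>i\<in>Basis. (a \<bullet> i) * metric_form A g c p i b)" for a b
    by (subst euclidean_representation[of a, symmetric]) (simp add: metric_form_sum_left metric_form_scale_left)
  have "metric_form A g c p a a = (\<Sum>i\<in>Basis. (a \<bullet> i) * metric_form A g c p a i)"
    by (subst 1) (simp add: metric_form_sym)
  also have "\<dots> = (\<Sum>i\<in>Basis. \<Sum>j\<in>Basis. (a \<bullet> i) * ((a \<bullet> j) * metric_form A g c p j i))"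
    by (simp only: 1[of a] sum_distrib_left)
  also have "\<dots> = (\<Sum>i\<in>Basis. \<Sum>j\<in>Basis. (a \<bullet> i) * (a \<bullet> j) * metric_form A g c p i j)"
    by (intro sum.cong refl) (simp add: metric_form_sym)
  finally show ?thesis .
qed

end

text \<open>Smoothness of the metric concerns fixed coordinate vectors; the basis expansion of the
  quadratic form turns it into joint continuity.\<close>

lemma continuous_metric_form:
  assumes c: "c \<in> A"
  shows "continuous_on (fst c \<times> UNIV) (\<lambda>(p, a). metric_form A g c p a a)"
proof -
  note A' = smooth_atlas_imp_topological_atlas[OF A]
  have "continuous_on (fst c) (\<lambda>p. metric_form A g c p i j)" for i j
  proof -
    have "Ck_on 0 (\<lambda>x. metric_form A g c (chart_inv c x) i j) (snd c ` fst c)"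
      using g c unfolding riemannian_metric_def smooth_on_def metric_form_def by blast
    then have "continuous_on (fst c) ((\<lambda>x. metric_form A g c (chart_inv c x) i j) \<circ> snd c)"
      by (intro continuous_on_compose continuous_chart[OF A' c]) simp
    then show ?thesis
      by (rule continuous_on_eq) (simp add: chart_inv_chart[OF A' c])
  qed
  then have "continuous_on (fst c \<times> UNIV)
      (\<lambda>q. \<Sum>i\<in>Basis. \<Sum>j\<in>Basis. (snd q \<bullet> i) * (snd q \<bullet> j) * metric_form A g c (fst q) i j)"
    by (intro continuous_intros continuous_on_compose2[of "fst c" _ _ fst]) auto
  then show ?thesis
    by (rule continuous_on_eq) (auto simp: metric_form_basis[OF c, symmetric])
qed

lemma metric_form_change:
  assumes "c \<in> A" "e \<in> A" "p \<in> fst c" "p \<in> fst e"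
  shows "metric_form A g e p (chart_deriv c e id p a) (chart_deriv c e id p a) = metric_form A g c p a a"
  unfolding metric_form_def by (simp add: coord_vector_change[OF A assms])

end

section \<open>The fibre cocycle of a skew product\<close>

locale skew_product =
  fixes A :: "('n::{t2_space, second_countable_topology}, 'e::euclidean_space) chart set"
    and g :: "('n, 'e) metric"
    and At :: "torus2 \<Rightarrow> torus2"
    and f :: "torus2 \<times> 'n \<Rightarrow> torus2 \<times> 'n"
  assumes compact_fibre: "compact (UNIV :: 'n set)"
    and smooth: "smooth_atlas A"
    and riemannian: "riemannian_metric A g"
    and base_diffeo: "C1_diffeo torus_atlas At"
    and skew: "fst (f z) = At (fst z)"
    and diffeo: "C1_diffeo (total_atlas A) f"
begin

lemma atlases: "topological_atlas A" "topological_atlas (total_atlas A)"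
  using smooth_atlas_imp_topological_atlas[OF smooth] topological_atlas_prod[OF topological_atlas_torus]
  by auto

text \<open>Writing the identity as \<open>f \<circ> inv f\<close> saves the computation of the coordinate changes of
  the torus.\<close>

lemma C1_id: "C1_map (total_atlas A) (total_atlas A) id"
proof -
  have "f \<circ> inv f = id" using diffeo by (simp add: C1_diffeo_def bij_def surj_iff)
  then show ?thesis
    using C1_map_comp[OF atlases(2) atlases(2) atlases(2), of "inv f" f] diffeo by (simp add: C1_diffeo_def)
qed

lemma C1_torus_id: "C1_map torus_atlas torus_atlas id"
proof -
  have "At \<circ> inv At = id" using base_diffeo by (simp add: C1_diffeo_def bij_def surj_iff)
  then show ?thesis
    using C1_map_comp[OF topological_atlas_torus topological_atlas_torus topological_atlas_torus, of "inv At" At]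
      base_diffeo by (simp add: C1_diffeo_def)
qed

lemma C1_funpow:
  assumes "C1_map (total_atlas A) (total_atlas A) h"
  shows "C1_map (total_atlas A) (total_atlas A) (h ^^ n)"
proof (induction n)
  case 0
  show ?case using C1_id by (simp add: id_def)
next
  case (Suc n)
  show ?case unfolding funpow.simps by (rule C1_map_comp[OF atlases(2) atlases(2) atlases(2) Suc assms])
qed

lemma C1_iterate: "C1_map (total_atlas A) (total_atlas A) (f ^^ n)"
  "C1_map (total_atlas A) (total_atlas A) (inv f ^^ n)"
  using diffeo by (auto intro!: C1_funpow simp: C1_diffeo_def)

lemma skew_iterate: "fst ((f ^^ n) z) = (At ^^ n) (fst z)"
  by (induction n) (auto simp: skew)

lemma skew_inverse_iterate: "fst ((inv f ^^ n) z) = (inv At ^^ n) (fst z)"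
proof (induction n)
  case (Suc n)
  have "fst (inv f w) = inv At (fst w)" for w
  proof -
    have "At (fst (inv f w)) = fst w"
      using diffeo skew[of "inv f w"] by (simp add: C1_diffeo_def bij_def surj_f_inv_f)
    then show ?thesis using base_diffeo by (metis C1_diffeo_def bij_inv_eq_iff)
  qed
  then show ?case using Suc by simp
qed simp

lemma inverse_iterate: "(inv f ^^ n) ((f ^^ n) z) = z" "(f ^^ n) ((inv f ^^ n) z) = z"
proof -
  have f: "inv f (f w) = w" "f (inv f w) = w" for w
    using diffeo by (auto simp: C1_diffeo_def bij_def surj_f_inv_f)
  show "(inv f ^^ n) ((f ^^ n) z) = z"
    by (induction n arbitrary: z) (simp_all add: f funpow_swap1)
  show "(f ^^ n) ((inv f ^^ n) z) = z"
    by (induction n arbitrary: z) (simp_all add: f funpow_swap1)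
qed

definition fibre_deriv :: "nat \<Rightarrow> ('n, 'e) chart \<Rightarrow> ('n, 'e) chart \<Rightarrow> torus2 \<times> 'n \<Rightarrow> 'e \<Rightarrow> 'e" where
  "fibre_deriv n c d z = chart_deriv c d (fibre_map (f ^^ n) (fst z)) (snd z)"

lemmas fibre_deriv_has_derivative =
  fibre_map_has_derivative[OF topological_atlas_torus atlases(1) C1_iterate(1) skew_iterate,
    folded fibre_deriv_def]

lemma linear_fibre_deriv:
  "c \<in> A \<Longrightarrow> d \<in> A \<Longrightarrow> snd z \<in> fst c \<Longrightarrow> snd ((f ^^ n) z) \<in> fst d \<Longrightarrow> linear (fibre_deriv n c d z)"
  by (rule has_derivative_linear[OF fibre_deriv_has_derivative])

lemma fibre_deriv_add:
  assumes "c \<in> A" "e \<in> A" "d \<in> A" "snd z \<in> fst c" "snd ((f ^^ n) z) \<in> fst e" "snd ((f ^^ (n + k)) z) \<in> fst d"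
  shows "fibre_deriv (n + k) c d z v = fibre_deriv k e d ((f ^^ n) z) (fibre_deriv n c e z v)"
proof -
  have "f ^^ (n + k) = f ^^ k \<circ> f ^^ n" using funpow_add[of k n f] by (simp add: add.commute)
  then show ?thesis
    using chart_deriv_fibre_map_comp[OF topological_atlas_torus atlases(1) C1_iterate(1) skew_iterate
        C1_iterate(1)[of k] skew_iterate assms(1-5)] assms(6)
    by (simp add: fibre_deriv_def)
qed

lemma fibre_deriv_0: "fibre_deriv 0 c d z = chart_deriv c d id (snd z)"
proof -
  have "fibre_map (f ^^ 0) (fst z) = id" by (auto simp: fibre_map_def)
  then show ?thesis by (simp add: fibre_deriv_def)
qed

lemma fibre_deriv_0_self: "c \<in> A \<Longrightarrow> snd z \<in> fst c \<Longrightarrow> fibre_deriv 0 c c z v = v"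
  by (simp add: fibre_deriv_0 chart_deriv_id_self[OF atlases(1)])

definition inverse_deriv :: "nat \<Rightarrow> ('n, 'e) chart \<Rightarrow> ('n, 'e) chart \<Rightarrow> torus2 \<times> 'n \<Rightarrow> 'e \<Rightarrow> 'e" where
  "inverse_deriv n d c z = chart_deriv d c (fibre_map (inv f ^^ n) (fst z)) (snd z)"

lemmas inverse_deriv_has_derivative =
  fibre_map_has_derivative[OF topological_atlas_torus atlases(1) C1_iterate(2) skew_inverse_iterate,
    folded inverse_deriv_def]

lemma inverse_deriv_fibre_deriv:
  assumes "c \<in> A" "d \<in> A" "snd z \<in> fst c" "snd ((f ^^ n) z) \<in> fst d"
  shows "inverse_deriv n d c ((f ^^ n) z) (fibre_deriv n c d z v) = v"
proof -
  have "inv f ^^ n \<circ> f ^^ n = f ^^ 0" by (auto simp: inverse_iterate)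
  then show ?thesis
    using chart_deriv_fibre_map_comp[OF topological_atlas_torus atlases(1) C1_iterate(1) skew_iterate
        C1_iterate(2)[of n] skew_inverse_iterate assms(1,2,1,3,4)] assms(3) fibre_deriv_0_self[OF assms(1,3)]
    by (simp add: fibre_deriv_def inverse_deriv_def inverse_iterate del: funpow.simps)
qed

lemma inj_fibre_deriv:
  assumes "c \<in> A" "d \<in> A" "snd z \<in> fst c" "snd ((f ^^ n) z) \<in> fst d"
  shows "inj (fibre_deriv n c d z)"
  using inverse_deriv_fibre_deriv[OF assms] by (rule inj_on_inverseI)

lemma fibre_deriv_inverse_deriv:
  assumes "c \<in> A" "d \<in> A" "snd z \<in> fst c" "snd ((f ^^ n) z) \<in> fst d"
  shows "fibre_deriv n c d z (inverse_deriv n d c ((f ^^ n) z) v) = v"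
proof -
  have "surj (fibre_deriv n c d z)"
    by (rule linear_injective_imp_surjective[OF linear_fibre_deriv inj_fibre_deriv]) (use assms in auto)
  then obtain u where "v = fibre_deriv n c d z u" by (meson surjD)
  then show ?thesis using inverse_deriv_fibre_deriv[OF assms] by simp
qed

abbreviation chart_of :: "torus2 \<times> 'n \<Rightarrow> ('n, 'e) chart" where
  "chart_of z \<equiv> chart_at A (snd z)"

lemma chart_of: "chart_of z \<in> A" "snd z \<in> fst (chart_of z)"
  using topological_atlas_chart_at[OF atlases(1)] by auto

text \<open>The charts at both ends are the selected ones, which makes the cocycle identity hold
  without coordinate changes but may destroy continuity in \<open>z\<close>.\<close>

definition iter_deriv :: "nat \<Rightarrow> torus2 \<times> 'n \<Rightarrow> 'e \<Rightarrow> 'e" where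
  "iter_deriv n z = fibre_deriv n (chart_of z) (chart_of ((f ^^ n) z)) z"

definition sqnorm :: "torus2 \<times> 'n \<Rightarrow> 'e \<Rightarrow> real" where
  "sqnorm z a = metric_form A g (chart_of z) (snd z) a a"

text \<open>\<open>fibre_deriv 0\<close> is a coordinate change. Absorbing it at the source and
  using invariance of the metric at the target removes the selected charts, so the expression can be
  studied in fixed charts \<open>c\<close> and \<open>d\<close>.\<close>

lemma sqnorm_iter_deriv:
  assumes "c \<in> A" "d \<in> A" "snd z \<in> fst c" "snd ((f ^^ n) z) \<in> fst d"
  shows "sqnorm ((f ^^ n) z) (iter_deriv n z (fibre_deriv 0 c (chart_of z) z a)) =
    metric_form A g d (snd ((f ^^ n) z)) (fibre_deriv n c d z a) (fibre_deriv n c d z a)"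
proof -
  have "iter_deriv n z (fibre_deriv 0 c (chart_of z) z a) = fibre_deriv n c (chart_of ((f ^^ n) z)) z a"
    using fibre_deriv_add[of c "chart_of z" "chart_of ((f ^^ n) z)" z 0 n a] assms chart_of
    by (simp add: iter_deriv_def)
  also have "\<dots> = chart_deriv d (chart_of ((f ^^ n) z)) id (snd ((f ^^ n) z)) (fibre_deriv n c d z a)"
    using fibre_deriv_add[of c d "chart_of ((f ^^ n) z)" z n 0 a] assms chart_of
    by (simp add: fibre_deriv_0)
  finally show ?thesis
    using metric_form_change[OF smooth riemannian assms(2) _ assms(4)] chart_of by (simp add: sqnorm_def)
qed

lemma sqnorm_chart:
  assumes "c \<in> A" "snd z \<in> fst c"
  shows "sqnorm z (fibre_deriv 0 c (chart_of z) z a) = metric_form A g c (snd z) a a"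
  using metric_form_change[OF smooth riemannian assms(1) _ assms(2)] chart_of
  by (simp add: sqnorm_def fibre_deriv_0)

lemma continuous_fibre_deriv_form:
  assumes c: "c \<in> A"
  shows "continuous_on ({z. snd z \<in> fst c} \<times> UNIV)
    (\<lambda>(z, a). sqnorm ((f ^^ n) z) (iter_deriv n z (fibre_deriv 0 c (chart_of z) z a)))"
proof -
  let ?U = "\<lambda>d. {z. snd z \<in> fst c \<and> snd ((f ^^ n) z) \<in> fst d}"
  have cont_f: "continuous_on UNIV (f ^^ n)" using C1_iterate(1) by (auto simp: C1_map_def)
  have "continuous_on (\<Union>d\<in>A. ?U d \<times> UNIV)
      (\<lambda>(z, a). sqnorm ((f ^^ n) z) (iter_deriv n z (fibre_deriv 0 c (chart_of z) z a)))"
  proof (rule continuous_on_open_UN)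
    fix d assume d: "d \<in> A"
    have "?U d = snd -` fst c \<inter> (\<lambda>z. snd ((f ^^ n) z)) -` fst d" by auto
    then have "open (?U d)"
      using chart_open(1)[OF atlases(1) c] chart_open(1)[OF atlases(1) d]
      by (simp only:) (intro open_Int open_vimage continuous_on_snd continuous_intros cont_f)
    then show "open (?U d \<times> UNIV)" by (intro open_Times) auto
    have lin: "linear (fibre_deriv n c d (fst q))" if "q \<in> ?U d \<times> UNIV" for q :: "(torus2 \<times> 'n) \<times> 'e"
      using that by (intro linear_fibre_deriv c d) auto
    have "continuous_on (?U d) (\<lambda>z. fibre_deriv n c d z v)" for v
      unfolding fibre_deriv_def
      by (rule continuous_fibre_deriv[OF topological_atlas_torus atlases(1) C1_iterate(1) skew_iterate c d])
    then have cont: "continuous_on (?U d \<times> (UNIV :: 'e set)) (\<lambda>q. fibre_deriv n c d (fst q) v)" for v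
      by (rule continuous_on_compose2) (auto intro: continuous_intros)
    have "continuous_on (?U d \<times> (UNIV :: 'e set)) (\<lambda>q. fibre_deriv n c d (fst q) (snd q))"
    proof (rule continuous_on_linear_family[where L = "\<lambda>q. fibre_deriv n c d (fst q)"])
      show "continuous_on (?U d \<times> (UNIV :: 'e set)) snd" by (intro continuous_intros)
    qed (fact lin cont)+
    then have "continuous_on (?U d \<times> (UNIV :: 'e set))
        (\<lambda>q. (snd ((f ^^ n) (fst q)), fibre_deriv n c d (fst q) (snd q)))"
      by (intro continuous_intros continuous_on_compose2[OF cont_f]) auto
    from continuous_on_compose2[OF continuous_metric_form[OF smooth riemannian d] this]
    have "continuous_on (?U d \<times> UNIV) (\<lambda>q. metric_form A g d (snd ((f ^^ n) (fst q)))
        (fibre_deriv n c d (fst q) (snd q)) (fibre_deriv n c d (fst q) (snd q)))"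
      unfolding prod.case by (rule meta_mp) auto
    then show "continuous_on (?U d \<times> UNIV)
      (\<lambda>(z, a). sqnorm ((f ^^ n) z) (iter_deriv n z (fibre_deriv 0 c (chart_of z) z a)))"
    proof (rule continuous_on_eq)
      fix q :: "(torus2 \<times> 'n) \<times> 'e" assume "q \<in> ?U d \<times> (UNIV :: 'e set)"
      then have "snd (fst q) \<in> fst c" "snd ((f ^^ n) (fst q)) \<in> fst d" by auto
      from sqnorm_iter_deriv[OF c d this, of "snd q"]
      show "metric_form A g d (snd ((f ^^ n) (fst q)))
          (fibre_deriv n c d (fst q) (snd q)) (fibre_deriv n c d (fst q) (snd q)) =
        (case q of (z, a) \<Rightarrow> sqnorm ((f ^^ n) z) (iter_deriv n z (fibre_deriv 0 c (chart_of z) z a)))"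
        by (simp add: case_prod_beta)
    qed
  qed
  moreover have "(\<Union>d\<in>A. ?U d \<times> UNIV) = {z. snd z \<in> fst c} \<times> (UNIV :: 'e set)"
  proof (intro equalityI subsetI)
    fix q :: "(torus2 \<times> 'n) \<times> 'e" assume "q \<in> {z. snd z \<in> fst c} \<times> (UNIV :: 'e set)"
    then have "q \<in> ?U (chart_of ((f ^^ n) (fst q))) \<times> UNIV"
      using chart_of(2)[of "(f ^^ n) (fst q)"] by (auto simp: mem_Times_iff)
    then show "q \<in> (\<Union>d\<in>A. ?U d \<times> UNIV)" using chart_of(1) by blast
  qed auto
  ultimately show ?thesis by simp
qed

sublocale linear_cocycle f iter_deriv sqnorm
proof (rule linear_cocycle.intro)
  show "continuous_on UNIV f" using diffeo by (simp add: C1_diffeo_def C1_map_def)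
  show "compact (UNIV :: (torus2 \<times> 'n) set)"
    using compact_Times[OF compact_torus compact_fibre] by (simp add: UNIV_Times_UNIV)
  fix n k and z :: "torus2 \<times> 'n" and a b :: 'e and t :: real
  note c = chart_of[of z]
  show "linear (iter_deriv n z)" "inj (iter_deriv n z)"
    unfolding iter_deriv_def by (intro linear_fibre_deriv inj_fibre_deriv chart_of)+
  show "iter_deriv 0 z a = a"
    unfolding iter_deriv_def using fibre_deriv_0_self[OF c] by simp
  show "iter_deriv (n + k) z a = iter_deriv k ((f ^^ n) z) (iter_deriv n z a)"
    using fibre_deriv_add[of "chart_of z" "chart_of ((f ^^ n) z)" "chart_of ((f ^^ (n + k)) z)" z n k a]
      chart_of funpow_add[of k n f] by (simp add: iter_deriv_def add.commute)
  show "a \<noteq> 0 \<Longrightarrow> 0 < sqnorm z a"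
    unfolding sqnorm_def by (rule metric_form_pos[OF smooth riemannian c])
  show "sqnorm z (t *\<^sub>R a) = t\<^sup>2 * sqnorm z a"
    by (simp add: sqnorm_def metric_form_scale_left[OF smooth riemannian c]
        metric_form_scale_right[OF smooth riemannian c] power2_eq_square)
  show "sqnorm z (a + b) \<le> 2 * sqnorm z a + 2 * sqnorm z b"
    unfolding sqnorm_def by (rule metric_form_add_le[OF smooth riemannian c])
  let ?U = "{w :: torus2 \<times> 'n. snd w \<in> fst (chart_of z)}"
  \<comment> \<open>The local frame: coordinates in the chart selected at the centre
    \<open>z\<close>, converted to the chart selected at \<open>w\<close>.\<close>
  let ?T = "\<lambda>w. fibre_deriv 0 (chart_of z) (chart_of w) w"
  have "open (snd -` fst (chart_of z) :: (torus2 \<times> 'n) set)"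
    by (intro open_vimage chart_open(1)[OF atlases(1) c(1)] continuous_intros)
  then have "open ?U" by (simp add: vimage_def)
  moreover have "linear (?T w) \<and> bij (?T w)" if "w \<in> ?U" for w
  proof -
    have w: "snd w \<in> fst (chart_of z)" "snd ((f ^^ 0) w) \<in> fst (chart_of w)"
      using that chart_of[of w] by auto
    note l = linear_fibre_deriv[OF c(1) chart_of(1) w]
    note i = inj_fibre_deriv[OF c(1) chart_of(1) w]
    have "surj (?T w)" by (rule linear_injective_imp_surjective[OF l i]) (rule refl)
    then show ?thesis using l i by (simp add: bij_def)
  qed
  moreover have "z \<in> ?U" using c by simp
  ultimately show "\<exists>U (T :: torus2 \<times> 'n \<Rightarrow> 'e \<Rightarrow> 'e). open U \<and> z \<in> U \<and>
      (\<forall>w\<in>U. linear (T w) \<and> bij (T w)) \<and>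
      (\<forall>n. continuous_on (U \<times> UNIV) (\<lambda>(w, a). sqnorm ((f ^^ n) w) (iter_deriv n w (T w a))))"
    using continuous_fibre_deriv_form[OF c(1)] by (intro exI[of _ ?U] exI[of _ ?T]) blast
qed

lemma metric_form_expansion:
  assumes cd: "c \<in> A" "d \<in> A" "snd z \<in> fst c" "snd ((f ^^ n) z) \<in> fst d"
  shows "exp (min_growth n z) * metric_form A g c (snd z) a a \<le>
    metric_form A g d (snd ((f ^^ n) z)) (fibre_deriv n c d z a) (fibre_deriv n c d z a)"
proof (cases "a = 0")
  case True
  then show ?thesis
    using linear_0[OF linear_fibre_deriv[OF cd]] metric_form_0_left[OF smooth riemannian] cd by simp
next
  case False
  define b where "b = fibre_deriv 0 c (chart_of z) z a"
  have z0: "snd ((f ^^ 0) z) \<in> fst (chart_of z)" using chart_of by simp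
  have "b \<noteq> 0"
    using False inj_eq[OF inj_fibre_deriv[OF cd(1) chart_of(1) cd(3) z0], of a 0]
      linear_0[OF linear_fibre_deriv[OF cd(1) chart_of(1) cd(3) z0]] by (simp add: b_def)
  define u v where "u = sqnorm z b" and "v = sqnorm ((f ^^ n) z) (iter_deriv n z b)"
  have pos: "0 < u" "0 < v" using \<open>b \<noteq> 0\<close> by (auto simp: u_def v_def \<rho>_pos M_eq_0_iff)
  have "min_growth n z + ln u \<le> ln v"
    using min_growth_le[OF \<open>b \<noteq> 0\<close>, of n z] by (simp add: growth_def u_def v_def)
  then have "exp (min_growth n z + ln u) \<le> v" using pos by (simp add: ln_ge_iff)
  then have "exp (min_growth n z) * u \<le> v" using pos by (simp add: exp_add)
  then show ?thesis
    unfolding u_def v_def b_def sqnorm_iter_deriv[OF cd] sqnorm_chart[OF cd(1,3)] .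
qed

text \<open>The bridge between exponents defined by \<open>differential\<close> and the cocycle. The
  image of a vertical vector is vertical, so the torus part of the product metric vanishes and the
  fibre part is left, whichever charts are selected.\<close>

lemma total_metric_iterate:
  fixes a :: 'e
  defines "v z \<equiv> differential A (total_atlas A) (Pair (fst z)) (snd z) (coord_vector A (chart_of z) (snd z) a)"
  shows "total_metric A g ((f ^^ n) z)
      (differential (total_atlas A) (total_atlas A) (f ^^ n) z (v z))
      (differential (total_atlas A) (total_atlas A) (f ^^ n) z (v z)) =
    sqnorm ((f ^^ n) z) (iter_deriv n z a)"
    and "v z \<in> fibre_tangent_space A z"
    and "a \<noteq> 0 \<Longrightarrow> v z \<noteq> (\<lambda>c. 0)"
proof -
  obtain c1 c where cz: "chart_at (total_atlas A) z = prod_chart c1 c" and c: "c1 \<in> torus_atlas" "c \<in> A"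
    using topological_atlas_chart_at(1)[OF atlases(2), of z] by (auto simp: prod_atlas_eq simp del: split_paired_Ex)
  have z: "z \<in> fst (prod_chart c1 c)" using topological_atlas_chart_at(2)[OF atlases(2), of z] cz by simp
  then have zc: "fst z \<in> fst c1" "snd z \<in> fst c" by (auto simp: mem_Times_iff)
  have pc: "prod_chart c1 c \<in> total_atlas A" using c by (auto simp: prod_atlas_eq simp del: split_paired_Ex)
  have tangent: "coord_vector A (chart_of z) (snd z) a \<in> tangent_space A (snd z)"
    by (intro coord_vector_in_tangent_space[OF smooth] chart_of)
  then show "v z \<in> fibre_tangent_space A z" by (simp add: v_def fibre_tangent_space_def)
  \<comment> \<open>The product chart selected at \<open>z\<close> may have a fibre factor
    \<open>c\<close> other than \<open>chart_of z\<close>; \<open>b\<close> is \<open>a\<close>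
    converted to \<open>c\<close>.\<close>
  define b where "b = fibre_deriv 0 (chart_of z) c z a"
  have "((\<lambda>u. (snd c1 (fst z), (snd c \<circ> id \<circ> chart_inv (chart_of z)) u)) has_derivative
      (\<lambda>u. (0, chart_deriv (chart_of z) c id (snd z) u))) (at (snd (chart_of z) (snd z)))"
    by (intro has_derivative_Pair has_derivative_const smooth_chart_deriv_id[OF smooth] chart_of c zc)
  moreover have "(\<lambda>u. (snd c1 (fst z), (snd c \<circ> id \<circ> chart_inv (chart_of z)) u)) =
      snd (prod_chart c1 c) \<circ> Pair (fst z) \<circ> chart_inv (chart_of z)" by auto
  ultimately have "frechet_derivative (snd (prod_chart c1 c) \<circ> Pair (fst z) \<circ> chart_inv (chart_of z))
      (at (snd (chart_of z) (snd z))) = (\<lambda>u. (0, chart_deriv (chart_of z) c id (snd z) u))"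
    by (metis frechet_derivative_at)
  moreover have "coord_vector A (chart_of z) (snd z) a (chart_of z) = a"
    using chart_of[of z] by (simp add: coord_vector_eq chart_deriv_id_self[OF atlases(1)])
  ultimately have vz: "v z (prod_chart c1 c) = (0, b)"
    using pc z by (simp add: v_def differential_def b_def fibre_deriv_0 Let_def)
  have z0: "snd ((f ^^ 0) z) \<in> fst c" using zc by simp
  show "v z \<noteq> (\<lambda>c. 0)" if "a \<noteq> 0"
  proof
    assume "v z = (\<lambda>c. 0)"
    then have "b = 0" using vz by (simp add: zero_prod_def)
    then show False
      using that inj_eq[OF inj_fibre_deriv[OF chart_of(1) c(2) chart_of(2) z0], of a 0]
        linear_0[OF linear_fibre_deriv[OF chart_of(1) c(2) chart_of(2) z0]] by (simp add: b_def)
  qed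
  define w where "w = differential (total_atlas A) (total_atlas A) (f ^^ n) z (v z)"
  define zn where "zn = (f ^^ n) z"
  obtain d1 d where dz: "chart_at (total_atlas A) zn = prod_chart d1 d" and d: "d1 \<in> torus_atlas" "d \<in> A"
    using topological_atlas_chart_at(1)[OF atlases(2), of zn] by (auto simp: prod_atlas_eq simp del: split_paired_Ex)
  have pd: "prod_chart d1 d \<in> total_atlas A" using d by (auto simp: prod_atlas_eq simp del: split_paired_Ex)
  have zn: "zn \<in> fst (prod_chart d1 d)" using topological_atlas_chart_at(2)[OF atlases(2), of zn] dz by simp
  then have znd: "fst zn \<in> fst d1" "snd zn \<in> fst d" by (auto simp: mem_Times_iff)
  define u where "u = fibre_deriv n c d z b"
  have "w (prod_chart d1 d) = chart_deriv (prod_chart c1 c) (prod_chart d1 d) (f ^^ n) z (0, b)"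
    using pd zn by (simp add: w_def differential_def zn_def cz vz chart_deriv_def Let_def)
  also have "\<dots> = (0, u)"
    unfolding u_def fibre_deriv_def
    by (rule chart_deriv_vertical[OF topological_atlas_torus atlases(1) C1_iterate(1) skew_iterate c d z
          zn[unfolded zn_def]])
  finally have wd: "w (prod_chart d1 d) = (0, u)" .
  have pd_inv: "chart_inv (prod_chart d1 d) q = (chart_inv d1 (fst q), chart_inv d (snd q))"
    if "q \<in> (snd d1 ` fst d1) \<times> (snd d ` fst d)" for q
    using that prod_chart_inv[OF topological_atlas_torus atlases(1) d, of "fst q" "snd q"]
    by (auto simp: mem_Times_iff)
  have op: "open ((snd d1 ` fst d1) \<times> (snd d ` fst d))"
    by (intro open_Times chart_open(2)[OF topological_atlas_torus d(1)] chart_open(2)[OF atlases(1) d(2)])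
  have inop: "snd (prod_chart d1 d) zn \<in> (snd d1 ` fst d1) \<times> (snd d ` fst d)" using znd by auto
  have snd_part: "differential (total_atlas A) A snd zn w = coord_vector A d (snd zn) u"
  proof
    fix e
    show "differential (total_atlas A) A snd zn w e = coord_vector A d (snd zn) u e"
    proof (cases "e \<in> A \<and> snd zn \<in> fst e")
      case True
      have "((snd e \<circ> id \<circ> chart_inv d) \<circ> snd has_derivative chart_deriv d e id (snd zn) \<circ> snd)
          (at (snd (prod_chart d1 d) zn))"
        by (rule diff_chain_at[OF has_derivative_snd[OF has_derivative_ident]])
          (use smooth_chart_deriv_id[OF smooth d(2) _ znd(2)] True in simp)
      then have "(snd e \<circ> snd \<circ> chart_inv (prod_chart d1 d) has_derivative chart_deriv d e id (snd zn) \<circ> snd)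
          (at (snd (prod_chart d1 d) zn))"
        by (rule has_derivative_transform_within_open[OF _ op inop]) (use pd_inv in auto)
      from frechet_derivative_at[OF this, symmetric] show ?thesis
        using True wd by (simp add: differential_def dz coord_vector_eq Let_def)
    next
      case False
      then show ?thesis by (auto simp: differential_def coord_vector_eq)
    qed
  qed
  \<comment> \<open>\<open>torus_metric\<close> reads vectors in this chart, so the entry at
    \<open>t\<close> decides the torus part.\<close>
  define t where "t = chart_at torus_atlas (fst zn)"
  have t: "t \<in> torus_atlas" "fst zn \<in> fst t"
    using topological_atlas_chart_at[OF topological_atlas_torus] by (auto simp: t_def)
  have fst_part: "differential (total_atlas A) torus_atlas fst zn w t = 0"
  proof -
    note D = C1_map_has_derivative[OF topological_atlas_torus C1_torus_id d(1) t(1) znd(1), simplified id_apply, OF t(2)]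
    have "((snd t \<circ> id \<circ> chart_inv d1) \<circ> fst has_derivative chart_deriv d1 t id (fst zn) \<circ> fst)
        (at (snd (prod_chart d1 d) zn))"
      by (rule diff_chain_at[OF has_derivative_fst[OF has_derivative_ident]]) (use D in simp)
    then have "(snd t \<circ> fst \<circ> chart_inv (prod_chart d1 d) has_derivative chart_deriv d1 t id (fst zn) \<circ> fst)
        (at (snd (prod_chart d1 d) zn))"
      by (rule has_derivative_transform_within_open[OF _ op inop]) (use pd_inv in auto)
    from frechet_derivative_at[OF this, symmetric] show ?thesis
      using t wd linear_0[OF has_derivative_linear[OF D]] by (simp add: differential_def dz Let_def)
  qed
  have "total_metric A g zn w w = metric_form A g d (snd zn) u u"
    using fst_part by (simp add: prod_metric_def torus_metric_def t_def[symmetric] snd_part metric_form_def)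
  also have "\<dots> = sqnorm ((f ^^ n) z) (iter_deriv n z a)"
  proof -
    have "fibre_deriv 0 c (chart_of z) z b = a"
      using fibre_deriv_add[of "chart_of z" c "chart_of z" z 0 0 a] chart_of[of z] c zc
      by (simp add: b_def fibre_deriv_0_self)
    then show ?thesis
      using sqnorm_iter_deriv[OF c(2) d(2) zc(2) znd(2)[unfolded zn_def], of b] by (simp add: u_def zn_def)
  qed
  finally show "total_metric A g ((f ^^ n) z)
      (differential (total_atlas A) (total_atlas A) (f ^^ n) z (v z))
      (differential (total_atlas A) (total_atlas A) (f ^^ n) z (v z)) =
    sqnorm ((f ^^ n) z) (iter_deriv n z a)" by (simp add: w_def zn_def)
qed

lemma exponents_positive_imp:
  assumes "fibre_exponents_positive A g f \<mu>"
  shows "AE z in \<mu>. \<forall>a. a \<noteq> 0 \<longrightarrow>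
    0 < limsup (\<lambda>n. ereal (ln (sqrt (sqnorm ((f ^^ n) z) (iter_deriv n z a))) / real n))"
  using assms unfolding fibre_exponents_positive_def
proof eventually_elim
  case (elim z)
  show ?case
  proof (intro allI impI)
    fix a :: 'e assume "a \<noteq> 0"
    with elim total_metric_iterate(2,3)[where z = z and a = a]
    have "0 < lyapunov_exponent (total_atlas A) (total_metric A g) f z
        (differential A (total_atlas A) (Pair (fst z)) (snd z) (coord_vector A (chart_of z) (snd z) a))"
      by blast
    then show "0 < limsup (\<lambda>n. ereal (ln (sqrt (sqnorm ((f ^^ n) z) (iter_deriv n z a))) / real n))"
      by (simp add: lyapunov_exponent_def Let_def total_metric_iterate(1))
  qed
qed

end

section \<open>The basin is a null set\<close>

lemma chart_image_measurable:
  assumes A: "topological_atlas A" "c \<in> A" and S: "S \<in> sets borel" "S \<subseteq> fst c"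
  shows "snd c ` S \<in> sets borel"
proof -
  let ?U = "snd c ` fst c"
  have "chart_inv c \<in> measurable (restrict_space borel ?U) borel"
    by (rule borel_measurable_continuous_on_restrict[OF continuous_chart_inv[OF A]])
  from measurable_sets[OF this S(1)]
  have "chart_inv c -` S \<inter> ?U \<in> sets (restrict_space borel ?U)" by (simp add: space_restrict_space)
  then have "chart_inv c -` S \<inter> ?U \<in> sets borel"
    by (subst (asm) sets_restrict_space_iff) (use chart_open(2)[OF A] in auto)
  moreover have "snd c ` S = chart_inv c -` S \<inter> ?U"
    using chart_image_eq[OF A, of S] S(2) by (metis Int_absorb1 Int_commute)
  ultimately show ?thesis by simp
qed

text \<open>Preimages of closed balls in charts. On such pieces the metric is comparable with the
  Euclidean norm and the chart images are bounded, and finiteness makes the constants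
  uniform.\<close>

lemma compact_chart_pieces:
  fixes A :: "('n::t2_space, 'e::euclidean_space) chart set"
  assumes "compact (UNIV :: 'n set)" and A: "topological_atlas A"
  obtains I where "finite I" "\<And>c Q. (c, Q) \<in> I \<Longrightarrow> c \<in> A \<and> compact Q \<and> Q \<subseteq> fst c"
    "(\<Union>i\<in>I. snd i) = UNIV"
proof -
  have "\<exists>V Q. open V \<and> p \<in> V \<and> V \<subseteq> Q \<and> compact Q \<and> Q \<subseteq> fst (chart_at A p)" for p
  proof -
    let ?c = "chart_at A p"
    note c = topological_atlas_chart_at[OF A, of p]
    note op = chart_open[OF A c(1)]
    obtain \<epsilon> where \<epsilon>: "0 < \<epsilon>" "cball (snd ?c p) \<epsilon> \<subseteq> snd ?c ` fst ?c"
      using open_contains_cball[THEN iffD1, OF op(2)] c(2) by blast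
    let ?Q = "chart_inv ?c ` cball (snd ?c p) \<epsilon>" and ?V = "fst ?c \<inter> snd ?c -` ball (snd ?c p) \<epsilon>"
    have "open ?V" by (intro continuous_open_preimage continuous_chart[OF A c(1)] op) auto
    moreover have "p \<in> ?V" using c(2) \<epsilon> by simp
    moreover have "?V \<subseteq> ?Q"
    proof
      fix q assume "q \<in> ?V"
      then show "q \<in> ?Q"
        using chart_inv_chart[OF A c(1), of q] by (intro image_eqI[of _ _ "snd ?c q"]) auto
    qed
    moreover have "compact ?Q"
      by (intro compact_continuous_image continuous_on_subset[OF continuous_chart_inv[OF A c(1)]] \<epsilon>) auto
    moreover have "?Q \<subseteq> fst ?c" using \<epsilon>(2) chart_inv_in[OF A c(1)] by blast
    ultimately show ?thesis by blast
  qed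
  then obtain V Q where VQ: "\<And>p. open (V p)" "\<And>p. p \<in> V p" "\<And>p. V p \<subseteq> Q p" "\<And>p. compact (Q p)"
      "\<And>p. Q p \<subseteq> fst (chart_at A p)"
    by metis
  obtain F where F: "finite F" "UNIV \<subseteq> (\<Union>p\<in>F. V p)"
    by (rule compactE_image[OF assms(1), of UNIV V]) (use VQ in auto)
  show thesis
  proof (rule that[of "(\<lambda>p. (chart_at A p, Q p)) ` F"])
    show "(\<Union>i\<in>(\<lambda>p. (chart_at A p, Q p)) ` F. snd i) = UNIV" using F VQ(3) by force
    fix c B assume "(c, B) \<in> (\<lambda>p. (chart_at A p, Q p)) ` F"
    then obtain p where "c = chart_at A p" "B = Q p" by auto
    then show "c \<in> A \<and> compact B \<and> B \<subseteq> fst c"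
      using VQ(4,5) topological_atlas_chart_at(1)[OF A] by simp
  qed (use F in auto)
qed

text \<open>The form has a positive minimum and a finite maximum on the compact set of unit vectors
  over \<open>Q\<close>; homogeneity does the rest. A single \<open>k\<close> dominates the maximum
  and the inverse of the minimum.\<close>

lemma metric_form_comparable:
  fixes A :: "('n::t2_space, 'e::euclidean_space) chart set"
  assumes A: "smooth_atlas A" and g: "riemannian_metric A g"
    and c: "c \<in> A" and Q: "compact Q" "Q \<subseteq> fst c"
  obtains k where "0 < k" "\<And>p a. p \<in> Q \<Longrightarrow> metric_form A g c p a a \<le> k * (norm a)\<^sup>2"
    "\<And>p a. p \<in> Q \<Longrightarrow> (norm a)\<^sup>2 \<le> k * metric_form A g c p a a"
proof (cases "Q = {}")
  case True
  then show thesis by (intro that[of 1]) auto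
next
  case False
  let ?h = "\<lambda>(p, a). metric_form A g c p a a"
  have comp: "compact (Q \<times> sphere (0::'e) 1)" by (intro compact_Times Q compact_sphere)
  have cont: "continuous_on (Q \<times> sphere (0::'e) 1) ?h"
    by (rule continuous_on_subset[OF continuous_metric_form[OF A g c]]) (use Q in auto)
  have ne: "Q \<times> sphere (0::'e) 1 \<noteq> {}" using False by simp
  obtain p1 a1 where 1: "p1 \<in> Q" "norm a1 = 1" "\<And>p a. p \<in> Q \<Longrightarrow> norm a = 1 \<Longrightarrow>
      metric_form A g c p1 a1 a1 \<le> metric_form A g c p a a"
    using continuous_attains_inf[OF comp ne cont] by auto
  obtain p2 a2 where 2: "p2 \<in> Q" "norm a2 = 1" "\<And>p a. p \<in> Q \<Longrightarrow> norm a = 1 \<Longrightarrow>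
      metric_form A g c p a a \<le> metric_form A g c p2 a2 a2"
    using continuous_attains_sup[OF comp ne cont] by auto
  define l u where "l = metric_form A g c p1 a1 a1" and "u = metric_form A g c p2 a2 a2"
  have "0 < l"
    unfolding l_def by (rule metric_form_pos[OF A g c]) (use 1 Q in auto)
  have "l \<le> u" unfolding l_def u_def by (rule 1(3)[OF 2(1,2)])
  have scale: "metric_form A g c p a a = (norm a)\<^sup>2 * metric_form A g c p (a /\<^sub>R norm a) (a /\<^sub>R norm a)"
    if "p \<in> Q" "a \<noteq> 0" for p and a :: 'e
    using that Q(2) metric_form_scale_left[OF A g c, of p] metric_form_scale_right[OF A g c, of p]
    by (auto simp: power2_eq_square subset_iff field_simps)
  have bnd: "l * (norm a)\<^sup>2 \<le> metric_form A g c p a a \<and> metric_form A g c p a a \<le> u * (norm a)\<^sup>2" if "p \<in> Q" for p and a :: 'e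
  proof (cases "a = 0")
    case True
    then show ?thesis using metric_form_0_left[OF A g c] that Q(2) by auto
  next
    case False
    then have "l \<le> metric_form A g c p (a /\<^sub>R norm a) (a /\<^sub>R norm a)"
        "metric_form A g c p (a /\<^sub>R norm a) (a /\<^sub>R norm a) \<le> u"
      using 1(3)[OF that, of "a /\<^sub>R norm a"] 2(3)[OF that, of "a /\<^sub>R norm a"] by (auto simp: l_def u_def)
    then show ?thesis unfolding scale[OF that False]
      by (metis mult.commute mult_right_mono zero_le_power2)
  qed
  define k where "k = max u (1 / l)"
  show thesis
  proof (rule that[of k])
    show "0 < k" using \<open>0 < l\<close> by (simp add: k_def less_max_iff_disj)
    fix p and a :: 'e assume p: "p \<in> Q"
    have "u * (norm a)\<^sup>2 \<le> k * (norm a)\<^sup>2" by (rule mult_right_mono) (auto simp: k_def)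
    then show "metric_form A g c p a a \<le> k * (norm a)\<^sup>2" using bnd[OF p, of a] by linarith
    have "(norm a)\<^sup>2 = 1 / l * (l * (norm a)\<^sup>2)" using \<open>0 < l\<close> by simp
    also have "\<dots> \<le> 1 / l * metric_form A g c p a a"
      using bnd[OF p, of a] \<open>0 < l\<close> by (intro mult_left_mono) auto
    also have "\<dots> \<le> k * metric_form A g c p a a"
      using metric_form_nonneg[OF A g c, of p] p Q by (intro mult_right_mono) (auto simp: k_def)
    finally show "(norm a)\<^sup>2 \<le> k * metric_form A g c p a a" .
  qed
qed

context skew_product
begin

lemma continuous_iterate: "continuous_on UNIV (f ^^ n)"
  using C1_iterate(1) by (auto simp: C1_map_def)

section \<open>Smallness of uniformly expanded sets\<close>

text \<open>Passing between the Riemannian and the Euclidean norm costs a factor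
  \<open>sqrt k\<close> at each end, so \<open>k\<close> in total. The exponent is halved because
  \<open>min_growth\<close> refers to squared norms.\<close>

lemma norm_inverse_deriv_le:
  assumes cd: "c \<in> A" "d \<in> A" "snd z \<in> fst c" "snd ((f ^^ n) z) \<in> fst d"
    and k: "0 < k" "\<And>a. (norm a)\<^sup>2 \<le> k * metric_form A g c (snd z) a a"
      "\<And>a. metric_form A g d (snd ((f ^^ n) z)) a a \<le> k * (norm a)\<^sup>2"
    and t: "t \<le> min_growth n z"
  shows "onorm (inverse_deriv n d c ((f ^^ n) z)) \<le> k * exp (- t / 2)"
proof (rule onorm_le)
  fix v
  let ?a = "inverse_deriv n d c ((f ^^ n) z) v"
  have "exp t * (norm ?a)\<^sup>2 \<le> exp t * (k * metric_form A g c (snd z) ?a ?a)"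
    by (intro mult_left_mono k) simp
  also have "\<dots> = k * (exp t * metric_form A g c (snd z) ?a ?a)" by simp
  also have "\<dots> \<le> k * (exp (min_growth n z) * metric_form A g c (snd z) ?a ?a)"
    using k(1) t metric_form_nonneg[OF smooth riemannian cd(1,3)]
    by (intro mult_left_mono mult_right_mono) auto
  also have "\<dots> \<le> k * metric_form A g d (snd ((f ^^ n) z)) v v"
    using metric_form_expansion[OF cd, of ?a] k(1) by (intro mult_left_mono) (auto simp: fibre_deriv_inverse_deriv[OF cd])
  also have "\<dots> \<le> k * (k * (norm v)\<^sup>2)" using k by (intro mult_left_mono) auto
  finally have "(norm ?a)\<^sup>2 \<le> exp (- t) * (k * (k * (norm v)\<^sup>2))"
    by (simp add: exp_minus field_simps)
  also have "\<dots> = (k * exp (- t / 2) * norm v)\<^sup>2"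
  proof -
    have "exp (- t) = (exp (- t / 2))\<^sup>2" by (simp add: power2_eq_square exp_add[symmetric])
    then show ?thesis by (simp add: power_mult_distrib power2_eq_square)
  qed
  finally show "norm ?a \<le> k * exp (- t / 2) * norm v"
    by (rule power2_le_imp_le) (use k in auto)
qed

definition expanded :: "torus2 \<Rightarrow> real \<Rightarrow> nat \<Rightarrow> 'n set" where
  "expanded x t n = {y. t \<le> min_growth n (x, y)}"

lemma closed_expanded: "closed (expanded x t n)"
proof -
  have "expanded x t n = (\<lambda>y. min_growth n (x, y)) -` {t..}" by (auto simp: expanded_def)
  moreover have "continuous_on UNIV (\<lambda>y. min_growth n (x, y))"
    by (rule continuous_on_compose2[OF continuous_min_growth]) (auto intro: continuous_intros)
  ultimately show ?thesis using closed_vimage[OF closed_atLeast] by metis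
qed

text \<open>A fibre has finite volume, so a set that is uniformly expanded into it must be small.\<close>

lemma emeasure_expanded_le:
  assumes I: "finite I" "\<And>c Q. (c, Q) \<in> I \<Longrightarrow> c \<in> A \<and> compact Q \<and> Q \<subseteq> fst c" "(\<Union>i\<in>I. snd i) = UNIV"
  obtains K where "0 \<le> K" "\<And>c Q x t n. (c, Q) \<in> I \<Longrightarrow>
    emeasure lborel (snd c ` (Q \<inter> expanded x t n)) \<le> ennreal (K * exp (- t / 2) ^ DIM('e))"
proof -
  have "\<exists>k>0. \<forall>p\<in>snd i. \<forall>a. metric_form A g (fst i) p a a \<le> k * (norm a)\<^sup>2 \<and>
      (norm a)\<^sup>2 \<le> k * metric_form A g (fst i) p a a" if "i \<in> I" for i
  proof -
    have "fst i \<in> A" "compact (snd i)" "snd i \<subseteq> fst (fst i)" using I(2)[of "fst i" "snd i"] that by auto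
    then show ?thesis
      by (rule metric_form_comparable[OF smooth riemannian]) blast
  qed
  then obtain \<kappa> where \<kappa>: "\<And>i. i \<in> I \<Longrightarrow> 0 < \<kappa> i"
      "\<And>i p a. i \<in> I \<Longrightarrow> p \<in> snd i \<Longrightarrow> metric_form A g (fst i) p a a \<le> \<kappa> i * (norm a)\<^sup>2"
      "\<And>i p a. i \<in> I \<Longrightarrow> p \<in> snd i \<Longrightarrow> (norm a)\<^sup>2 \<le> \<kappa> i * metric_form A g (fst i) p a a"
    by metis
  \<comment> \<open>One constant above all \<open>\<kappa> i\<close> serves the source piece and the
    target pieces simultaneously.\<close>
  define k where "k = 1 + sum \<kappa> I"
  have k_ge: "\<kappa> i \<le> k" if "i \<in> I" for i
    using member_le_sum[of i I \<kappa>] that I(1) \<kappa>(1) by (force simp: k_def intro: less_imp_le)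
  have "0 < k" using sum_nonneg[of I \<kappa>] \<kappa>(1) by (force simp: k_def intro: less_imp_le add_pos_nonneg)
  have k: "metric_form A g c p a a \<le> k * (norm a)\<^sup>2" "(norm a)\<^sup>2 \<le> k * metric_form A g c p a a"
    if "(c, Q) \<in> I" "p \<in> Q" for c Q p a
  proof -
    have "\<kappa> (c, Q) * (norm a)\<^sup>2 \<le> k * (norm a)\<^sup>2" by (intro mult_right_mono k_ge that) auto
    then show "metric_form A g c p a a \<le> k * (norm a)\<^sup>2" using \<kappa>(2)[OF that(1), of p a] that by simp
    have "\<kappa> (c, Q) * metric_form A g c p a a \<le> k * metric_form A g c p a a"
      using metric_form_nonneg[OF smooth riemannian, of c p] I(2)[OF that(1)] that
      by (intro mult_right_mono k_ge) auto
    then show "(norm a)\<^sup>2 \<le> k * metric_form A g c p a a" using \<kappa>(3)[OF that(1), of p a] that by simp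
  qed
  have "compact (\<Union>i\<in>I. snd (fst i) ` snd i)"
  proof (intro compact_UN I(1))
    fix i assume "i \<in> I"
    then have "fst i \<in> A" "compact (snd i)" "snd i \<subseteq> fst (fst i)" using I(2)[of "fst i" "snd i"] by auto
    then show "compact (snd (fst i) ` snd i)"
      by (intro compact_continuous_image continuous_on_subset[OF continuous_chart[OF atlases(1)]])
  qed
  then have "bounded (\<Union>i\<in>I. snd (fst i) ` snd i)" by (rule compact_imp_bounded)
  then obtain R where R: "0 < R" "\<forall>x\<in>(\<Union>i\<in>I. snd (fst i) ` snd i). norm x \<le> R"
    unfolding bounded_pos by blast
  \<comment> \<open>\<open>10 = 5 * 2\<close> joins the covering constant with the factor 2 in
    \<epsilon> below; \<open>card I\<close> bounds the number of pieces into which the image is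
    cut.\<close>
  define K where "K = real (card I) * (unit_ball_vol DIM('e) * (10 * k * (R + 1)) ^ DIM('e))"
  have main: "emeasure lborel (snd c ` (Q \<inter> expanded x t n)) \<le> ennreal (K * exp (- t / 2) ^ DIM('e))"
    if cQ: "(c, Q) \<in> I" for c Q x t n
  proof -
    let ?Y = "Q \<inter> expanded x t n"
    let ?F = "fibre_map (f ^^ n) x"
    define x' where "x' = (At ^^ n) x"
    \<comment> \<open>The factor 2 gives the strict derivative bound that
      \<open>emeasure_contracting_image_le\<close> demands.\<close>
    define \<epsilon> where "\<epsilon> = 2 * k * exp (- t / 2)"
    have c: "c \<in> A" "compact Q" "Q \<subseteq> fst c" using I(2)[OF cQ] by auto
    have Y: "compact ?Y" using c closed_expanded by (intro compact_Int_closed)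
    have contF: "continuous_on UNIV ?F"
      by (rule continuous_fibre_map[OF topological_atlas_torus atlases(1) C1_iterate(1) skew_iterate])
    have fn: "(f ^^ n) (x, y) = (x', ?F y)" for y
      using skew_iterate[of n "(x, y)"] by (simp add: prod_eq_iff x'_def fibre_map_def)
    have inv: "fibre_map (inv f ^^ n) x' (?F y) = y" for y
      using inverse_iterate(1)[of n "(x, y)"] unfolding fn by (simp add: fibre_map_def[of "inv f ^^ n"])
    \<comment> \<open>\<open>h d\<close> undoes the iterate, from a target chart \<open>d\<close>
      back to \<open>c\<close>. The image in the target fibre is cut into the compact sets
      \<open>T j\<close>, all inside one ball, and their images under \<open>h\<close> cover the set
      to be measured.\<close>
    define h where "h d = snd c \<circ> fibre_map (inv f ^^ n) x' \<circ> chart_inv d" for d :: "('n, 'e) chart"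
    define T where "T j = snd (fst j) ` (snd j \<inter> ?F ` ?Y)" for j :: "('n, 'e) chart \<times> 'n set"
    have "snd c ` ?Y \<subseteq> (\<Union>j\<in>I. h (fst j) ` T j)"
    proof
      fix b assume "b \<in> snd c ` ?Y"
      then obtain y where y: "y \<in> ?Y" "b = snd c y" by auto
      obtain j where j: "j \<in> I" "?F y \<in> snd j" using I(3) by blast
      have "?F y \<in> fst (fst j)" "fst j \<in> A" using I(2)[of "fst j" "snd j"] j by auto
      then have "h (fst j) (snd (fst j) (?F y)) = b"
        by (simp add: h_def chart_inv_chart[OF atlases(1)] inv y)
      then show "b \<in> (\<Union>j\<in>I. h (fst j) ` T j)" using j y unfolding T_def by blast
    qed
    moreover have Tj: "emeasure lborel (h (fst j) ` T j) \<le>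
        ennreal (unit_ball_vol DIM('e) * (5 * \<epsilon> * (R + 1)) ^ DIM('e)) \<and> h (fst j) ` T j \<in> sets borel"
      if j: "j \<in> I" for j
    proof -
      define d where "d = fst j"
      have d: "d \<in> A" "compact (snd j)" "snd j \<subseteq> fst d" using I(2)[of "fst j" "snd j"] j by (auto simp: d_def)
      have "compact (snd j \<inter> ?F ` ?Y)"
        by (intro compact_Int d compact_continuous_image Y continuous_on_subset[OF contF]) auto
      then have compT: "compact (T j)"
        unfolding T_def d_def[symmetric]
        by (intro compact_continuous_image continuous_on_subset[OF continuous_chart[OF atlases(1) d(1)]])
          (use d in auto)
      have deriv: "\<exists>L. (h d has_derivative L) (at b within T j) \<and> onorm L < \<epsilon>" if b: "b \<in> T j" for b
      proof -
        obtain y where y: "y \<in> ?Y" "?F y \<in> snd j" "b = snd d (?F y)"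
          using b unfolding T_def d_def by blast
        have zc: "snd (x, y) \<in> fst c" "snd ((f ^^ n) (x, y)) \<in> fst d" using y c d by (auto simp: fn)
        have "(h d has_derivative inverse_deriv n d c ((f ^^ n) (x, y))) (at b)"
          using inverse_deriv_has_derivative[OF d(1) c(1), of "(f ^^ n) (x, y)" n] zc
          by (simp add: inverse_iterate) (simp add: h_def fn y)
        moreover have "onorm (inverse_deriv n d c ((f ^^ n) (x, y))) \<le> k * exp (- t / 2)"
          by (rule norm_inverse_deriv_le[OF c(1) d(1) zc \<open>0 < k\<close>])
            (use k(2)[OF cQ, of y] k(1)[of d "snd j" "?F y"] j y in \<open>auto simp: fn d_def expanded_def\<close>)
        moreover have "k * exp (- t / 2) < \<epsilon>" using \<open>0 < k\<close> by (simp add: \<epsilon>_def)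
        ultimately show ?thesis by (meson has_derivative_at_withinI le_less_trans)
      qed
      then obtain h' where h': "\<And>b. b \<in> T j \<Longrightarrow> (h d has_derivative h' b) (at b within T j)"
          "\<And>b. b \<in> T j \<Longrightarrow> onorm (h' b) < \<epsilon>"
        by metis
      have "T j \<subseteq> cball 0 R" using R(2) j by (auto simp: T_def)
      then have "emeasure lborel (h d ` T j) \<le> ennreal (unit_ball_vol DIM('e) * (5 * \<epsilon> * (R + 1)) ^ DIM('e))"
        using h' R(1) by (intro emeasure_contracting_image_le[OF compT]) auto
      moreover have "compact (h d ` T j)"
        by (intro compact_continuous_image compT has_derivative_continuous_on[OF h'(1)])
      ultimately show ?thesis by (auto simp: d_def borel_compact)
    qed
    ultimately have "emeasure lborel (snd c ` ?Y) \<le> emeasure lborel (\<Union>j\<in>I. h (fst j) ` T j)"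
      by (intro emeasure_mono) (use I(1) in auto)
    also have "\<dots> \<le> (\<Sum>j\<in>I. emeasure lborel (h (fst j) ` T j))"
      by (rule emeasure_subadditive_finite) (use I(1) Tj in auto)
    also have "\<dots> \<le> (\<Sum>j\<in>I. ennreal (unit_ball_vol DIM('e) * (5 * \<epsilon> * (R + 1)) ^ DIM('e)))"
      by (rule sum_mono) (use Tj in auto)
    also have "\<dots> = ennreal (K * exp (- t / 2) ^ DIM('e))"
    proof -
      have "(5 * \<epsilon> * (R + 1)) ^ DIM('e) = (10 * k * (R + 1)) ^ DIM('e) * exp (- t / 2) ^ DIM('e)"
        unfolding power_mult_distrib[symmetric] by (simp add: \<epsilon>_def algebra_simps)
      then show ?thesis
        by (simp add: K_def ennreal_of_nat_eq_real_of_nat ennreal_mult'[symmetric] mult.assoc)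
    qed
    finally show ?thesis .
  qed
  have "0 \<le> K" using \<open>0 < k\<close> R(1) by (simp add: K_def)
  with main that show thesis by blast
qed

text \<open>Every point of \<open>S\<close> passes the level \<open>t\<close> for good, at a time
  depending on the point. Sorting by this time writes \<open>S\<close> as an increasing union of
  sets, each inside one expanded set whose bound does not depend on the time; then \<open>t\<close>
  tends to infinity.\<close>

lemma null_slice:
  assumes I: "finite I" "\<And>c Q. (c, Q) \<in> I \<Longrightarrow> c \<in> A \<and> compact Q \<and> Q \<subseteq> fst c" "(\<Union>i\<in>I. snd i) = UNIV"
    and cQ: "(c, Q) \<in> I" and X: "X \<subseteq> snd c ` (Q \<inter> S)"
    and S: "\<And>y. y \<in> S \<Longrightarrow> filterlim (\<lambda>k. min_growth (\<nu> k) (x, y)) at_top sequentially"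
  shows "emeasure lborel X = 0"
proof -
  obtain K where K: "0 \<le> K" "\<And>c Q x t n. (c, Q) \<in> I \<Longrightarrow>
      emeasure lborel (snd c ` (Q \<inter> expanded x t n)) \<le> ennreal (K * exp (- t / 2) ^ DIM('e))"
    using emeasure_expanded_le[OF I] by blast
  have c: "c \<in> A" "compact Q" "Q \<subseteq> fst c" using I(2)[OF cQ] by auto
  have le: "emeasure lborel X \<le> ennreal (K * exp (- t / 2) ^ DIM('e))" for t
  proof -
    \<comment> \<open>The points expanded at all sampled times from \<open>k\<close> on. These sets
      are compact, whereas nothing is known about the measurability of \<open>S\<close>.\<close>
    define Z where "Z k = snd c ` (Q \<inter> (\<Inter>j\<in>{k..}. expanded x t (\<nu> j)))" for k
    have "compact (Q \<inter> (\<Inter>j\<in>{k..}. expanded x t (\<nu> j)))" for k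
      by (intro compact_Int_closed c closed_INT ballI closed_expanded)
    then have "compact (Z k)" for k
      unfolding Z_def
      by (intro compact_continuous_image continuous_on_subset[OF continuous_chart[OF atlases(1) c(1)]])
        (use c in auto)
    then have Z: "range Z \<subseteq> sets lborel" by (auto intro: borel_compact)
    have inc: "incseq Z" unfolding Z_def by (intro incseq_SucI image_mono) auto
    have "X \<subseteq> (\<Union>k. Z k)"
    proof
      fix b assume "b \<in> X"
      then obtain y where y: "y \<in> Q" "y \<in> S" "b = snd c y" using X by auto
      have "eventually (\<lambda>k. t \<le> min_growth (\<nu> k) (x, y)) sequentially"
        using S[OF y(2)] by (simp add: filterlim_at_top)
      then obtain k where "\<And>j. k \<le> j \<Longrightarrow> t \<le> min_growth (\<nu> j) (x, y)"
        by (auto simp: eventually_sequentially)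
      then show "b \<in> (\<Union>k. Z k)" using y by (auto simp: Z_def expanded_def)
    qed
    then have "emeasure lborel X \<le> emeasure lborel (\<Union>k. Z k)"
      by (rule emeasure_mono) (use Z in auto)
    also have "\<dots> = (SUP k. emeasure lborel (Z k))"
      by (rule SUP_emeasure_incseq[OF Z inc, symmetric])
    also have "\<dots> \<le> ennreal (K * exp (- t / 2) ^ DIM('e))"
    proof (rule SUP_least)
      fix k
      have "compact (Q \<inter> expanded x t (\<nu> k))" by (intro compact_Int_closed c closed_expanded)
      then have "compact (snd c ` (Q \<inter> expanded x t (\<nu> k)))"
        by (intro compact_continuous_image continuous_on_subset[OF continuous_chart[OF atlases(1) c(1)]])
          (use c in auto)
      then have "emeasure lborel (Z k) \<le> emeasure lborel (snd c ` (Q \<inter> expanded x t (\<nu> k)))"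
        unfolding Z_def by (intro emeasure_mono image_mono) (auto intro: borel_compact)
      also have "\<dots> \<le> ennreal (K * exp (- t / 2) ^ DIM('e))" by (rule K(2)[OF cQ])
      finally show "emeasure lborel (Z k) \<le> ennreal (K * exp (- t / 2) ^ DIM('e))" .
    qed
    finally show ?thesis .
  qed
  \<comment> \<open>Levels \<open>t = 2 * j\<close>, which turn the exponent into
    \<open>- j\<close>; the power tends to 0 because the dimension is positive.\<close>
  have "(\<lambda>j. K * exp (- (2 * real j) / 2) ^ DIM('e)) \<longlonglongrightarrow> K * 0 ^ DIM('e)"
  proof (intro tendsto_intros)
    have "(\<lambda>j. exp (- real j)) \<longlonglongrightarrow> 0"
      using filterlim_compose[OF exp_at_bot filterlim_compose[OF filterlim_uminus_at_bot_at_top filterlim_real_sequentially]]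
      by simp
    then show "(\<lambda>j. exp (- (2 * real j) / 2)) \<longlonglongrightarrow> 0" by simp
  qed
  then have "(\<lambda>j. ennreal (K * exp (- (2 * real j) / 2) ^ DIM('e))) \<longlonglongrightarrow> ennreal 0"
    by (intro tendsto_ennrealI) (simp add: power_0_left)
  then have "emeasure lborel X \<le> ennreal 0"
    by (rule LIMSEQ_le_const) (use le in blast)
  then show ?thesis by simp
qed

text \<open>Fubini needs a Borel set and the basin is not known to be one, hence the Borel superset
  \<open>B\<close>. In each product chart the slices over the base coordinates are null, so the
  image of \<open>B\<close> is Lebesgue null and every volume density integrates to 0 over
  it.\<close>

lemma riemannian_volume_expanded_eq_0:
  assumes B: "B \<in> sets borel"
    and grow: "\<And>z. z \<in> B \<Longrightarrow> filterlim (\<lambda>k. min_growth (\<nu> k) z) at_top sequentially"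
    and "S \<subseteq> B"
  shows "riemannian_volume (total_atlas A) G S = 0"
proof -
  obtain I where I: "finite I" "\<And>c Q. (c, Q) \<in> I \<Longrightarrow> c \<in> A \<and> compact Q \<and> Q \<subseteq> fst c"
    "(\<Union>i\<in>I. snd i) = (UNIV :: 'n set)"
    using compact_chart_pieces[OF compact_fibre atlases(1)] by metis
  obtain J where J: "finite J" "J \<subseteq> torus_atlas" "(UNIV :: torus2 set) \<subseteq> (\<Union>c\<in>J. fst c)"
    by (rule compactE_image[OF compact_torus, of torus_atlas fst])
      (use chart_open(1)[OF topological_atlas_torus] topological_atlas_torus in
        \<open>auto simp: topological_atlas_def\<close>)
  define piece where "piece i = (prod_chart (fst i) (fst (snd i)), B \<inter> fst (fst i) \<times> snd (snd i))"
    for i :: "(torus2, real \<times> real) chart \<times> ('n, 'e) chart \<times> 'n set"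
  have piece: "fst (piece i) \<in> total_atlas A \<and> snd (piece i) \<in> sets borel \<and>
      snd (piece i) \<subseteq> fst (fst (piece i)) \<and> chart_volume (total_atlas A) G (fst (piece i)) (snd (piece i)) = 0"
    if "i \<in> J \<times> I" for i
  proof -
    define c1 c Q where "c1 = fst i" and "c = fst (snd i)" and "Q = snd (snd i)"
    then have i: "i = (c1, c, Q)" and c1J: "c1 \<in> J" and cQ: "(c, Q) \<in> I"
      using that by (simp_all add: mem_Times_iff)
    have c1: "c1 \<in> torus_atlas" using c1J J by auto
    have c: "c \<in> A" "compact Q" "Q \<subseteq> fst c" using I(2)[OF cQ] by auto
    let ?P = "prod_chart c1 c" and ?D = "B \<inter> fst c1 \<times> Q"
    have P: "?P \<in> total_atlas A" using c1 c by (auto simp: prod_atlas_eq simp del: split_paired_Ex)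
    have "fst c1 \<times> Q = (fst -` fst c1) \<inter> (snd -` Q)" by auto
    moreover have "open (fst -` fst c1 :: (torus2 \<times> 'n) set)"
      by (intro open_vimage chart_open(1)[OF topological_atlas_torus c1] continuous_intros)
    moreover have "closed (snd -` Q :: (torus2 \<times> 'n) set)"
      by (intro closed_vimage compact_imp_closed c continuous_intros)
    ultimately have D: "?D \<in> sets borel" using B by auto
    have sub: "?D \<subseteq> fst ?P" using c by auto
    define X where "X = snd ?P ` ?D"
    have X: "X \<in> sets (borel :: ((real \<times> real) \<times> 'e) measure)"
      unfolding X_def by (rule chart_image_measurable[OF atlases(2) P D sub])
    \<comment> \<open>A torus coordinate \<open>s\<close> in the chart image belongs to exactly one
      base point \<open>x\<close>, so the slice lies in a single fibre.\<close>
    have slice: "emeasure lborel (Pair s -` X) = 0" for s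
    proof (cases "s \<in> snd c1 ` fst c1")
      case True
      then obtain x where x: "x \<in> fst c1" "s = snd c1 x" by auto
      have slice_sub: "Pair s -` X \<subseteq> snd c ` (Q \<inter> {y. (x, y) \<in> B})"
      proof
        fix a assume "a \<in> Pair s -` X"
        then obtain x' y where xy: "(x', y) \<in> B" "x' \<in> fst c1" "y \<in> Q" "s = snd c1 x'" "a = snd c y"
          by (auto simp: X_def)
        have "x' = x"
          using chart_inv_chart[OF topological_atlas_torus c1 x(1)]
            chart_inv_chart[OF topological_atlas_torus c1 xy(2)] x(2) xy(4) by simp
        then show "a \<in> snd c ` (Q \<inter> {y. (x, y) \<in> B})" using xy by auto
      qed
      show ?thesis
      proof (rule null_slice[where I = I and c = c and Q = Q and \<nu> = \<nu> and x = x])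
        show "Pair s -` X \<subseteq> snd c ` (Q \<inter> {y. (x, y) \<in> B})" by (rule slice_sub)
      qed (use I cQ grow in auto)
    next
      case False
      then have "Pair s -` X = {}" by (auto simp: X_def)
      then show ?thesis by simp
    qed
    have "emeasure lborel X = emeasure (lborel \<Otimes>\<^sub>M lborel) X" by (simp add: lborel_prod)
    also have "\<dots> = (\<integral>\<^sup>+s. emeasure lborel (Pair s -` X) \<partial>lborel)"
    proof (rule lborel.emeasure_pair_measure_alt)
      show "X \<in> sets (lborel \<Otimes>\<^sub>M lborel)" unfolding lborel_prod using X by simp
    qed
    finally have "emeasure lborel X = 0" by (simp add: slice)
    then have "X \<in> null_sets lborel" using X by auto
    then have "AE q in lborel. q \<notin> X" by (rule AE_not_in)
    then have "chart_volume (total_atlas A) G ?P ?D = (\<integral>\<^sup>+q. 0 \<partial>(lborel :: ((real \<times> real) \<times> 'e) measure))"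
      unfolding chart_volume_def X_def[symmetric] by (intro nn_integral_cong_AE) (auto simp: indicator_def)
    then show ?thesis using P D sub by (simp add: i piece_def)
  qed
  have ne: "J \<times> I \<noteq> {}" using J(3) I(3) by auto
  have fin: "countable (J \<times> I)" using J I by (intro countable_finite) auto
  \<comment> \<open>\<open>riemannian_volume\<close> is an infimum over sequences, so the finite
    family is enumerated with repetitions, harmless as all volumes are 0.\<close>
  define P where "P n = piece (from_nat_into (J \<times> I) n)" for n
  have P: "fst (P n) \<in> total_atlas A \<and> snd (P n) \<in> sets borel \<and> snd (P n) \<subseteq> fst (fst (P n)) \<and>
      chart_volume (total_atlas A) G (fst (P n)) (snd (P n)) = 0" for n
    unfolding P_def by (rule piece[OF from_nat_into[OF ne]])
  have cover: "S \<subseteq> (\<Union>n. snd (P n))"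
  proof
    fix z assume "z \<in> S"
    then have "z \<in> B" using \<open>S \<subseteq> B\<close> by auto
    obtain c1 where c1: "c1 \<in> J" "fst z \<in> fst c1" using J(3) by blast
    obtain i where i: "i \<in> I" "snd z \<in> snd i" using I(3) by blast
    have "(c1, i) \<in> J \<times> I" using c1 i by auto
    then obtain n where n: "from_nat_into (J \<times> I) n = (c1, i)"
      using from_nat_into_surj[OF fin] by blast
    have "z \<in> snd (P n)" using \<open>z \<in> B\<close> c1 i by (simp add: P_def n piece_def mem_Times_iff)
    then show "z \<in> (\<Union>n. snd (P n))" by blast
  qed
  have "riemannian_volume (total_atlas A) G S \<le>
      (\<Sum>n. chart_volume (total_atlas A) G (fst (P n)) (snd (P n)))"
    unfolding riemannian_volume_def by (rule INF_lower) (use P cover in auto)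
  also have "\<dots> = 0" using P by simp
  finally show ?thesis by simp
qed

lemma no_physical_measure:
  assumes "physical_measure (total_atlas A) G f \<mu>" and "fibre_exponents_positive A g f \<mu>"
  shows False
proof -
  have \<mu>: "prob_space \<mu>" "sets \<mu> = sets borel" "distr \<mu> borel f = \<mu>"
    and vol: "0 < riemannian_volume (total_atlas A) G (basin f \<mu>)"
    using assms(1) by (auto simp: physical_measure_def)
  obtain m where m: "0 < m" "0 < (\<integral>z. min_growth m z \<partial>\<mu>)"
    using integral_min_growth_pos[OF \<mu> exponents_positive_imp[OF assms(2)]] by blast
  let ?avg = "\<lambda>n z. (\<Sum>j<n. min_growth m ((f ^^ j) z)) / real n"
  \<comment> \<open>Testing with the single function \<open>min_growth m\<close> gives a Borel set
    around the basin, which is defined through all continuous functions.\<close>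
  define B where "B = {z. (\<lambda>n. ?avg n z) \<longlonglongrightarrow> (\<integral>z. min_growth m z \<partial>\<mu>)}"
  have "basin f \<mu> \<subseteq> B" using continuous_min_growth by (auto simp: basin_def B_def)
  moreover have "B \<in> sets borel"
  proof -
    have [measurable]: "?avg n \<in> borel_measurable borel" for n
    proof -
      have "continuous_on UNIV (\<lambda>z. min_growth m ((f ^^ j) z))" for j
        by (rule continuous_on_compose2[OF continuous_min_growth continuous_iterate]) auto
      then show ?thesis
        by (intro borel_measurable_divide borel_measurable_sum borel_measurable_continuous_onI) auto
    qed
    have "{z \<in> space borel. (\<lambda>n. ?avg n z) \<longlonglongrightarrow> (\<integral>z. min_growth m z \<partial>\<mu>)} \<in> sets borel"
      by measurable
    then show ?thesis by (simp add: B_def)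
  qed
  ultimately have "riemannian_volume (total_atlas A) G (basin f \<mu>) = 0"
    using min_growth_tendsto_infinity[OF m]
    by (intro riemannian_volume_expanded_eq_0[where \<nu> = "\<lambda>k. m * k + m"]) (auto simp: B_def)
  then show False using vol by simp
qed

end

theorem proposition1p2:
  fixes A :: "('n::{t2_space, second_countable_topology}, 'e::euclidean_space) chart set"
    and g :: "('n, 'e) metric"
    and At :: "torus2 \<Rightarrow> torus2"
    and K :: "torus2 \<times> 'n \<Rightarrow> 'n"
    and f :: "torus2 \<times> 'n \<Rightarrow> torus2 \<times> 'n"
  assumes "compact (UNIV :: 'n set)"
    and "smooth_atlas A"
    and "riemannian_metric A g"
    and "C1_diffeo torus_atlas At"
    and "\<And>x y. f (x, y) = (At x, K (x, y))"
    and "C1plus_diffeo (total_atlas A) f"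
  shows "\<not> (\<exists>\<mu>. physical_measure (total_atlas A) (total_metric A g) f \<mu> \<and>
              fibre_exponents_positive A g f \<mu>)"
proof -
  interpret skew_product A g At f
  proof
    show "fst (f z) = At (fst z)" for z using assms(5)[of "fst z" "snd z"] by simp
    show "C1_diffeo (total_atlas A) f"
      using assms(6) by (simp add: C1plus_diffeo_def C1plus_map_def C1_diffeo_def)
  qed (fact assms)+
  show ?thesis using no_physical_measure by blast
qed

end
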